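(* Let $T>0$, let $V$ be a probability vector field satisfying: (H1) there is $C>0$ such that for all $\mu\in\mathcal P_c(\mathbb R^d)$, $\sup_{(x,v)\in\operatorname{supp}V[\mu]}|v|\le C\bigl(1+\sup_{x\in\operatorname{supp}\mu}|x|\bigr)$; (H2) the map $V:\mathcal P_c(\mathbb R^d)\to\mathcal P_c(T\mathbb R^d)$ is continuous. Let $\mu_0\in\mathcal P_c(\mathbb R^d)$, and let $\boldsymbol\mu=\{\mu_t\}_{t\in[0,T]}$ be a solution of $\dot\mu_t=V[\mu_t]$, $\mu_{t=0}=\mu_0$, obtained as uniform-in-time limit, for the Wasserstein metric, of the Lattice Approximate Solutions $\{\boldsymbol\mu^N\}_N$ (i.e. $\sup_{t\in[0,T]}W(\mu^N_t,\mu_t)\to0$). Let $\boldsymbol\eta^N\in\mathcal P(\Gamma_{[0,T]})$ be the measures constructed from $\boldsymbol\mu^N$ as in the context. Then: (1) $\boldsymbol\eta^N$ is a probabilistic representation for $\boldsymbol\mu^N$, i.e. $\mu^N_t=e_t\sharp\boldsymbol\eta^N$ for all $t\in[0,T]$; (2) up to subsequences, $\boldsymbol\eta^N\rightharpoonup^*\boldsymbol\eta$ for some $\boldsymbol\eta\in\mathcal P(\Gamma_{[0,T]})$, and $\boldsymbol\eta$ is a probabilistic representation for $\boldsymbol\mu$, i.e. $\mu_t=e_t\sharp\boldsymbol\eta$ for all $t\in[0,T]$.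
   Context: Notation: $\mathcal P(X)$ (resp. $\mathcal P_c(X)$) is the set of Borel probability measures on $X$ (resp. with compact support); $\mathcal P_c(X)$ carries the 1-Wasserstein distance $W=W^X$; $T\mathbb R^d=\mathbb R^d\times\mathbb R^d$ with elements $(x,v)$; $\pi_1(x,v)=x$; $\sharp$ is push-forward. For a compact interval $I$, $\Gamma_I$ is the space of continuous curves $I\to\mathbb R^d$ with the sup norm, and $e_t(\gamma)=\gamma(t)$, $t\in I$. $\rightharpoonup^*$ is narrow convergence (tested against bounded continuous functions). A probability vector field (PVF) is a map $V:\mathcal P(\mathbb R^d)\to\mathcal P(T\mathbb R^d)$ with $\pi_1\sharp V[\mu]=\mu$. Solution of $\dot\mu_t=V[\mu_t]$, $\mu_{t=0}=\mu_0$: a map $t\mapsto\mu_t\in\mathcal P(\mathbb R^d)$ with $\mu_{t=0}=\mu_0$ such that for every $f\in C_c^\infty(\mathbb R^d)$, $\int_{T\mathbb R^d}\nabla f(x)\cdot v\,dV[\mu_t](x,v)$ is defined for a.e. $t$ and in $L^1([0,T])$, $t\mapsto\int f\,d\mu_t$ is absolutely continuous, and $\frac{d}{dt}\int f\,d\mu_t=\int_{T\mathbb R^d}\nabla f(x)\cdot v\,dV[\mu_t](x,v)$ for a.e. $t$. Lattice Approximate Solutions (LAS). For $N\ge1$ let $\Delta_N=T/N$, $\Delta^v_N=1/N$, $\Delta^x_N=T/N^2$. Let $x_i$ be the points of $\frac{T}{N^2}\mathbb Z^d\cap[-TN,TN]^d$ and $v_j$ those of $\frac1N\mathbb Z^d\cap[-N,N]^d$;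 $Q=[0,\frac{T}{N^2})^d$, $Q'=[0,\frac1N)^d$. Set $m^x_i(\mu)=\mu(x_i+Q)$, $m^v_{ij}(V[\mu])=V[\mu](\{(x_i,v):v\in v_j+Q'\})$. Define $\mu^N_0=\sum_i m^x_i(\mu_0)\delta_{x_i}$ and, recursively for $k=0,\dots,N-1$ and $t\in[0,\Delta_N]$, $$\mu^N_{k\Delta_N+t}=\sum_{i,j}m^v_{ij}(V[\mu^N_{k\Delta_N}])\,\delta_{x_i+t v_j}.$$ Throughout, $N$ is taken large enough that (by (H1) and compactness of $\operatorname{supp}\mu_0$) no mass leaves the grids, so each $\mu^N_t$ is a probability measure. Construction of $\boldsymbol\eta^N$. For integers $a\le b$ let $I_a^b=[a\Delta_N,b\Delta_N]$. For $\gamma_1\in\Gamma_{I_1}$, $\gamma_2\in\Gamma_{I_2}$ with $\max I_1=\min I_2$ and $\gamma_1(\max I_1)=\gamma_2(\min I_2)$, let $\gamma_1\star\gamma_2\in\Gamma_{I_1\cup I_2}$ be the concatenation (equal to $\gamma_1$ on $I_1$ and $\gamma_2$ on $I_2$), and let $M_{I_1,I_2}(\gamma_1,\gamma_2)=\gamma_1\star\gamma_2$ be the merge map on such compatible pairs. (a) For $\ell=0,\dots,N-1$: $\boldsymbol\eta^N_{I_\ell^{\ell+1}}=\sum_{i,j}m^v_{ij}(V[\mu^N_{\ell\Delta_N}])\,\delta_{\gamma^\ell_{i,j}}\in\mathcal P(\Gamma_{I_\ell^{\ell+1}})$, where $\gamma^\ell_{i,j}(t)=x_i+(t-\ell\Delta_N)v_j$.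 (b) Recursively for $h=1,\dots,N-1$: $\boldsymbol\eta^N_{I_0^{h+1}}\in\mathcal P(\Gamma_{I_0^{h+1}})$ is defined by $$\int\varphi\,d\boldsymbol\eta^N_{I_0^{h+1}}=\int_{\mathbb R^d}\left(\int\varphi\,d\Bigl[M_{I_0^h,I_h^{h+1}}\sharp\bigl(\eta^N_{I_0^h,x}\otimes\eta^N_{I_h^{h+1},x}\bigr)\Bigr]\right)d\mu^N_{h\Delta_N}(x)$$ for bounded Borel $\varphi:\Gamma_{I_0^{h+1}}\to\mathbb R$, where $\eta^N_{I_0^h,x}$ and $\eta^N_{I_h^{h+1},x}$ are the disintegrations of $\boldsymbol\eta^N_{I_0^h}$ and $\boldsymbol\eta^N_{I_h^{h+1}}$ with respect to $e_{h\Delta_N}$. (c) $\boldsymbol\eta^N:=\boldsymbol\eta^N_{I_0^N}\in\mathcal P(\Gamma_{[0,T]})$. *)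

theory Defs
  imports "HOL-Probability.Probability"
begin

section \<open>Borel probability measures\<close>

definition borel_of :: "'a topology \<Rightarrow> 'a measure" where
  "borel_of X = sigma (topspace X) {U. openin X U}"

abbreviation probs :: "'a measure \<Rightarrow> 'a measure set" where
  "probs M \<equiv> space (prob_algebra M)"

text \<open>\<^term>\<open>probs M\<close> is the set of probability measures on the sigma-algebra of \<^term>\<open>M\<close>
  (lemma \<open>space_prob_algebra\<close>); only that sigma-algebra and not the values of \<^term>\<open>M\<close> matter.\<close>

definition msupport :: "'a::topological_space measure \<Rightarrow> 'a set" where
  "msupport \<mu> = {x. \<forall>U. open U \<longrightarrow> x \<in> U \<longrightarrow> emeasure \<mu> U > 0}"

definition probs_c :: "'a::topological_space measure set" where
  "probs_c = {\<mu> \<in> probs borel. compact (msupport \<mu>)}"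

definition narrowly_converges ::
    "'a topology \<Rightarrow> (nat \<Rightarrow> 'a measure) \<Rightarrow> 'a measure \<Rightarrow> bool" where
  "narrowly_converges X M L \<longleftrightarrow>
     (\<forall>\<phi> :: 'a \<Rightarrow> real. continuous_map X euclideanreal \<phi> \<longrightarrow> bounded (\<phi> ` topspace X) \<longrightarrow>
        (\<lambda>n. \<integral>x. \<phi> x \<partial>M n) \<longlonglongrightarrow> (\<integral>x. \<phi> x \<partial>L))"

definition couplings :: "'a::topological_space measure \<Rightarrow> 'a measure \<Rightarrow> ('a \<times> 'a) measure set" where
  "couplings \<mu> \<nu> = {\<pi> \<in> probs borel. distr \<pi> borel fst = \<mu> \<and> distr \<pi> borel snd = \<nu>}"

text \<open>The 1-Wasserstein distance is extended-valued, so that it makes sense for arbitrary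
  measures; on \<^term>\<open>probs_c\<close> it is finite. It is infinite if no coupling exists, in particular
  if one argument is not a probability measure.\<close>

definition wasserstein :: "'a::metric_space measure \<Rightarrow> 'a measure \<Rightarrow> ennreal" where
  "wasserstein \<mu> \<nu> = (INF \<pi>\<in>couplings \<mu> \<nu>. \<integral>\<^sup>+p. ennreal (dist (fst p) (snd p)) \<partial>\<pi>)"

text \<open>The finite sum of Dirac masses \<open>\<Sum>i\<in>I. w i \<cdot> \<delta>\<^bsub>p i\<^esub>\<close> as a measure on the
  sigma-algebra of \<^term>\<open>M\<close>.\<close>

definition dirac_sum :: "'a measure \<Rightarrow> 'i set \<Rightarrow> ('i \<Rightarrow> ennreal) \<Rightarrow> ('i \<Rightarrow> 'a) \<Rightarrow> 'a measure" where
  "dirac_sum M I w p = distr (point_measure I w) M p"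

lemma emeasure_dirac_sum:
  assumes "finite I" "p \<in> I \<rightarrow> space M" "A \<in> sets M"
  shows "emeasure (dirac_sum M I w p) A = (\<Sum>i\<in>I. w i * emeasure (return M (p i)) A)"
proof -
  have "emeasure (dirac_sum M I w p) A = emeasure (point_measure I w) (p -` A \<inter> I)"
    using assms by (simp add: dirac_sum_def emeasure_distr space_point_measure)
  also have "\<dots> = (\<Sum>i\<in>p -` A \<inter> I. w i)"
    using assms by (simp add: emeasure_point_measure_finite)
  also have "\<dots> = (\<Sum>i\<in>I. w i * indicator A (p i))"
    using assms(1) by (intro sum.mono_neutral_cong_left) (auto simp: indicator_def)
  finally show ?thesis
    using assms(3) by simp
qed

section \<open>Probability vector fields and their solutions\<close>

text \<open>A probability vector field is a map on all measures of which only the values on Borel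
  probability measures are relevant. The tangent bundle is the product type.\<close>

definition pvf :: "((real^'d) measure \<Rightarrow> ((real^'d) \<times> (real^'d)) measure) \<Rightarrow> bool" where
  "pvf V \<longleftrightarrow> (\<forall>\<mu>\<in>probs borel. V \<mu> \<in> probs borel \<and> distr (V \<mu>) borel fst = \<mu>)"

text \<open>The suprema are taken in \<^typ>\<open>ennreal\<close>, hence need no boundedness proviso.\<close>

definition pvf_growth :: "((real^'d) measure \<Rightarrow> ((real^'d) \<times> (real^'d)) measure) \<Rightarrow> bool" where
  "pvf_growth V \<longleftrightarrow> (\<exists>C>0. \<forall>\<mu>\<in>probs_c.
     (SUP p\<in>msupport (V \<mu>). ennreal (norm (snd p)))
       \<le> ennreal C * (1 + (SUP x\<in>msupport \<mu>. ennreal (norm x))))"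

definition pvf_continuous :: "((real^'d) measure \<Rightarrow> ((real^'d) \<times> (real^'d)) measure) \<Rightarrow> bool" where
  "pvf_continuous V \<longleftrightarrow> (\<forall>\<mu>\<in>probs_c. V \<mu> \<in> probs_c) \<and>
     (\<forall>\<mu>\<in>probs_c. \<forall>\<epsilon>>0. \<exists>\<delta>>0. \<forall>\<nu>\<in>probs_c.
        wasserstein \<nu> \<mu> < \<delta> \<longrightarrow> wasserstein (V \<nu>) (V \<mu>) < \<epsilon>)"

text \<open>\<open>C\<^sup>k\<close> functions: the derivative in every direction exists and is \<open>C\<^bsup>k-1\<^esup>\<close>.\<close>

primrec Ck :: "nat \<Rightarrow> ('a::real_normed_vector \<Rightarrow> real) \<Rightarrow> bool" where
  "Ck 0 f \<longleftrightarrow> continuous_on UNIV f"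
| "Ck (Suc k) f \<longleftrightarrow> (\<forall>x. f differentiable (at x)) \<and>
     (\<forall>v. Ck k (\<lambda>x. frechet_derivative f (at x) v))"

definition test_function :: "(real^'d \<Rightarrow> real) \<Rightarrow> bool" where
  "test_function f \<longleftrightarrow> (\<forall>k. Ck k f) \<and> compact (closure {x. f x \<noteq> 0})"

definition gradient :: "('a::real_inner \<Rightarrow> real) \<Rightarrow> 'a \<Rightarrow> 'a" where
  "gradient f x = (THE D. GDERIV f x :> D)"

definition absolutely_continuous_on :: "real \<Rightarrow> real \<Rightarrow> (real \<Rightarrow> real) \<Rightarrow> bool" where
  "absolutely_continuous_on a b f \<longleftrightarrow> (\<forall>\<epsilon>>0. \<exists>\<delta>>0. \<forall>D.
     finite D \<longrightarrow> (\<forall>(c, d)\<in>D. a \<le> c \<and> c \<le> d \<and> d \<le> b) \<longrightarrow>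
     disjoint_family_on (\<lambda>(c, d). {c<..<d}) D \<longrightarrow>
     (\<Sum>(c, d)\<in>D. d - c) < \<delta> \<longrightarrow> (\<Sum>(c, d)\<in>D. \<bar>f d - f c\<bar>) < \<epsilon>)"

definition pvf_solution ::
    "real \<Rightarrow> ((real^'d) measure \<Rightarrow> ((real^'d) \<times> (real^'d)) measure) \<Rightarrow> (real^'d) measure
      \<Rightarrow> (real \<Rightarrow> (real^'d) measure) \<Rightarrow> bool" where
  "pvf_solution T V \<mu>0 \<mu> \<longleftrightarrow>
     (\<forall>t\<in>{0..T}. \<mu> t \<in> probs borel) \<and> \<mu> 0 = \<mu>0 \<and>
     (\<forall>f. test_function f \<longrightarrow>
        (AE t in lebesgue_on {0..T}. integrable (V (\<mu> t)) (\<lambda>(x, v). gradient f x \<bullet> v)) \<and>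
        integrable (lebesgue_on {0..T}) (\<lambda>t. \<integral>(x, v). gradient f x \<bullet> v \<partial>V (\<mu> t)) \<and>
        absolutely_continuous_on 0 T (\<lambda>t. \<integral>x. f x \<partial>\<mu> t) \<and>
        (AE t in lebesgue_on {0..T}.
           ((\<lambda>s. \<integral>x. f x \<partial>\<mu> s) has_real_derivative (\<integral>(x, v). gradient f x \<bullet> v \<partial>V (\<mu> t)))
             (at t within {0..T})))"

section \<open>Lattice Approximate Solutions\<close>

definition lattice :: "real \<Rightarrow> real \<Rightarrow> (real^'d) set" where
  "lattice h R = {x. \<forall>i. (\<exists>k::int. x $ i = h * of_int k) \<and> -R \<le> x $ i \<and> x $ i \<le> R}"

definition cell :: "real^'d \<Rightarrow> real \<Rightarrow> (real^'d) set" where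
  "cell a h = (\<lambda>q. a + q) ` {q. \<forall>i. 0 \<le> q $ i \<and> q $ i < h}"

definition xgrid :: "real \<Rightarrow> nat \<Rightarrow> (real^'d) set" where
  "xgrid T N = lattice (T / real N ^ 2) (T * real N)"

definition vgrid :: "nat \<Rightarrow> (real^'d) set" where
  "vgrid N = lattice (1 / real N) (real N)"

text \<open>Grid points are used as their own indices; \<^term>\<open>mv V N \<mu> (x, v)\<close> is the weight of the
  pair of grid points \<^term>\<open>x\<close> and \<^term>\<open>v\<close>.\<close>

definition mv :: "((real^'d) measure \<Rightarrow> ((real^'d) \<times> (real^'d)) measure) \<Rightarrow> nat \<Rightarrow> (real^'d) measure
    \<Rightarrow> (real^'d) \<times> (real^'d) \<Rightarrow> ennreal" where
  "mv V N \<mu> = (\<lambda>(x, v). emeasure (V \<mu>) {(x, w) | w. w \<in> cell v (1 / real N)})"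

definition LAS_initial :: "real \<Rightarrow> (real^'d) measure \<Rightarrow> nat \<Rightarrow> (real^'d) measure" where
  "LAS_initial T \<mu>0 N =
     dirac_sum borel (xgrid T N) (\<lambda>x. emeasure \<mu>0 (cell x (T / real N ^ 2))) (\<lambda>x. x)"

definition LAS_step ::
    "real \<Rightarrow> ((real^'d) measure \<Rightarrow> ((real^'d) \<times> (real^'d)) measure) \<Rightarrow> nat
      \<Rightarrow> (real^'d) measure \<Rightarrow> real \<Rightarrow> (real^'d) measure" where
  "LAS_step T V N \<mu> t =
     dirac_sum borel (xgrid T N \<times> vgrid N) (mv V N \<mu>) (\<lambda>(x, v). x + t *\<^sub>R v)"

definition tick :: "real \<Rightarrow> nat \<Rightarrow> nat \<Rightarrow> real" where
  "tick T N k = real k * (T / real N)"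

text \<open>\<^term>\<open>LAS_node T V \<mu>0 N k\<close> is the Lattice Approximate Solution at time \<^term>\<open>tick T N k\<close>.\<close>

primrec LAS_node ::
    "real \<Rightarrow> ((real^'d) measure \<Rightarrow> ((real^'d) \<times> (real^'d)) measure) \<Rightarrow> (real^'d) measure
      \<Rightarrow> nat \<Rightarrow> nat \<Rightarrow> (real^'d) measure" where
  "LAS_node T V \<mu>0 N 0 = LAS_initial T \<mu>0 N"
| "LAS_node T V \<mu>0 N (Suc k) = LAS_step T V N (LAS_node T V \<mu>0 N k) (T / real N)"

text \<open>The formula for the piece starting at node \<open>k\<close> is used for local times in \<open>]0, T/N]\<close>.
  At local time 0 it reproduces the value at node \<open>k\<close> as soon as no mass leaves the grids.\<close>

definition LAS ::
    "real \<Rightarrow> ((real^'d) measure \<Rightarrow> ((real^'d) \<times> (real^'d)) measure) \<Rightarrow> (real^'d) measure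
      \<Rightarrow> nat \<Rightarrow> real \<Rightarrow> (real^'d) measure" where
  "LAS T V \<mu>0 N t =
     (if t \<le> 0 then LAS_initial T \<mu>0 N
      else let k = nat \<lceil>t / (T / real N)\<rceil> - 1
           in LAS_step T V N (LAS_node T V \<mu>0 N k) (t - tick T N k))"

lemma LAS_piece:
  assumes "T > 0" "N \<ge> 1" "0 < t" "t \<le> T / real N"
  shows "LAS T V \<mu>0 N (tick T N k + t) = LAS_step T V N (LAS_node T V \<mu>0 N k) t"
proof -
  let ?d = "T / real N"
  have d: "?d > 0" using assms by simp
  have "(tick T N k + t) / ?d = real k + t / ?d"
    using assms by (simp add: tick_def field_simps)
  moreover have "0 < t / ?d" "t / ?d \<le> 1"
    using assms d by (auto simp: field_simps)
  ultimately have "\<lceil>(tick T N k + t) / ?d\<rceil> = int k + 1"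
    by (simp only: ceiling_eq_iff) simp
  moreover have "tick T N k \<ge> 0" using assms by (simp add: tick_def)
  ultimately show ?thesis
    using assms(3) by (simp add: LAS_def Let_def nat_add_distrib)
qed

lemma LAS_tick:
  assumes "T > 0" "N \<ge> 1"
  shows "LAS T V \<mu>0 N (tick T N k) = LAS_node T V \<mu>0 N k"
proof (cases k)
  case 0
  then show ?thesis by (simp add: LAS_def tick_def)
next
  case (Suc j)
  have "tick T N k = tick T N j + T / real N"
    by (simp add: Suc tick_def algebra_simps add_divide_distrib)
  then show ?thesis
    using assms LAS_piece[of T N "T / real N"] by (simp add: Suc)
qed

definition no_mass_lost ::
    "real \<Rightarrow> ((real^'d) measure \<Rightarrow> ((real^'d) \<times> (real^'d)) measure) \<Rightarrow> (real^'d) measure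
      \<Rightarrow> nat \<Rightarrow> bool" where
  "no_mass_lost T V \<mu>0 N \<longleftrightarrow> (\<forall>t\<in>{0..T}. LAS T V \<mu>0 N t \<in> probs borel)"

section \<open>Measures on curves\<close>

text \<open>Curves on \<open>[a, b]\<close> are functions that are continuous on \<open>[a, b]\<close> and \<open>undefined\<close>
  elsewhere; the topology is that of the sup metric.\<close>

definition curves :: "real \<Rightarrow> real \<Rightarrow> (real \<Rightarrow> real^'d) topology" where
  "curves a b = mtopology_of (cfunspace (top_of_set {a..b}) euclidean_metric)"

text \<open>\<^term>\<open>K\<close> is a disintegration of \<^term>\<open>\<eta>\<close> with respect to \<^term>\<open>e\<close>: a measurable family of
  probability measures with \<open>\<eta> = \<integral> K x d(e\<sharp>\<eta>)(x)\<close> and \<open>K x\<close> concentrated on the fibre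
  \<open>e = x\<close> for almost every \<open>x\<close>.\<close>

definition is_disintegration ::
    "('a \<Rightarrow> real^'d) \<Rightarrow> 'a measure \<Rightarrow> (real^'d \<Rightarrow> 'a measure) \<Rightarrow> bool" where
  "is_disintegration e \<eta> K \<longleftrightarrow>
     K \<in> borel \<rightarrow>\<^sub>M prob_algebra \<eta> \<and>
     (\<forall>A\<in>sets \<eta>. emeasure \<eta> A = (\<integral>\<^sup>+x. emeasure (K x) A \<partial>distr \<eta> borel e)) \<and>
     (AE x in distr \<eta> borel e. AE \<gamma> in K x. e \<gamma> = x)"

definition disintegration :: "('a \<Rightarrow> real^'d) \<Rightarrow> 'a measure \<Rightarrow> real^'d \<Rightarrow> 'a measure" where
  "disintegration e \<eta> = (SOME K. is_disintegration e \<eta> K)"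

definition concat_curves :: "real \<Rightarrow> real \<Rightarrow> real
    \<Rightarrow> (real \<Rightarrow> real^'d) \<times> (real \<Rightarrow> real^'d) \<Rightarrow> (real \<Rightarrow> real^'d)" where
  "concat_curves a b c = (\<lambda>(\<gamma>1, \<gamma>2). restrict (\<lambda>t. if t \<le> b then \<gamma>1 t else \<gamma>2 t) {a..c})"

text \<open>Push-forward under the merge map, which is only defined on pairs of curves on \<open>[a, b]\<close> and
  \<open>[b, c]\<close> agreeing at \<open>b\<close>; the product measure is therefore first restricted to these pairs.\<close>

definition push_merge :: "real \<Rightarrow> real \<Rightarrow> real
    \<Rightarrow> ((real \<Rightarrow> real^'d) \<times> (real \<Rightarrow> real^'d)) measure \<Rightarrow> (real \<Rightarrow> real^'d) measure" where
  "push_merge a b c \<pi> =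
     distr (restrict_space \<pi> {(\<gamma>1, \<gamma>2). \<gamma>1 b = \<gamma>2 b}) (borel_of (curves a c)) (concat_curves a b c)"

definition glue :: "real \<Rightarrow> real \<Rightarrow> real \<Rightarrow> (real^'d) measure
    \<Rightarrow> (real \<Rightarrow> real^'d) measure \<Rightarrow> (real \<Rightarrow> real^'d) measure \<Rightarrow> (real \<Rightarrow> real^'d) measure" where
  "glue a b c \<mu> \<eta>1 \<eta>2 =
     (THE \<eta>. \<eta> \<in> probs (borel_of (curves a c)) \<and>
        (\<forall>\<phi> \<in> borel_measurable (borel_of (curves a c)).
           bounded (\<phi> ` topspace (curves a c)) \<longrightarrow>
           (\<integral>\<gamma>. \<phi> \<gamma> \<partial>\<eta>) =
           (\<integral>x. (\<integral>\<gamma>. (\<phi> \<gamma> :: real) \<partial>push_merge a b c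
                   (disintegration (\<lambda>\<gamma>. \<gamma> b) \<eta>1 x \<Otimes>\<^sub>M disintegration (\<lambda>\<gamma>. \<gamma> b) \<eta>2 x)) \<partial>\<mu>)))"

definition eta_piece ::
    "real \<Rightarrow> ((real^'d) measure \<Rightarrow> ((real^'d) \<times> (real^'d)) measure) \<Rightarrow> (real^'d) measure
      \<Rightarrow> nat \<Rightarrow> nat \<Rightarrow> (real \<Rightarrow> real^'d) measure" where
  "eta_piece T V \<mu>0 N l =
     dirac_sum (borel_of (curves (tick T N l) (tick T N (Suc l))))
       (xgrid T N \<times> vgrid N) (mv V N (LAS_node T V \<mu>0 N l))
       (\<lambda>(x, v). restrict (\<lambda>t. x + (t - tick T N l) *\<^sub>R v) {tick T N l..tick T N (Suc l)})"

text \<open>\<^term>\<open>eta_upto T V \<mu>0 N j\<close> lives on curves on the interval from 0 to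
  \<^term>\<open>tick T N (Suc j)\<close>.\<close>

primrec eta_upto ::
    "real \<Rightarrow> ((real^'d) measure \<Rightarrow> ((real^'d) \<times> (real^'d)) measure) \<Rightarrow> (real^'d) measure
      \<Rightarrow> nat \<Rightarrow> nat \<Rightarrow> (real \<Rightarrow> real^'d) measure" where
  "eta_upto T V \<mu>0 N 0 = eta_piece T V \<mu>0 N 0"
| "eta_upto T V \<mu>0 N (Suc j) =
     glue 0 (tick T N (Suc j)) (tick T N (Suc (Suc j))) (LAS_node T V \<mu>0 N (Suc j))
       (eta_upto T V \<mu>0 N j) (eta_piece T V \<mu>0 N (Suc j))"

definition eta ::
    "real \<Rightarrow> ((real^'d) measure \<Rightarrow> ((real^'d) \<times> (real^'d)) measure) \<Rightarrow> (real^'d) measure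
      \<Rightarrow> nat \<Rightarrow> (real \<Rightarrow> real^'d) measure" where
  "eta T V \<mu>0 N = eta_upto T V \<mu>0 N (N - 1)"

definition prob_representation ::
    "real \<Rightarrow> (real \<Rightarrow> real^'d) measure \<Rightarrow> (real \<Rightarrow> (real^'d) measure) \<Rightarrow> bool" where
  "prob_representation T \<eta> \<mu> \<longleftrightarrow>
     \<eta> \<in> probs (borel_of (curves 0 T)) \<and> (\<forall>t\<in>{0..T}. \<mu> t = distr \<eta> borel (\<lambda>\<gamma>. \<gamma> t))"

end

(* The Lattice Approximate Solution at a node is a finite sum of Dirac masses on grid points, and as
   long as no mass is lost it is reproduced by the next step at local time 0. Hence consecutive pieces
   of eta^N have the same marginal at the node where they are glued, the disintegrations exist because
   this marginal has finite support, and glueing preserves the marginals of both pieces: this gives (1).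

   By the growth condition the supports of the approximations stay in a ball independent of N, with
   velocities bounded by some L, so that for large N the measures eta^N are concentrated on one compact
   set of L-Lipschitz curves. Prokhorov's theorem yields a narrowly convergent subsequence. Evaluation
   at t is continuous on curves, so integrals of bounded Lipschitz functions against the marginals
   converge both to those of the limit measure and, by Wasserstein convergence, to those of mu_t. *)

theory Submission
  imports Defs
begin

section \<open>The Borel sets of the space of curves\<close>

text \<open>Three obstacles shape the proof. The measures live on the Borel sets of the sup metric,
  whereas merging is a map on a product sigma-algebra. Its measurability is reached by showing that
  the Borel sets of curves are generated by evaluations, so that a map into curves can be checked
  one time at a time. Next, \<open>disintegration\<close> is an unspecified choice and
  \<open>glue\<close> a definite description. The glued measure is therefore identified with the
  bind of fibrewise kernels, and beyond measurability these kernels are known only through two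
  facts: they integrate back to the pieces, and almost every one sits on its fibre. Finally,
  Prokhorov's theorem is transported from the real line: every Lipschitz curve with bounded starting
  point is encoded by one real number, and Helly's selection theorem is applied to the laws of these
  numbers. The code is merely measurable, but decoding is uniformly continuous, and decoding is the
  direction along which continuous test functions are pulled back.\<close>

lemma topspace_curves:
  "topspace (curves a b) = {g. continuous_on {a..b} g \<and> g \<in> extensional {a..b}}"
proof -
  have "bounded (g ` {a..b})" if "continuous_on {a..b} g" for g :: "real \<Rightarrow> real^'d"
    using that by (simp add: compact_continuous_image compact_imp_bounded)
  then show ?thesis
    by (auto simp: curves_def)
qed

lemma curves_restrict: "restrict g {a..b} \<in> topspace (curves a b)" if "continuous_on {a..b} g"
proof -
  have "continuous_on {a..b} (restrict g {a..b}) \<longleftrightarrow> continuous_on {a..b} g"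
    by (rule continuous_on_cong) auto
  then show ?thesis using that by (simp add: topspace_curves)
qed

text \<open>The distance of the function space is handled only here. Pointwise bounds control a
  supremum only in non-strict form, hence the condition with \<open>\<le> r\<close>; halving the
  radius of an open ball absorbs the difference.\<close>

lemma openin_curves:
  fixes U :: "(real \<Rightarrow> real^'d) set"
  shows "openin (curves a b) U \<longleftrightarrow> U \<subseteq> topspace (curves a b) \<and>
    (\<forall>g\<in>U. \<exists>r>0. \<forall>h\<in>topspace (curves a b). (\<forall>t\<in>{a..b}. dist (g t) (h t) \<le> r) \<longrightarrow> h \<in> U)"
proof -
  define m where "m = cfunspace (top_of_set {a..b}) (euclidean_metric :: (real^'d) metric)"
  interpret Metric_space "mspace m" "mdist m" by simp
  have m: "curves a b = mtopology" "topspace (curves a b) = mspace m"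
    unfolding curves_def m_def topspace_mtopology_of by (simp_all only: mtopology_of_def)
  have le: "mdist m g h \<le> r" if "0 \<le> r" "\<And>t. t \<in> {a..b} \<Longrightarrow> dist (g t) (h t) \<le> r" for g h r
    unfolding m_def by (rule mdist_cfunspace_le) (use that in auto)
  have ge: "dist (g t) (h t) \<le> mdist m g h" if "g \<in> mspace m" "h \<in> mspace m" "t \<in> {a..b}" for g h t
    using cfunspace_mdist_le[of g "top_of_set {a..b}" euclidean_metric h "mdist m g h"] that
    unfolding m_def by auto
  show ?thesis
    unfolding m(2) unfolding m(1) openin_mtopology
  proof (intro conj_cong refl iffI ballI allI impI)
    fix g assume U: "U \<subseteq> mspace m" and *: "\<forall>x. x \<in> U \<longrightarrow> (\<exists>r>0. mball x r \<subseteq> U)" and g: "g \<in> U"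
    then obtain r where r: "r > 0" "mball g r \<subseteq> U" by auto
    have "h \<in> U" if "h \<in> mspace m" "\<forall>t\<in>{a..b}. dist (g t) (h t) \<le> r/2" for h
    proof -
      have "mdist m g h \<le> r/2" using le[of "r/2" g h] r that by auto
      then have "h \<in> mball g r" using r that U g by auto
      with r show ?thesis by auto
    qed
    then show "\<exists>r>0. \<forall>h\<in>mspace m. (\<forall>t\<in>{a..b}. dist (g t) (h t) \<le> r) \<longrightarrow> h \<in> U"
      using r by (intro exI[of _ "r/2"]) auto
  next
    fix g assume U: "U \<subseteq> mspace m" and
      *: "\<forall>g\<in>U. \<exists>r>0. \<forall>h\<in>mspace m. (\<forall>t\<in>{a..b}. dist (g t) (h t) \<le> r) \<longrightarrow> h \<in> U" and g: "g \<in> U"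
    then obtain r where r: "r > 0" "\<forall>h\<in>mspace m. (\<forall>t\<in>{a..b}. dist (g t) (h t) \<le> r) \<longrightarrow> h \<in> U"
      by meson
    have "mball g r \<subseteq> U"
    proof
      fix h assume h: "h \<in> mball g r"
      have "dist (g t) (h t) \<le> r" if "t \<in> {a..b}" for t
        using ge[of g h t] h that by auto
      then show "h \<in> U" using r h by auto
    qed
    then show "\<exists>r>0. mball g r \<subseteq> U" using r by auto
  qed
qed

lemma space_borel_of [simp]: "space (borel_of X) = topspace X"
  unfolding borel_of_def by (rule space_measure_of) (auto dest: openin_subset)

lemma sets_borel_of: "sets (borel_of X) = sigma_sets (topspace X) {U. openin X U}"
  unfolding borel_of_def by (rule sets_measure_of) (auto dest: openin_subset)

lemma closedin_in_sets_borel_of: "S \<in> sets (borel_of X)" if "closedin X S"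
proof -
  have "topspace X - S \<in> sets (borel_of X)"
    using that by (auto simp: sets_borel_of closedin_def)
  then have "space (borel_of X) - (topspace X - S) \<in> sets (borel_of X)"
    by blast
  moreover have "topspace X - (topspace X - S) = S"
    using closedin_subset[OF that] by auto
  ultimately show ?thesis by simp
qed

lemma continuous_map_borel_measurable:
  fixes f :: "'a \<Rightarrow> 'b::topological_space"
  assumes "continuous_map X euclidean f"
  shows "f \<in> borel_of X \<rightarrow>\<^sub>M borel"
proof (rule borel_measurableI)
  fix S :: "'b set" assume "open S"
  then have "openin X {x \<in> topspace X. f x \<in> S}"
    using openin_continuous_map_preimage[OF assms] by simp
  moreover have "f -` S \<inter> space (borel_of X) = {x \<in> topspace X. f x \<in> S}" by auto
  ultimately show "f -` S \<inter> space (borel_of X) \<in> sets (borel_of X)"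
    by (auto simp: sets_borel_of)
qed

lemma continuous_map_eval: "continuous_map (curves a b) euclidean (\<lambda>g. g t)" if "t \<in> {a..b}"
  unfolding continuous_map_def
proof (intro conjI allI impI)
  fix U :: "(real^'d) set" assume "openin euclidean U"
  then have U: "open U" by simp
  show "openin (curves a b) {g \<in> topspace (curves a b). g t \<in> U}"
    unfolding openin_curves
  proof (intro conjI ballI)
    fix g :: "real \<Rightarrow> real^'d" assume "g \<in> {g \<in> topspace (curves a b). g t \<in> U}"
    then obtain e where e: "e > 0" "cball (g t) e \<subseteq> U"
      using U by (auto simp: open_contains_cball)
    then show "\<exists>r>0. \<forall>h\<in>topspace (curves a b). (\<forall>t\<in>{a..b}. dist (g t) (h t) \<le> r) \<longrightarrow>
      h \<in> {g \<in> topspace (curves a b). g t \<in> U}"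
      using that by (intro exI[of _ e]) auto
  qed auto
qed auto

lemma measurable_eval: "(\<lambda>g. g t) \<in> borel_of (curves a b) \<rightarrow>\<^sub>M borel" if "t \<in> {a..b}"
  by (intro continuous_map_borel_measurable continuous_map_eval that)

text \<open>Every open set of curves is a countable union of tubes around step functions, and a tube is
  described by countably many evaluations: the Borel sets are generated by the evaluations.\<close>

lemma measurable_into_curves:
  fixes F :: "'a \<Rightarrow> real \<Rightarrow> real^'d"
  assumes F: "F \<in> space M \<rightarrow> topspace (curves a b)"
    and ev: "\<And>t. t \<in> {a..b} \<Longrightarrow> (\<lambda>x. F x t) \<in> M \<rightarrow>\<^sub>M borel"
  shows "F \<in> M \<rightarrow>\<^sub>M borel_of (curves a b)"
proof -
  obtain D where D: "countable D" "D \<subseteq> {a..b}" "{a..b} \<subseteq> closure D"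
    using separable by blast
  obtain E :: "(real^'d) set" where E: "countable E" "UNIV \<subseteq> closure E"
    using separable by (metis subset_UNIV)
  \<comment> \<open>Here 1/n is the mesh of a step function on \<open>{a..b}\<close>,
    \<open>xs\<close> lists its values, and 1/(k+1) is the width of the tube around it. Only times
    in the countable set \<open>D\<close> are tested, so that membership is a countable conjunction
    of conditions on evaluations.\<close>
  define tube where "tube = (\<lambda>(n::nat, xs, k::nat). {g \<in> topspace (curves a b).
     \<forall>t\<in>D. dist (g t :: real^'d) (xs ! nat \<lfloor>(t - a) * real n\<rfloor>) \<le> 1 / real (Suc k)})"
  define I :: "(nat \<times> (real^'d) list \<times> nat) set" where "I = UNIV \<times> lists E \<times> UNIV"
  have I: "countable I" unfolding I_def using E by (intro countable_SIGMA) auto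
  have union: "U = \<Union> (tube ` {i \<in> I. tube i \<subseteq> U})" if U: "openin (curves a b) U" for U :: "(real \<Rightarrow> real^'d) set"
  proof (intro equalityI subsetI)
    fix g assume g: "g \<in> U"
    have gt: "g \<in> topspace (curves a b)" using U g openin_subset by auto
    then have gc: "continuous_on {a..b} g" by (simp add: topspace_curves)
    obtain r where r: "r > 0"
      "\<And>h. h\<in>topspace (curves a b) \<Longrightarrow> (\<forall>t\<in>{a..b}. dist (g t) (h t) \<le> r) \<Longrightarrow> h \<in> U"
      using U g unfolding openin_curves by meson
    \<comment> \<open>Half of \<open>r\<close> because two curves in the same tube are each within
      1/(k+1) of the step function.\<close>
    obtain k :: nat where k: "1 / real (Suc k) < r / 2"
      using r(1) reals_Archimedean[of "r/2"] by (auto simp: field_simps)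
    define e where "e = 1 / real (Suc k)"
    have e: "e > 0" by (simp add: e_def)
    have "uniformly_continuous_on {a..b} g"
      using gc by (intro compact_uniformly_continuous) auto
    then obtain \<delta> where \<delta>: "\<delta> > 0" "\<And>t u. t \<in> {a..b} \<Longrightarrow> u \<in> {a..b} \<Longrightarrow> dist u t < \<delta> \<Longrightarrow> dist (g u) (g t) < e/2"
      unfolding uniformly_continuous_on_def using e by (meson half_gt_zero)
    obtain n :: nat where n: "n > 0" "1 / real n < \<delta>"
      using \<delta>(1) by (metis divide_inverse mult_1 ex_inverse_of_nat_less)
    \<comment> \<open>The width \<open>e\<close> is shared equally between the oscillation of
      \<open>g\<close> over one mesh interval and the replacement of its value at the left node by a
      point of \<open>E\<close>.\<close>
    have "\<exists>p\<in>E. dist p (g (a + real i / real n)) < e/2" for i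
      using E(2) e by (metis UNIV_I closure_approachable half_gt_zero subsetD)
    then obtain p where p: "\<And>i. p i \<in> E" "\<And>i. dist (p i) (g (a + real i / real n)) < e/2"
      by metis
    define xs where "xs = map p [0..<Suc (nat \<lfloor>(b - a) * real n\<rfloor>)]"
    have step: "dist (g t) (xs ! nat \<lfloor>(t - a) * real n\<rfloor>) \<le> e" if t: "t \<in> {a..b}" for t
    proof -
      define i where "i = nat \<lfloor>(t - a) * real n\<rfloor>"
      have "(t - a) * real n \<le> (b - a) * real n" using t n by (intro mult_right_mono) auto
      then have i1: "i \<le> nat \<lfloor>(b - a) * real n\<rfloor>" unfolding i_def by (intro nat_mono floor_mono)
      have "0 \<le> (t - a) * real n" using t by simp
      then have i2: "real i \<le> (t - a) * real n" "(t - a) * real n < real i + 1"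
        unfolding i_def by linarith+
      have i3: "real i / real n \<le> t - a" "t - a < real i / real n + 1 / real n"
        using i2 n by (auto simp: field_simps)
      have "dist (g (a + real i / real n)) (g t) < e/2"
        using i3 n t by (intro \<delta>(2)) (auto simp: dist_real_def)
      moreover have "xs ! i = p i" using i1 by (simp add: xs_def del: upt_Suc)
      ultimately show ?thesis
        using p(2)[of i] dist_triangle[of "g t" "p i" "g (a + real i / real n)"]
        by (simp add: i_def[symmetric] dist_commute)
    qed
    have "tube (n, xs, k) \<subseteq> U"
    proof
      fix h assume h: "h \<in> tube (n, xs, k)"
      then have ht: "h \<in> topspace (curves a b)" by (simp add: tube_def)
      then have hc: "continuous_on {a..b} h" by (simp add: topspace_curves)
      have hg: "dist (h t) (g t) \<le> r" if "t \<in> D" for t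
      proof -
        have "dist (h t) (xs ! nat \<lfloor>(t - a) * real n\<rfloor>) \<le> e"
          using h that by (auto simp: tube_def e_def)
        moreover have "dist (g t) (xs ! nat \<lfloor>(t - a) * real n\<rfloor>) \<le> e"
          using step that D by auto
        ultimately show ?thesis
          using k dist_triangle2[of "h t" "g t" "xs ! nat \<lfloor>(t - a) * real n\<rfloor>"] unfolding e_def by linarith
      qed
      \<comment> \<open>A non-strict bound between continuous curves extends from \<open>D\<close>
        to its closure.\<close>
      have "closure D = {a..b}" using D closure_minimal[of D "{a..b}"] by auto
      then have "dist (h t) (g t) \<le> r" if "t \<in> {a..b}" for t
        using continuous_le_on_closure[of D "\<lambda>t. dist (h t) (g t)" t r] that hg hc gc
        by (auto intro!: continuous_intros)
      then show "h \<in> U" using r(2) ht by (simp add: dist_commute)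
    qed
    moreover have "g \<in> tube (n, xs, k)"
      using gt step D unfolding tube_def e_def by auto
    moreover have "(n, xs, k) \<in> I" using p by (auto simp: I_def xs_def)
    ultimately show "g \<in> \<Union> (tube ` {i \<in> I. tube i \<subseteq> U})" by blast
  qed auto
  have pre: "F -` tube i \<inter> space M \<in> sets M" for i
  proof -
    obtain n xs k where i: "i = (n, xs, k)" by (cases i)
    have "F -` tube i \<inter> space M =
       {x \<in> space M. \<forall>t\<in>D. dist (F x t) (xs ! nat \<lfloor>(t - a) * real n\<rfloor>) \<le> 1 / real (Suc k)}"
      using F by (auto simp: i tube_def)
    also have "\<dots> \<in> sets M"
    proof (intro sets.sets_Collect_countable_All' D(1))
      fix t assume "t \<in> D"
      then have [measurable]: "(\<lambda>x. F x t) \<in> M \<rightarrow>\<^sub>M borel" using ev D by auto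
      show "{x \<in> space M. dist (F x t) (xs ! nat \<lfloor>(t - a) * real n\<rfloor>) \<le> 1 / real (Suc k)} \<in> sets M"
        by measurable
    qed
    finally show ?thesis .
  qed
  show ?thesis
  proof (rule measurable_sigma_sets[OF sets_borel_of])
    fix U :: "(real \<Rightarrow> real^'d) set" assume "U \<in> {U. openin (curves a b) U}"
    then have "U = \<Union> (tube ` {i \<in> I. tube i \<subseteq> U})" using union by simp
    then have "F -` U \<inter> space M = (\<Union>i\<in>{i \<in> I. tube i \<subseteq> U}. F -` tube i \<inter> space M)" by blast
    also have "\<dots> \<in> sets M"
      using I pre by (intro sets.countable_UN'') auto
    finally show "F -` U \<inter> space M \<in> sets M" .
  qed (use F in \<open>auto dest: openin_subset\<close>)
qed

section \<open>Disintegration and glueing\<close>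

lemma probsD: "prob_space M" "sets M = sets N" "space M = space N" if "M \<in> probs N"
  using that by (auto simp: space_prob_algebra dest: sets_eq_imp_space_eq)

lemma nn_integral_finite_concentrated:
  fixes M :: "'a::t1_space measure"
  assumes M: "sets M = sets borel" and S: "finite S" "AE x in M. x \<in> S" and f: "f \<in> borel_measurable M"
  shows "(\<integral>\<^sup>+x. f x \<partial>M) = (\<Sum>x\<in>S. f x * emeasure M {x})"
proof -
  have [measurable]: "{x} \<in> sets M" for x using M by simp
  have "(\<integral>\<^sup>+x. f x \<partial>M) = (\<integral>\<^sup>+y. (\<Sum>x\<in>S. f x * indicator {x} y) \<partial>M)"
  proof (rule nn_integral_cong_AE)
    show "AE y in M. f y = (\<Sum>x\<in>S. f x * indicator {x} y)"
      using S(2)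
    proof eventually_elim
      fix y assume "y \<in> S"
      have "(\<Sum>x\<in>S. f x * indicator {x} y) = (\<Sum>x\<in>{y}. f x * indicator {x} y)"
        using S(1) \<open>y \<in> S\<close> by (intro sum.mono_neutral_right) (auto simp: indicator_def)
      then show "f y = (\<Sum>x\<in>S. f x * indicator {x} y)" by simp
    qed
  qed
  also have "\<dots> = (\<Sum>x\<in>S. f x * emeasure M {x})"
    by (subst nn_integral_sum) (auto simp: nn_integral_cmult_indicator)
  finally show ?thesis .
qed

text \<open>When \<open>e\<close> takes finitely many values almost surely, elementary conditioning
  suffices: normalise \<eta> on each fibre of positive mass and sum over the fibres.\<close>

lemma is_disintegration_exists:
  fixes e :: "'a \<Rightarrow> real^'d"
  assumes "prob_space \<eta>" and e[measurable]: "e \<in> \<eta> \<rightarrow>\<^sub>M borel" and S: "finite S" "AE \<gamma> in \<eta>. e \<gamma> \<in> S"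
  shows "\<exists>K. is_disintegration e \<eta> K"
proof -
  interpret prob_space \<eta> by fact
  define fib where "fib x = e -` {x} \<inter> space \<eta>" for x
  have fib_sets [measurable]: "fib x \<in> sets \<eta>" for x unfolding fib_def by simp
  \<comment> \<open>Off \<open>S\<close> and over null fibres the value is \<eta> itself. These
    points form a null set for the law of \<open>e\<close>, and the default keeps every
    \<open>K x\<close> a probability measure.\<close>
  define K where "K x = (if x \<in> S \<and> emeasure \<eta> (fib x) \<noteq> 0 then uniform_measure \<eta> (fib x) else \<eta>)" for x
  have prob: "K x \<in> probs \<eta>" for x
    using prob_space_uniform_measure[of \<eta> "fib x"] prob_space_axioms
    by (auto simp: K_def space_prob_algebra)
  have K: "K \<in> borel \<rightarrow>\<^sub>M prob_algebra \<eta>"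
  \<comment> \<open>\<open>K\<close> differs from a constant kernel only on the finite set
    \<open>S\<close>.\<close>
  proof (rule measurable_discrete_difference[where X=S])
    show "(\<lambda>x. \<eta>) \<in> borel \<rightarrow>\<^sub>M prob_algebra \<eta>"
      using prob_space_axioms by (intro measurable_const) (simp add: space_prob_algebra)
    show "countable S" using S(1) by (rule countable_finite)
    show "K x \<in> space (prob_algebra \<eta>)" for x by (rule prob)
  qed (auto simp: K_def)
  have S': "AE x in distr \<eta> borel e. x \<in> S"
    using S borel_closed[OF finite_imp_closed[OF S(1)]] by (subst AE_distr_iff) auto
  have fib: "emeasure (distr \<eta> borel e) {x} = emeasure \<eta> (fib x)" for x
    by (simp add: emeasure_distr fib_def)
  have "is_disintegration e \<eta> K"
    unfolding is_disintegration_def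
  proof (intro conjI ballI K)
    fix A assume A[measurable]: "A \<in> sets \<eta>"
    have "K \<in> borel \<rightarrow>\<^sub>M subprob_algebra \<eta>" using K by (rule measurable_prob_algebraD)
    then have [measurable]: "(\<lambda>x. emeasure (K x) A) \<in> borel_measurable borel" by measurable
    have "(\<integral>\<^sup>+x. emeasure (K x) A \<partial>distr \<eta> borel e) = (\<Sum>x\<in>S. emeasure (K x) A * emeasure \<eta> (fib x))"
      using S(1) S' by (subst nn_integral_finite_concentrated[where S=S]) (auto simp: fib)
    also have "\<dots> = (\<Sum>x\<in>S. emeasure \<eta> (A \<inter> fib x))"
    proof (intro sum.cong refl)
      fix x assume "x \<in> S"
      show "emeasure (K x) A * emeasure \<eta> (fib x) = emeasure \<eta> (A \<inter> fib x)"
      proof (cases "emeasure \<eta> (fib x) = 0")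
        case True
        moreover have "emeasure \<eta> (A \<inter> fib x) \<le> emeasure \<eta> (fib x)" by (intro emeasure_mono) auto
        ultimately show ?thesis by simp
      next
        case False
        then show ?thesis using \<open>x \<in> S\<close>
          by (simp add: K_def Int_commute ennreal_divide_times ennreal_times_divide[symmetric]
              ennreal_divide_self less_top[symmetric])
      qed
    qed
    also have "\<dots> = emeasure \<eta> (\<Union>x\<in>S. A \<inter> fib x)"
      using S(1) by (intro sum_emeasure) (auto simp: disjoint_family_on_def fib_def)
    also have "\<dots> = emeasure \<eta> A"
    proof (intro emeasure_eq_AE)
      show "AE x in \<eta>. (x \<in> (\<Union>x\<in>S. A \<inter> fib x)) = (x \<in> A)"
        using S(2) AE_space by eventually_elim (auto simp: fib_def)
      show "(\<Union>x\<in>S. A \<inter> fib x) \<in> sets \<eta>" using S(1) by (intro sets.finite_UN) auto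
    qed (rule A)
    finally show "emeasure \<eta> A = (\<integral>\<^sup>+x. emeasure (K x) A \<partial>distr \<eta> borel e)" by simp
  next
    \<comment> \<open>The atoms of \<open>S\<close> with mass zero are finitely many, so their union
      is null; at all other points of \<open>S\<close> the kernel is the conditional
      measure.\<close>
    have "AE x in distr \<eta> borel e. emeasure (distr \<eta> borel e) {x} \<noteq> 0"
    proof -
      let ?Z = "{x \<in> S. emeasure (distr \<eta> borel e) {x} = 0}"
      have "?Z \<in> sets borel" using S(1) by (intro borel_closed finite_imp_closed) simp
      then have "AE x in distr \<eta> borel e. x \<notin> ?Z"
        using S(1) by (intro AE_not_in null_setsI, subst emeasure_eq_sum_singleton) (auto intro: borel_closed finite_imp_closed)
      then show ?thesis using S' by eventually_elim auto
    qed
    then show "AE x in distr \<eta> borel e. AE \<gamma> in K x. e \<gamma> = x"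
      using S'
    proof eventually_elim
      fix x assume "emeasure (distr \<eta> borel e) {x} \<noteq> 0" "x \<in> S"
      then have K_eq: "K x = uniform_measure \<eta> (fib x)" by (simp add: K_def fib)
      show "AE \<gamma> in K x. e \<gamma> = x"
        unfolding K_eq by (intro AE_uniform_measureI) (auto simp: fib_def)
    qed
  qed
  then show ?thesis by blast
qed

text \<open>Evaluating a merged curve at \<open>t\<close> evaluates one of the two pieces at
  \<open>t\<close>, so the evaluation criterion for maps into curves reduces the claim to
  measurability of the projections. Compatibility at \<open>b\<close> is what makes the merged curve
  continuous.\<close>

lemma measurable_concat_curves:
  fixes \<pi> :: "((real \<Rightarrow> real^'d) \<times> (real \<Rightarrow> real^'d)) measure"
  assumes "a \<le> b" "b \<le> c"
    and \<pi>: "sets \<pi> = sets (borel_of (curves a b) \<Otimes>\<^sub>M borel_of (curves b c))"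
  shows "concat_curves a b c \<in> restrict_space \<pi> {(\<gamma>1, \<gamma>2). \<gamma>1 b = \<gamma>2 b} \<rightarrow>\<^sub>M borel_of (curves a c)"
proof (rule measurable_into_curves)
  have sp: "space \<pi> = topspace (curves a b) \<times> topspace (curves b c)"
    using sets_eq_imp_space_eq[OF \<pi>] by (simp add: space_pair_measure)
  show "concat_curves a b c \<in> space (restrict_space \<pi> {(\<gamma>1, \<gamma>2). \<gamma>1 b = \<gamma>2 b}) \<rightarrow> topspace (curves a c)"
  proof
    fix p assume "p \<in> space (restrict_space \<pi> {(\<gamma>1, \<gamma>2). \<gamma>1 b = \<gamma>2 b})"
    then obtain g h where p: "p = (g, h)" "g b = h b" "continuous_on {a..b} g" "continuous_on {b..c} h"
      by (auto simp: space_restrict_space sp topspace_curves)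
    have "continuous_on ({a..b} \<union> {b..c}) (\<lambda>t. if t \<le> b then g t else h t)"
      using p by (intro continuous_on_cases) auto
    moreover have "{a..b} \<union> {b..c} = {a..c}" using assms by auto
    ultimately show "concat_curves a b c p \<in> topspace (curves a c)"
      by (simp add: p concat_curves_def curves_restrict)
  qed
  fix t assume t: "t \<in> {a..c}"
  have m: "(\<lambda>p. if t \<le> b then fst p t else snd p t) \<in> \<pi> \<rightarrow>\<^sub>M borel"
  proof (cases "t \<le> b")
    case True
    then have "(\<lambda>p. fst p t) \<in> \<pi> \<rightarrow>\<^sub>M borel"
      using t \<pi> by (intro measurable_compose[OF _ measurable_eval[of t a b]]) (auto cong: measurable_cong_sets)
    then show ?thesis using True by simp
  next
    case False
    then have "(\<lambda>p. snd p t) \<in> \<pi> \<rightarrow>\<^sub>M borel"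
      using t \<pi> by (intro measurable_compose[OF _ measurable_eval[of t b c]]) (auto cong: measurable_cong_sets)
    then show ?thesis using False by simp
  qed
  have "(\<lambda>p. concat_curves a b c p t) = (\<lambda>p. (if t \<le> b then fst p t else snd p t) :: real^'d)"
    using t by (auto simp: concat_curves_def fun_eq_iff split: prod.split)
  with measurable_restrict_space1[OF m, of "{(\<gamma>1, \<gamma>2). \<gamma>1 b = \<gamma>2 b}"]
  show "(\<lambda>p. concat_curves a b c p t) \<in> restrict_space \<pi> {(\<gamma>1, \<gamma>2). \<gamma>1 b = \<gamma>2 b} \<rightarrow>\<^sub>M borel" by simp
qed

lemma compatible_pairs_measurable:
  fixes \<pi> :: "((real \<Rightarrow> real^'d) \<times> (real \<Rightarrow> real^'d)) measure"
  assumes "a \<le> b" "b \<le> c"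
    and \<pi>: "sets \<pi> = sets (borel_of (curves a b) \<Otimes>\<^sub>M borel_of (curves b c))"
  shows "{(\<gamma>1, \<gamma>2). \<gamma>1 b = \<gamma>2 b} \<inter> space \<pi> \<in> sets \<pi>"
proof -
  have [measurable]: "(\<lambda>p. fst p b) \<in> \<pi> \<rightarrow>\<^sub>M borel"
    using \<pi> assms by (intro measurable_compose[OF _ measurable_eval[of b a b]]) (auto cong: measurable_cong_sets)
  have [measurable]: "(\<lambda>p. snd p b) \<in> \<pi> \<rightarrow>\<^sub>M borel"
    using \<pi> assms by (intro measurable_compose[OF _ measurable_eval[of b b c]]) (auto cong: measurable_cong_sets)
  have "{p \<in> space \<pi>. fst p b = snd p b} \<in> sets \<pi>" by measurable
  moreover have "{p \<in> space \<pi>. fst p b = snd p b} = {(\<gamma>1, \<gamma>2). \<gamma>1 b = \<gamma>2 b} \<inter> space \<pi>" by auto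
  ultimately show ?thesis by simp
qed

text \<open>The mass of incompatible pairs is discarded, so that a probability measure may be sent
  to a measure of total mass below 1.\<close>

lemma push_merge:
  fixes \<pi> :: "((real \<Rightarrow> real^'d) \<times> (real \<Rightarrow> real^'d)) measure"
  assumes abc: "a \<le> b" "b \<le> c"
    and \<pi>: "sets \<pi> = sets (borel_of (curves a b) \<Otimes>\<^sub>M borel_of (curves b c))"
    and A: "A \<in> sets (borel_of (curves a c))"
  shows emeasure_push_merge: "emeasure (push_merge a b c \<pi>) A =
      emeasure \<pi> {(\<gamma>1, \<gamma>2) \<in> space \<pi>. \<gamma>1 b = \<gamma>2 b \<and> concat_curves a b c (\<gamma>1, \<gamma>2) \<in> A}" (is "_ = emeasure \<pi> ?B")
    and merge_preimage_measurable: "{(\<gamma>1, \<gamma>2) \<in> space \<pi>. \<gamma>1 b = \<gamma>2 b \<and> concat_curves a b c (\<gamma>1, \<gamma>2) \<in> A} \<in> sets \<pi>"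
proof -
  note m = measurable_concat_curves[OF abc \<pi>]
  have B: "concat_curves a b c -` A \<inter> space (restrict_space \<pi> {(\<gamma>1, \<gamma>2). \<gamma>1 b = \<gamma>2 b}) = ?B"
    by (auto simp: space_restrict_space)
  show "emeasure (push_merge a b c \<pi>) A = emeasure \<pi> ?B"
    unfolding push_merge_def
    by (subst emeasure_distr[OF m A], subst B, rule emeasure_restrict_space)
      (use compatible_pairs_measurable[OF abc \<pi>] in auto)
  show "?B \<in> sets \<pi>"
    using measurable_sets[OF m A] compatible_pairs_measurable[OF abc \<pi>]
    by (simp add: B sets_restrict_space_iff)
qed

text \<open>Supplies the uniqueness behind the definite description in \<open>glue\<close>;
  indicators are admissible test functions.\<close>

lemma prob_measure_eqI_bounded:
  assumes "\<eta> \<in> probs M" "\<eta>' \<in> probs M"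
    and "\<And>\<phi>. \<phi> \<in> borel_measurable M \<Longrightarrow> bounded (\<phi> ` space M) \<Longrightarrow> (\<integral>x. \<phi> x \<partial>\<eta>) = (\<integral>x. (\<phi> x :: real) \<partial>\<eta>')"
  shows "\<eta> = \<eta>'"
proof (rule measure_eqI)
  note p = probsD[OF assms(1)] probsD[OF assms(2)]
  show "sets \<eta> = sets \<eta>'" using p by simp
  interpret \<eta>: prob_space \<eta> by fact
  interpret \<eta>': prob_space \<eta>' by fact
  fix A assume "A \<in> sets \<eta>"
  then have A: "A \<in> sets M" "A \<in> sets \<eta>" "A \<in> sets \<eta>'" using p by auto
  have "bounded (indicator A ` space M :: real set)"
    by (rule boundedI[of _ 1]) (auto simp: indicator_def)
  then have "(\<integral>x. indicator A x \<partial>\<eta>) = (\<integral>x. (indicator A x :: real) \<partial>\<eta>')"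
    using A by (intro assms(3)) auto
  then show "emeasure \<eta> A = emeasure \<eta>' A"
    using A by (simp add: \<eta>.emeasure_eq_measure \<eta>'.emeasure_eq_measure)
qed

text \<open>One glueing step at time \<open>b\<close>. Equal marginals let both pieces be
  disintegrated over the same points, and the finite carrier \<open>S\<close> of the marginal makes
  the disintegrations exist.\<close>

locale glueing =
  fixes a b c :: real and \<mu> :: "(real^'d) measure" and \<eta>1 \<eta>2 and S
  assumes abc: "a \<le> b" "b \<le> c"
    and \<eta>1: "\<eta>1 \<in> probs (borel_of (curves a b))" and \<eta>2: "\<eta>2 \<in> probs (borel_of (curves b c))"
    and marginal1: "distr \<eta>1 borel (\<lambda>\<gamma>. \<gamma> b) = \<mu>" and marginal2: "distr \<eta>2 borel (\<lambda>\<gamma>. \<gamma> b) = \<mu>"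
    and S: "finite S" "AE x in \<mu>. x \<in> S"
begin

abbreviation "K1 \<equiv> disintegration (\<lambda>\<gamma>. \<gamma> b) \<eta>1"
abbreviation "K2 \<equiv> disintegration (\<lambda>\<gamma>. \<gamma> b) \<eta>2"
abbreviation "\<kappa> x \<equiv> push_merge a b c (K1 x \<Otimes>\<^sub>M K2 x)"

lemma eval_b [measurable]: "(\<lambda>\<gamma>. \<gamma> b) \<in> \<eta>1 \<rightarrow>\<^sub>M borel" "(\<lambda>\<gamma>. \<gamma> b) \<in> \<eta>2 \<rightarrow>\<^sub>M borel"
  using probsD(2)[OF \<eta>1] probsD(2)[OF \<eta>2] measurable_eval[of b a b] measurable_eval[of b b c] abc
  by (auto cong: measurable_cong_sets)

lemma prob_\<mu>: "prob_space \<mu>" "sets \<mu> = sets borel" "space \<mu> = UNIV"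
  using prob_space.prob_space_distr[OF probsD(1)[OF \<eta>1] eval_b(1)] marginal1 by auto

lemma disintegrations:
  "is_disintegration (\<lambda>\<gamma>. \<gamma> b) \<eta>1 K1" "is_disintegration (\<lambda>\<gamma>. \<gamma> b) \<eta>2 K2"
proof -
  have "AE \<gamma> in \<eta>1. \<gamma> b \<in> S" "AE \<gamma> in \<eta>2. \<gamma> b \<in> S"
    using S(2) AE_distrD[OF eval_b(1), of "\<lambda>x. x \<in> S"] AE_distrD[OF eval_b(2), of "\<lambda>x. x \<in> S"]
    unfolding marginal1 marginal2 by blast+
  then show "is_disintegration (\<lambda>\<gamma>. \<gamma> b) \<eta>1 K1" "is_disintegration (\<lambda>\<gamma>. \<gamma> b) \<eta>2 K2"
    unfolding disintegration_def
    using is_disintegration_exists[OF probsD(1)[OF \<eta>1] eval_b(1) S(1)]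
      is_disintegration_exists[OF probsD(1)[OF \<eta>2] eval_b(2) S(1)] someI_ex by metis+
qed

lemma kernels:
  "K1 \<in> borel \<rightarrow>\<^sub>M prob_algebra (borel_of (curves a b))" "K2 \<in> borel \<rightarrow>\<^sub>M prob_algebra (borel_of (curves b c))"
proof -
  have "prob_algebra \<eta>1 = prob_algebra (borel_of (curves a b))" "prob_algebra \<eta>2 = prob_algebra (borel_of (curves b c))"
    using probsD(2)[OF \<eta>1] probsD(2)[OF \<eta>2] by (auto simp: prob_algebra_def cong: subprob_algebra_cong)
  then show "K1 \<in> borel \<rightarrow>\<^sub>M prob_algebra (borel_of (curves a b))" "K2 \<in> borel \<rightarrow>\<^sub>M prob_algebra (borel_of (curves b c))"
    using disintegrations by (auto simp: is_disintegration_def)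
qed

lemma kernel_prob: "K1 x \<in> probs (borel_of (curves a b))" "K2 x \<in> probs (borel_of (curves b c))"
  using kernels[THEN measurable_space, of x] by auto

lemma sets_pair: "sets (K1 x \<Otimes>\<^sub>M K2 x) = sets (borel_of (curves a b) \<Otimes>\<^sub>M borel_of (curves b c))"
  by (intro sets_pair_measure_cong probsD(2) kernel_prob)

lemma space_pair: "space (K1 x \<Otimes>\<^sub>M K2 x) = topspace (curves a b) \<times> topspace (curves b c)"
  using sets_eq_imp_space_eq[OF sets_pair] by (simp add: space_pair_measure)

lemma kernel_fibre: "AE x in \<mu>. (AE \<gamma> in K1 x. \<gamma> b = x) \<and> (AE \<gamma> in K2 x. \<gamma> b = x)"
  using disintegrations marginal1 marginal2 unfolding is_disintegration_def by (intro AE_conjI) metis+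

lemma kernel_emeasure:
  "A \<in> sets \<eta>1 \<Longrightarrow> (\<integral>\<^sup>+x. emeasure (K1 x) A \<partial>\<mu>) = emeasure \<eta>1 A"
  "A \<in> sets \<eta>2 \<Longrightarrow> (\<integral>\<^sup>+x. emeasure (K2 x) A \<partial>\<mu>) = emeasure \<eta>2 A"
  using disintegrations marginal1 marginal2 unfolding is_disintegration_def by auto

lemma prob_pair: "prob_space (K1 x \<Otimes>\<^sub>M K2 x)" "pair_prob_space (K1 x) (K2 x)"
proof -
  interpret A: prob_space "K1 x" by (rule probsD(1)[OF kernel_prob(1)])
  interpret B: prob_space "K2 x" by (rule probsD(1)[OF kernel_prob(2)])
  interpret pair_prob_space "K1 x" "K2 x" ..
  show "prob_space (K1 x \<Otimes>\<^sub>M K2 x)" "pair_prob_space (K1 x) (K2 x)" by unfold_locales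
qed

text \<open>The target is the space of sub-probabilities because, at exceptional points where the
  kernels miss their fibre, restriction to compatible pairs can lose mass.\<close>

lemma measurable_\<kappa>: "\<kappa> \<in> borel \<rightarrow>\<^sub>M subprob_algebra (borel_of (curves a c))"
proof (rule measurable_subprob_algebra)
  fix x
  show sets: "sets (\<kappa> x) = sets (borel_of (curves a c))" by (simp add: push_merge_def)
  show "subprob_space (\<kappa> x)"
  proof
    show "emeasure (\<kappa> x) (space (\<kappa> x)) \<le> 1"
      using emeasure_push_merge[OF abc sets_pair, of "space (\<kappa> x)" x] prob_space.emeasure_le_1[OF prob_pair(1)]
        sets.top[of "borel_of (curves a c :: (real \<Rightarrow> real^'d) topology)"]
      by (simp add: sets_eq_imp_space_eq[OF sets])
    show "space (\<kappa> x) \<noteq> {}"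
      unfolding sets_eq_imp_space_eq[OF sets] using curves_restrict[of a c "\<lambda>_. 0"]
      by (metis continuous_on_const empty_iff space_borel_of)
  qed
next
  fix A :: "(real \<Rightarrow> real^'d) set" assume A: "A \<in> sets (borel_of (curves a c))"
  let ?N = "borel_of (curves a b) \<Otimes>\<^sub>M borel_of (curves b c) :: ((real \<Rightarrow> real^'d) \<times> (real \<Rightarrow> real^'d)) measure"
  have "{(\<gamma>1, \<gamma>2) \<in> space ?N. \<gamma>1 b = \<gamma>2 b \<and> concat_curves a b c (\<gamma>1, \<gamma>2) \<in> A} \<in> sets ?N"
    using merge_preimage_measurable[OF abc refl A] .
  moreover have "(\<lambda>x. K1 x \<Otimes>\<^sub>M K2 x) \<in> borel \<rightarrow>\<^sub>M subprob_algebra ?N"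
    by (intro measurable_pair_measure measurable_prob_algebraD kernels)
  ultimately have "(\<lambda>x. emeasure (K1 x \<Otimes>\<^sub>M K2 x)
      {(\<gamma>1, \<gamma>2) \<in> space ?N. \<gamma>1 b = \<gamma>2 b \<and> concat_curves a b c (\<gamma>1, \<gamma>2) \<in> A}) \<in> borel_measurable borel"
    by (rule measurable_compose[OF _ measurable_emeasure_subprob_algebra, rotated])
  then show "(\<lambda>x. emeasure (\<kappa> x) A) \<in> borel_measurable borel"
    by (simp add: emeasure_push_merge[OF abc sets_pair A] space_pair) (simp add: space_pair_measure)
qed

text \<open>If both kernels sit on the fibre over \<open>x\<close>, almost every pair takes the
  common value \<open>x\<close> at \<open>b\<close>; hence no mass is lost in merging, and by Fubini
  properties of the two pieces hold jointly.\<close>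

lemma \<kappa>_full:
  assumes "AE \<gamma> in K1 x. \<gamma> b = x" "AE \<gamma> in K2 x. \<gamma> b = x"
    and P: "AE \<gamma> in K1 x. P \<gamma>" and Q: "AE \<gamma> in K2 x. Q \<gamma>" and A: "A \<in> sets (borel_of (curves a c))"
    and PQ: "\<And>g h. P g \<Longrightarrow> Q h \<Longrightarrow> g b = h b \<Longrightarrow> g \<in> topspace (curves a b) \<Longrightarrow> h \<in> topspace (curves b c)
      \<Longrightarrow> concat_curves a b c (g, h) \<in> A"
  shows "emeasure (\<kappa> x) A = 1"
proof -
  interpret pair_prob_space "K1 x" "K2 x" by (rule prob_pair)
  interpret P: prob_space "K1 x \<Otimes>\<^sub>M K2 x" by (rule prob_pair)
  let ?B = "{(\<gamma>1, \<gamma>2) \<in> space (K1 x \<Otimes>\<^sub>M K2 x). \<gamma>1 b = \<gamma>2 b \<and> concat_curves a b c (\<gamma>1, \<gamma>2) \<in> A}"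
  have B: "?B \<in> sets (K1 x \<Otimes>\<^sub>M K2 x)" using merge_preimage_measurable[OF abc sets_pair A] .
  have "AE g in K1 x. AE h in K2 x. (g, h) \<in> ?B"
    using assms(1) P AE_space
  proof eventually_elim
    fix g assume g: "g b = x" "P g" "g \<in> space (K1 x)"
    show "AE h in K2 x. (g, h) \<in> ?B"
      using assms(2) Q AE_space
      by eventually_elim (use g PQ probsD(3)[OF kernel_prob(1)] probsD(3)[OF kernel_prob(2)]
          in \<open>auto simp: space_pair_measure\<close>)
  qed
  then have "AE p in K1 x \<Otimes>\<^sub>M K2 x. p \<in> ?B"
  proof (intro AE_pair_measure)
    have "{p \<in> space (K1 x \<Otimes>\<^sub>M K2 x). p \<in> ?B} = ?B" by blast
    then show "{p \<in> space (K1 x \<Otimes>\<^sub>M K2 x). p \<in> ?B} \<in> sets (K1 x \<Otimes>\<^sub>M K2 x)"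
      by (simp only: B)
  qed
  then show ?thesis
    unfolding emeasure_push_merge[OF abc sets_pair A] using B by (intro P.emeasure_eq_1_AE) auto
qed

text \<open>Resolves the definite description: the bind is a probability measure since almost every
  \<kappa>-value is one, it satisfies the defining formula by integration against a bind, and
  bounded test functions determine a probability measure.\<close>

lemma glue_eq_bind: "glue a b c \<mu> \<eta>1 \<eta>2 = \<mu> \<bind> \<kappa>" (is "_ = ?\<eta>")
  and glue_probs: "glue a b c \<mu> \<eta>1 \<eta>2 \<in> probs (borel_of (curves a c))"
proof -
  interpret \<mu>: prob_space \<mu> by (rule prob_\<mu>)
  have m: "\<kappa> \<in> \<mu> \<rightarrow>\<^sub>M subprob_algebra (borel_of (curves a c))"
    using measurable_\<kappa> by (simp cong: measurable_cong_sets add: prob_\<mu>)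
  have sets: "sets (\<kappa> x) = sets (borel_of (curves a c))" for x by (simp add: push_merge_def)
  note space = sets_eq_imp_space_eq[OF sets]
  have "AE x in \<mu>. prob_space (\<kappa> x)"
    using kernel_fibre
  proof eventually_elim
    fix x assume "(AE \<gamma> in K1 x. \<gamma> b = x) \<and> (AE \<gamma> in K2 x. \<gamma> b = x)"
    then have "emeasure (\<kappa> x) (space (\<kappa> x)) = 1"
      using \<kappa>_full[of x "\<lambda>_. True" "\<lambda>_. True" "space (borel_of (curves a c))"] sets.top[of "borel_of (curves a c :: (real \<Rightarrow> real^'d) topology)"]
        measurable_space[OF measurable_concat_curves[OF abc sets_pair, of x]]
      by (simp add: space space_restrict_space space_pair)
    then show "prob_space (\<kappa> x)" by (rule prob_spaceI)
  qed
  then have "prob_space ?\<eta>" using m by (rule \<mu>.prob_space_bind)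
  moreover have "sets ?\<eta> = sets (borel_of (curves a c))"
    using sets by (rule sets_bind) (simp add: prob_\<mu>)
  ultimately have \<eta>: "?\<eta> \<in> probs (borel_of (curves a c))" by (simp add: space_prob_algebra)
  have int: "(\<integral>\<gamma>. \<phi> \<gamma> \<partial>?\<eta>) = (\<integral>x. (\<integral>\<gamma>. (\<phi> \<gamma> :: real) \<partial>\<kappa> x) \<partial>\<mu>)"
    if \<phi>: "\<phi> \<in> borel_measurable (borel_of (curves a c))" "bounded (\<phi> ` topspace (curves a c))" for \<phi>
  proof -
    obtain B where B: "\<And>\<gamma>. \<gamma> \<in> topspace (curves a c) \<Longrightarrow> norm (\<phi> \<gamma>) \<le> B"
      using \<phi>(2) by (auto simp: bounded_iff)
    show ?thesis
    proof (rule integral_bind[OF \<phi>(1) _ m])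
      show "\<bar>\<phi> y\<bar> \<le> B" if "y \<in> space (borel_of (curves a c))" for y
        using B that by simp
      show "AE x in \<mu>. emeasure (\<kappa> x) (space (\<kappa> x)) \<le> ennreal 1"
        using m by (intro AE_I2) (auto dest!: measurable_space simp: space_subprob_algebra intro: subprob_space.subprob_emeasure_le_1)
    qed (auto simp: prob_\<mu> \<mu>.finite_measure_axioms)
  qed
  show eq: "glue a b c \<mu> \<eta>1 \<eta>2 = ?\<eta>"
    unfolding glue_def
  proof (rule the_equality)
    fix \<eta> assume *: "\<eta> \<in> probs (borel_of (curves a c)) \<and>
        (\<forall>\<phi> \<in> borel_measurable (borel_of (curves a c)).
           bounded (\<phi> ` topspace (curves a c)) \<longrightarrow>
           (\<integral>\<gamma>. \<phi> \<gamma> \<partial>\<eta>) = (\<integral>x. (\<integral>\<gamma>. (\<phi> \<gamma> :: real) \<partial>\<kappa> x) \<partial>\<mu>))"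
    show "\<eta> = ?\<eta>"
      using * \<eta> int by (intro prob_measure_eqI_bounded[of _ "borel_of (curves a c)"]) auto
  qed (use \<eta> int in auto)
  show "glue a b c \<mu> \<eta>1 \<eta>2 \<in> probs (borel_of (curves a c))" using \<eta> eq by simp
qed

lemma emeasure_glue: "emeasure (glue a b c \<mu> \<eta>1 \<eta>2) A = (\<integral>\<^sup>+x. emeasure (\<kappa> x) A \<partial>\<mu>)"
  if "A \<in> sets (borel_of (curves a c))"
  unfolding glue_eq_bind
  using measurable_\<kappa> that by (intro emeasure_bind) (auto cong: measurable_cong_sets simp: prob_\<mu>)

text \<open>Transfers almost sure properties of the two pieces to the glued measure; it is later
  applied to the Lipschitz bound.\<close>

lemma AE_glue:
  assumes P: "AE \<gamma> in \<eta>1. P \<gamma>" and Q: "AE \<gamma> in \<eta>2. Q \<gamma>" and A: "A \<in> sets (borel_of (curves a c))"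
    and PQ: "\<And>g h. P g \<Longrightarrow> Q h \<Longrightarrow> g b = h b \<Longrightarrow> g \<in> topspace (curves a b) \<Longrightarrow> h \<in> topspace (curves b c)
      \<Longrightarrow> concat_curves a b c (g, h) \<in> A"
  shows "AE \<gamma> in glue a b c \<mu> \<eta>1 \<eta>2. \<gamma> \<in> A"
proof -
  interpret \<mu>: prob_space \<mu> by (rule prob_\<mu>)
  have P': "AE x in \<mu>. AE \<gamma> in K1 x. P \<gamma>"
  proof -
    obtain N where N: "{\<gamma> \<in> space \<eta>1. \<not> P \<gamma>} \<subseteq> N" "N \<in> sets \<eta>1" "emeasure \<eta>1 N = 0" using P by (rule AE_E)
    have [measurable]: "(\<lambda>x. emeasure (K1 x) N) \<in> borel_measurable \<mu>"
      using kernels N probsD(2)[OF \<eta>1] by (auto dest!: measurable_prob_algebraD cong: measurable_cong_sets simp: prob_\<mu>)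
    \<comment> \<open>The integral of these masses against \<mu> is the mass of \<open>N\<close>
      under \<eta>1, which vanishes, so almost every fibre measure sees \<open>N\<close> as a null
      set.\<close>
    have "AE x in \<mu>. emeasure (K1 x) N = 0"
      using kernel_emeasure(1)[OF N(2)] N(3) by (intro nn_integral_0_iff_AE[THEN iffD1]) auto
    then show ?thesis
    proof eventually_elim
      fix x assume "emeasure (K1 x) N = 0"
      then show "AE \<gamma> in K1 x. P \<gamma>"
        using N probsD[OF \<eta>1] probsD[OF kernel_prob(1)] by (intro AE_I[of _ _ N]) auto
    qed
  qed
  have Q': "AE x in \<mu>. AE \<gamma> in K2 x. Q \<gamma>"
  proof -
    obtain N where N: "{\<gamma> \<in> space \<eta>2. \<not> Q \<gamma>} \<subseteq> N" "N \<in> sets \<eta>2" "emeasure \<eta>2 N = 0" using Q by (rule AE_E)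
    have [measurable]: "(\<lambda>x. emeasure (K2 x) N) \<in> borel_measurable \<mu>"
      using kernels N probsD(2)[OF \<eta>2] by (auto dest!: measurable_prob_algebraD cong: measurable_cong_sets simp: prob_\<mu>)
    have "AE x in \<mu>. emeasure (K2 x) N = 0"
      using kernel_emeasure(2)[OF N(2)] N(3) by (intro nn_integral_0_iff_AE[THEN iffD1]) auto
    then show ?thesis
    proof eventually_elim
      fix x assume "emeasure (K2 x) N = 0"
      then show "AE \<gamma> in K2 x. Q \<gamma>"
        using N probsD[OF \<eta>2] probsD[OF kernel_prob(2)] by (intro AE_I[of _ _ N]) auto
    qed
  qed
  have "AE x in \<mu>. emeasure (\<kappa> x) A = 1"
    using kernel_fibre P' Q' by eventually_elim (rule \<kappa>_full[where P=P and Q=Q]; use A PQ in blast)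
  then have "emeasure (glue a b c \<mu> \<eta>1 \<eta>2) A = (\<integral>\<^sup>+x. 1 \<partial>\<mu>)"
    unfolding emeasure_glue[OF A] by (rule nn_integral_cong_AE)
  also have "\<dots> = 1" by (simp add: \<mu>.emeasure_space_1)
  finally show ?thesis
    using A probsD[OF glue_probs] by (subst prob_space.AE_in_set_eq_1) (auto simp: measure_def)
qed

text \<open>On each side of \<open>b\<close> only one factor of the product is evaluated, the other
  contributes its total mass 1, and integrating the remaining kernel against \<mu> returns the
  corresponding piece.\<close>

lemma glue_marginal:
  shows "t \<in> {a..b} \<Longrightarrow> distr (glue a b c \<mu> \<eta>1 \<eta>2) borel (\<lambda>\<gamma>. \<gamma> t) = distr \<eta>1 borel (\<lambda>\<gamma>. \<gamma> t)"
    and "t \<in> {b..c} \<Longrightarrow> distr (glue a b c \<mu> \<eta>1 \<eta>2) borel (\<lambda>\<gamma>. \<gamma> t) = distr \<eta>2 borel (\<lambda>\<gamma>. \<gamma> t)"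
proof -
  note glue = probsD[OF glue_probs]
  have ev: "(\<lambda>\<gamma>. \<gamma> t) \<in> glue a b c \<mu> \<eta>1 \<eta>2 \<rightarrow>\<^sub>M borel" if "t \<in> {a..c}" for t
    using measurable_eval[OF that] glue by (auto cong: measurable_cong_sets)
  have *: "emeasure (glue a b c \<mu> \<eta>1 \<eta>2) {\<gamma> \<in> topspace (curves a c). \<gamma> t \<in> B}
      = (\<integral>\<^sup>+x. emeasure (K1 x \<Otimes>\<^sub>M K2 x) {p \<in> space (K1 x \<Otimes>\<^sub>M K2 x). (if t \<le> b then fst p t else snd p t) \<in> B} \<partial>\<mu>)"
    if t: "t \<in> {a..c}" and B: "B \<in> sets borel" for t B
  proof -
    let ?A = "{\<gamma> \<in> topspace (curves a c). \<gamma> t \<in> B}"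
    have A: "?A \<in> sets (borel_of (curves a c))"
      using measurable_sets[OF measurable_eval[OF t] B] by (simp add: vimage_def Int_def conj_commute)
    show ?thesis
      unfolding emeasure_glue[OF A]
    proof (rule nn_integral_cong_AE)
      show "AE x in \<mu>. emeasure (\<kappa> x) ?A =
        emeasure (K1 x \<Otimes>\<^sub>M K2 x) {p \<in> space (K1 x \<Otimes>\<^sub>M K2 x). (if t \<le> b then fst p t else snd p t) \<in> B}"
        using kernel_fibre
      proof eventually_elim
        fix x assume x: "(AE \<gamma> in K1 x. \<gamma> b = x) \<and> (AE \<gamma> in K2 x. \<gamma> b = x)"
        interpret pair_prob_space "K1 x" "K2 x" by (rule prob_pair)
        have C: "{(\<gamma>1, \<gamma>2). \<gamma>1 b = \<gamma>2 b} \<inter> space (K1 x \<Otimes>\<^sub>M K2 x) \<in> sets (K1 x \<Otimes>\<^sub>M K2 x)"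
          using compatible_pairs_measurable[OF abc sets_pair] .
        have "AE p in K1 x \<Otimes>\<^sub>M K2 x. fst p b = snd p b"
        proof (rule AE_pair_measure)
          show "AE g in K1 x. AE h in K2 x. fst (g, h) b = snd (g, h) b"
            using x[THEN conjunct1]
          proof eventually_elim
            fix g assume "g b = x"
            then show "AE h in K2 x. fst (g, h) b = snd (g, h) b" using x[THEN conjunct2] by auto
          qed
          have "{p \<in> space (K1 x \<Otimes>\<^sub>M K2 x). fst p b = snd p b} =
            {(\<gamma>1, \<gamma>2). \<gamma>1 b = \<gamma>2 b} \<inter> space (K1 x \<Otimes>\<^sub>M K2 x)" by auto
          with C show "{p \<in> space (K1 x \<Otimes>\<^sub>M K2 x). fst p b = snd p b} \<in> sets (K1 x \<Otimes>\<^sub>M K2 x)" by simp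
        qed
        then have *: "AE p in K1 x \<Otimes>\<^sub>M K2 x. fst p b = snd p b" .
        show "emeasure (\<kappa> x) ?A =
          emeasure (K1 x \<Otimes>\<^sub>M K2 x) {p \<in> space (K1 x \<Otimes>\<^sub>M K2 x). (if t \<le> b then fst p t else snd p t) \<in> B}"
          unfolding emeasure_push_merge[OF abc sets_pair A]
        proof (intro emeasure_eq_AE)
          show "AE p in K1 x \<Otimes>\<^sub>M K2 x.
            (p \<in> {(\<gamma>1, \<gamma>2) \<in> space (K1 x \<Otimes>\<^sub>M K2 x). \<gamma>1 b = \<gamma>2 b \<and> concat_curves a b c (\<gamma>1, \<gamma>2) \<in> ?A}) =
            (p \<in> {p \<in> space (K1 x \<Otimes>\<^sub>M K2 x). (if t \<le> b then fst p t else snd p t) \<in> B})"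
            using *
          proof eventually_elim
            fix p :: "(real \<Rightarrow> real^'d) \<times> (real \<Rightarrow> real^'d)" assume "fst p b = snd p b"
            then have "concat_curves a b c p \<in> topspace (curves a c)" if "p \<in> space (K1 x \<Otimes>\<^sub>M K2 x)"
              using that measurable_space[OF measurable_concat_curves[OF abc sets_pair, of x], of p]
              by (auto simp: space_restrict_space case_prod_beta)
            moreover have "concat_curves a b c p t = (if t \<le> b then fst p t else snd p t)"
              using t by (auto simp: concat_curves_def split: prod.split)
            ultimately show "(p \<in> {(\<gamma>1, \<gamma>2) \<in> space (K1 x \<Otimes>\<^sub>M K2 x). \<gamma>1 b = \<gamma>2 b \<and> concat_curves a b c (\<gamma>1, \<gamma>2) \<in> ?A}) =
              (p \<in> {p \<in> space (K1 x \<Otimes>\<^sub>M K2 x). (if t \<le> b then fst p t else snd p t) \<in> B})"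
              using \<open>fst p b = snd p b\<close> by (auto split: prod.splits)
          qed
          show "{(\<gamma>1, \<gamma>2) \<in> space (K1 x \<Otimes>\<^sub>M K2 x). \<gamma>1 b = \<gamma>2 b \<and> concat_curves a b c (\<gamma>1, \<gamma>2) \<in> ?A} \<in> sets (K1 x \<Otimes>\<^sub>M K2 x)"
            by (rule merge_preimage_measurable[OF abc sets_pair A])
          have "(\<lambda>p. if t \<le> b then fst p t else snd p t) \<in> K1 x \<Otimes>\<^sub>M K2 x \<rightarrow>\<^sub>M borel"
          proof (cases "t \<le> b")
            case True
            then have "(\<lambda>p. fst p t) \<in> K1 x \<Otimes>\<^sub>M K2 x \<rightarrow>\<^sub>M borel"
              using t sets_pair[of x] by (intro measurable_compose[OF _ measurable_eval[of t a b]]) (auto cong: measurable_cong_sets)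
            then show ?thesis using True by simp
          next
            case False
            then have "(\<lambda>p. snd p t) \<in> K1 x \<Otimes>\<^sub>M K2 x \<rightarrow>\<^sub>M borel"
              using t sets_pair[of x] by (intro measurable_compose[OF _ measurable_eval[of t b c]]) (auto cong: measurable_cong_sets)
            then show ?thesis using False by simp
          qed
          from measurable_sets[OF this B]
          show "{p \<in> space (K1 x \<Otimes>\<^sub>M K2 x). (if t \<le> b then fst p t else snd p t) \<in> B} \<in> sets (K1 x \<Otimes>\<^sub>M K2 x)"
            by (simp add: vimage_def Int_def conj_commute)
        qed
      qed
    qed
  qed
  have eq: "distr (glue a b c \<mu> \<eta>1 \<eta>2) borel (\<lambda>\<gamma>. \<gamma> t) = distr \<eta>1 borel (\<lambda>\<gamma>. \<gamma> t)" if t: "t \<in> {a..b}" for t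
  proof (rule measure_eqI)
    fix B :: "(real^'d) set" assume "B \<in> sets (distr (glue a b c \<mu> \<eta>1 \<eta>2) borel (\<lambda>\<gamma>. \<gamma> t))"
    then have B: "B \<in> sets borel" by simp
    let ?G = "{\<gamma> \<in> topspace (curves a b). \<gamma> t \<in> B}"
    have G: "?G \<in> sets (borel_of (curves a b))"
      using measurable_sets[OF measurable_eval[OF t] B] by (simp add: vimage_def Int_def conj_commute)
    have ev1: "(\<lambda>\<gamma>. \<gamma> t) \<in> \<eta>1 \<rightarrow>\<^sub>M borel"
      using measurable_eval[OF t] probsD(2)[OF \<eta>1] by (auto cong: measurable_cong_sets)
    have fib: "emeasure (K1 x \<Otimes>\<^sub>M K2 x) {p \<in> space (K1 x \<Otimes>\<^sub>M K2 x). (if t \<le> b then fst p t else snd p t) \<in> B}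
        = emeasure (K1 x) ?G" for x
    proof -
      interpret pair_prob_space "K1 x" "K2 x" by (rule prob_pair)
      have "{p \<in> space (K1 x \<Otimes>\<^sub>M K2 x). (if t \<le> b then fst p t else snd p t) \<in> B} = ?G \<times> space (K2 x)"
        using t probsD(3)[OF kernel_prob(1)] by (auto simp: space_pair_measure)
      then show ?thesis
        using G probsD(2)[OF kernel_prob(1)] by (simp add: M2.emeasure_pair_measure_Times M2.emeasure_space_1)
    qed
    have tac: "t \<in> {a..c}" using t abc by auto
    have "emeasure (distr (glue a b c \<mu> \<eta>1 \<eta>2) borel (\<lambda>\<gamma>. \<gamma> t)) B
        = emeasure (glue a b c \<mu> \<eta>1 \<eta>2) {\<gamma> \<in> topspace (curves a c). \<gamma> t \<in> B}"
      using ev[OF tac] B by (simp add: emeasure_distr glue vimage_def Int_def conj_commute)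
    also have "\<dots> = (\<integral>\<^sup>+x. emeasure (K1 x) ?G \<partial>\<mu>)"
      unfolding *[OF tac B] fib ..
    also have "\<dots> = emeasure \<eta>1 ?G"
      using G probsD(2)[OF \<eta>1] by (intro kernel_emeasure) auto
    also have "\<dots> = emeasure (distr \<eta>1 borel (\<lambda>\<gamma>. \<gamma> t)) B"
      using ev1 B by (simp add: emeasure_distr probsD(3)[OF \<eta>1] vimage_def Int_def conj_commute)
    finally show "emeasure (distr (glue a b c \<mu> \<eta>1 \<eta>2) borel (\<lambda>\<gamma>. \<gamma> t)) B = emeasure (distr \<eta>1 borel (\<lambda>\<gamma>. \<gamma> t)) B" .
  qed simp
  then show "t \<in> {a..b} \<Longrightarrow> distr (glue a b c \<mu> \<eta>1 \<eta>2) borel (\<lambda>\<gamma>. \<gamma> t) = distr \<eta>1 borel (\<lambda>\<gamma>. \<gamma> t)" .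
  assume t: "t \<in> {b..c}"
  show "distr (glue a b c \<mu> \<eta>1 \<eta>2) borel (\<lambda>\<gamma>. \<gamma> t) = distr \<eta>2 borel (\<lambda>\<gamma>. \<gamma> t)"
  \<comment> \<open>A merged curve takes its value at \<open>b\<close> from the first piece; this
    time is settled by the first claim together with the common marginal.\<close>
  proof (cases "t = b")
    case True
    then show ?thesis using eq[of b] abc marginal1 marginal2 by simp
  next
    case False
    show ?thesis
    proof (rule measure_eqI)
      fix B :: "(real^'d) set" assume "B \<in> sets (distr (glue a b c \<mu> \<eta>1 \<eta>2) borel (\<lambda>\<gamma>. \<gamma> t))"
      then have B: "B \<in> sets borel" by simp
      let ?G = "{\<gamma> \<in> topspace (curves b c). \<gamma> t \<in> B}"
      have G: "?G \<in> sets (borel_of (curves b c))"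
        using measurable_sets[OF measurable_eval[OF t] B] by (simp add: vimage_def Int_def conj_commute)
      have ev2: "(\<lambda>\<gamma>. \<gamma> t) \<in> \<eta>2 \<rightarrow>\<^sub>M borel"
        using measurable_eval[OF t] probsD(2)[OF \<eta>2] by (auto cong: measurable_cong_sets)
      have fib: "emeasure (K1 x \<Otimes>\<^sub>M K2 x) {p \<in> space (K1 x \<Otimes>\<^sub>M K2 x). (if t \<le> b then fst p t else snd p t) \<in> B}
          = emeasure (K2 x) ?G" for x
      proof -
        interpret pair_prob_space "K1 x" "K2 x" by (rule prob_pair)
        have "{p \<in> space (K1 x \<Otimes>\<^sub>M K2 x). (if t \<le> b then fst p t else snd p t) \<in> B} = space (K1 x) \<times> ?G"
          using t False probsD(3)[OF kernel_prob(2)] by (auto simp: space_pair_measure)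
        then show ?thesis
          using G probsD(2)[OF kernel_prob(2)] by (simp add: M2.emeasure_pair_measure_Times M1.emeasure_space_1)
      qed
      have tac: "t \<in> {a..c}" using t abc by auto
      have "emeasure (distr (glue a b c \<mu> \<eta>1 \<eta>2) borel (\<lambda>\<gamma>. \<gamma> t)) B
          = emeasure (glue a b c \<mu> \<eta>1 \<eta>2) {\<gamma> \<in> topspace (curves a c). \<gamma> t \<in> B}"
        using ev[OF tac] B by (simp add: emeasure_distr glue vimage_def Int_def conj_commute)
      also have "\<dots> = (\<integral>\<^sup>+x. emeasure (K2 x) ?G \<partial>\<mu>)"
        unfolding *[OF tac B] fib ..
      also have "\<dots> = emeasure \<eta>2 ?G"
        using G probsD(2)[OF \<eta>2] by (intro kernel_emeasure) auto
      also have "\<dots> = emeasure (distr \<eta>2 borel (\<lambda>\<gamma>. \<gamma> t)) B"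
        using ev2 B by (simp add: emeasure_distr probsD(3)[OF \<eta>2] vimage_def Int_def conj_commute)
      finally show "emeasure (distr (glue a b c \<mu> \<eta>1 \<eta>2) borel (\<lambda>\<gamma>. \<gamma> t)) B = emeasure (distr \<eta>2 borel (\<lambda>\<gamma>. \<gamma> t)) B" .
    qed simp
  qed
qed

end

section \<open>Representation of the Lattice Approximate Solutions\<close>

lemma sets_dirac_sum [simp]: "sets (dirac_sum M I w p) = sets M"
  and space_dirac_sum [simp]: "space (dirac_sum M I w p) = space M"
  by (simp_all add: dirac_sum_def)

lemma dirac_sum_probs_iff:
  assumes "finite I" "p \<in> I \<rightarrow> space M"
  shows "dirac_sum M I w p \<in> probs M \<longleftrightarrow> sum w I = 1"
proof -
  have "emeasure (dirac_sum M I w p) (space M) = (\<Sum>i\<in>I. w i)"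
    using assms by (subst emeasure_dirac_sum) (auto intro!: sum.cong simp: indicator_def)
  then show ?thesis
    by (auto simp: space_prob_algebra intro!: prob_spaceI dest!: prob_space.emeasure_space_1)
qed

lemma AE_dirac_sum:
  assumes "finite I" "p \<in> I \<rightarrow> space M" "A \<in> sets M" "\<And>i. i \<in> I \<Longrightarrow> w i \<noteq> 0 \<Longrightarrow> p i \<in> A"
  shows "AE x in dirac_sum M I w p. x \<in> A"
proof (rule AE_I)
  show "emeasure (dirac_sum M I w p) (space M - A) = 0"
    using assms by (subst emeasure_dirac_sum) (auto simp: indicator_def)
qed (use assms in auto)

lemma distr_dirac_sum:
  assumes "p \<in> I \<rightarrow> space M" "f \<in> M \<rightarrow>\<^sub>M N"
  shows "distr (dirac_sum M I w p) N f = dirac_sum N I w (\<lambda>i. f (p i))"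
  unfolding dirac_sum_def using assms
  by (subst distr_distr) (auto simp: measurable_point_measure_eq1 comp_def)

text \<open>Equal total masses turn a one-sided comparison into equality: apply it to the
  complement. This serves the comparison of a node with the next step at local time 0, where only
  one inequality is direct.\<close>

lemma prob_measure_eqI_le:
  assumes P: "P \<in> probs M" and Q: "Q \<in> probs M" and le: "\<And>A. A \<in> sets M \<Longrightarrow> emeasure P A \<le> emeasure Q A"
  shows "P = Q"
proof (rule measure_eqI)
  note p = probsD[OF P] and q = probsD[OF Q]
  interpret P: prob_space P by fact
  interpret Q: prob_space Q by fact
  show "sets P = sets Q" using p q by simp
  fix A assume "A \<in> sets P"
  then have A: "A \<in> sets P" "A \<in> sets Q" "A \<in> sets M" using p q by auto
  have "P.prob (space M - A) \<le> Q.prob (space M - A)"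
    using le[of "space M - A"] A by (simp add: P.emeasure_eq_measure Q.emeasure_eq_measure)
  then have "Q.prob A \<le> P.prob A"
    using P.prob_compl[of A] Q.prob_compl[of A] A p q by simp
  then show "emeasure P A = emeasure Q A"
    using le[of A] A by (simp add: P.emeasure_eq_measure Q.emeasure_eq_measure)
qed

section \<open>Lattices, cells and the mass they carry\<close>

lemma finite_lattice: "finite (lattice h R :: (real^'d) set)" if "h > 0"
proof -
  let ?A = "(\<lambda>k::int. h * of_int k) ` {-\<lceil>R/h\<rceil>..\<lceil>R/h\<rceil>}"
  have "lattice h R \<subseteq> (vec_lambda ` (UNIV \<rightarrow>\<^sub>E ?A) :: (real^'d) set)"
  proof
    fix x :: "real^'d" assume x: "x \<in> lattice h R"
    have "x $ i \<in> ?A" for i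
    proof -
      have "(\<exists>k::int. x $ i = h * of_int k) \<and> -R \<le> x $ i \<and> x $ i \<le> R"
        using x by (simp add: lattice_def)
      then obtain k :: int where k: "x $ i = h * of_int k" "-R \<le> x $ i" "x $ i \<le> R"
        by blast
      then have "-(R/h) \<le> of_int k" "of_int k \<le> R/h" using that by (auto simp: field_simps)
      then have "k \<in> {-\<lceil>R/h\<rceil>..\<lceil>R/h\<rceil>}" by (auto simp: le_ceiling_iff) linarith+
      then show ?thesis using k by auto
    qed
    then show "x \<in> vec_lambda ` (UNIV \<rightarrow>\<^sub>E ?A)"
      by (intro image_eqI[of _ _ "vec_nth x"]) auto
  qed
  moreover have "finite (UNIV \<rightarrow>\<^sub>E ?A :: ('d \<Rightarrow> real) set)" by (intro finite_PiE) auto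
  ultimately show ?thesis by (meson finite_surj)
qed

lemma cell_eq: "cell a h = {y. \<forall>i. a $ i \<le> y $ i \<and> y $ i < a $ i + h}"
  unfolding cell_def
proof (intro equalityI subsetI)
  fix y assume "y \<in> {y. \<forall>i. a $ i \<le> y $ i \<and> y $ i < a $ i + h}"
  then show "y \<in> (\<lambda>q. a + q) ` {q. \<forall>i. 0 \<le> q $ i \<and> q $ i < h}"
    by (intro image_eqI[of _ _ "y - a"]) (auto simp: algebra_simps)
qed auto

lemma cell_measurable [measurable]: "cell a h \<in> sets (borel :: (real^'d) measure)"
proof -
  have "{y \<in> space (borel :: (real^'d) measure). \<forall>i. a $ i \<le> y $ i \<and> y $ i < a $ i + h} \<in> sets borel"
    by measurable
  then show ?thesis by (simp add: cell_eq)
qed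

text \<open>Each coordinate of the common point pins the two integer multiples of \<open>h\<close>
  strictly within one unit of each other, hence equal.\<close>

lemma lattice_cell_unique:
  assumes "h > 0" "a \<in> lattice h R" "a' \<in> lattice h R'" "y \<in> cell a h" "y \<in> cell a' h"
  shows "a = a'"
  unfolding vec_eq_iff
proof
  fix i
  obtain k k' :: int where k: "a $ i = h * of_int k" "a' $ i = h * of_int k'"
    using assms by (fastforce simp: lattice_def)
  have "h * of_int k < h * of_int k' + h" "h * of_int k' < h * of_int k + h"
    using assms(4,5) k unfolding cell_eq by (metis (mono_tags, lifting) mem_Collect_eq order_le_less_trans)+
  then have "h * of_int k < h * of_int (k' + 1)" "h * of_int k' < h * of_int (k + 1)"
    by (auto simp: algebra_simps)
  then have "k < k' + 1" "k' < k + 1"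
    using assms(1) by (auto simp del: of_int_add)
  then show "a $ i = a' $ i" using k by simp
qed

lemma Times_in_borel: "A \<times> B \<in> sets borel" if "A \<in> sets borel" "B \<in> sets borel"
  for A :: "'a::second_countable_topology set" and B :: "'b::second_countable_topology set"
  using that unfolding borel_prod[symmetric] by auto

lemma mv_eq: "mv V N \<mu> (x, v) = emeasure (V \<mu>) ({x} \<times> cell v (1 / real N))"
proof -
  have "{(x, w) | w. w \<in> cell v (1 / real N)} = {x} \<times> cell v (1 / real N)" by auto
  then show ?thesis by (simp add: mv_def)
qed

lemma finite_xgrid [simp]: "T > 0 \<Longrightarrow> N \<ge> 1 \<Longrightarrow> finite (xgrid T N)"
  and finite_vgrid [simp]: "N \<ge> 1 \<Longrightarrow> finite (vgrid N)"
  by (auto simp: xgrid_def vgrid_def intro!: finite_lattice)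

lemma sum_mv:
  assumes "N \<ge> 1" and V: "V \<mu> \<in> probs borel" and "finite X"
  shows "(\<Sum>p\<in>X \<times> vgrid N. mv V N \<mu> p) = emeasure (V \<mu>) (\<Union>(x,v)\<in>X \<times> vgrid N. {x} \<times> cell v (1 / real N))"
proof -
  let ?B = "\<lambda>(x::real^'d, v). {x} \<times> cell v (1 / real N)"
  have "(\<Sum>p\<in>X \<times> vgrid N. mv V N \<mu> p) = (\<Sum>p\<in>X \<times> vgrid N. emeasure (V \<mu>) (?B p))"
    by (intro sum.cong) (auto simp: mv_eq)
  also have "\<dots> = emeasure (V \<mu>) (\<Union>p\<in>X \<times> vgrid N. ?B p)"
  proof (rule sum_emeasure)
    show "?B ` (X \<times> vgrid N) \<subseteq> sets (V \<mu>)"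
      using probsD(2)[OF V] by (auto intro!: Times_in_borel)
    show "disjoint_family_on ?B (X \<times> vgrid N)"
      unfolding disjoint_family_on_def
      using assms(1) lattice_cell_unique[of "1 / real N" _ "real N" _ "real N"]
      by (fastforce simp: vgrid_def)
  qed (use assms in auto)
  finally show ?thesis by (simp add: case_prod_beta)
qed

lemma LAS_step_probs_iff:
  assumes "T > 0" "N \<ge> 1"
  shows "LAS_step T V N \<mu> t \<in> probs borel \<longleftrightarrow> (\<Sum>p\<in>xgrid T N \<times> vgrid N. mv V N \<mu> p) = 1"
  unfolding LAS_step_def by (rule dirac_sum_probs_iff) (use assms in auto)

text \<open>At local time 0 the weights over grid points in \<open>A\<close> add up to mass that
  \<open>V \<mu>\<close> gives to disjoint subsets of \<open>A\<close> times the velocity space,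
  hence to at most \<open>\<mu> A\<close> by the projection property. Both sides are probability
  measures, so equality follows. In particular \<mu> is carried by the grid.\<close>

lemma LAS_step_0:
  fixes \<mu> :: "(real^'d) measure"
  assumes TN: "T > 0" "N \<ge> 1" and V: "pvf V" and \<mu>: "\<mu> \<in> probs borel"
    and 1: "(\<Sum>p\<in>xgrid T N \<times> vgrid N. mv V N \<mu> p) = 1"
  shows "LAS_step T V N \<mu> 0 = \<mu>"
proof (rule prob_measure_eqI_le)
  show "LAS_step T V N \<mu> 0 \<in> probs borel" using LAS_step_probs_iff[OF TN] 1 by blast
  show "\<mu> \<in> probs borel" by fact
  have V\<mu>: "V \<mu> \<in> probs borel" and fst: "distr (V \<mu>) borel fst = \<mu>"
    using V \<mu> by (auto simp: pvf_def)
  fix A :: "(real^'d) set" assume A: "A \<in> sets borel"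
  let ?X = "xgrid T N \<inter> A"
  have fin: "finite ?X" using TN by simp
  have "emeasure (LAS_step T V N \<mu> 0) A = (\<Sum>(x, v)\<in>xgrid T N \<times> vgrid N. mv V N \<mu> (x, v) * indicator A x)"
    unfolding LAS_step_def using TN A
    by (subst emeasure_dirac_sum) (auto simp: case_prod_unfold)
  also have "\<dots> = (\<Sum>p\<in>?X \<times> vgrid N. mv V N \<mu> p)"
    using TN by (intro sum.mono_neutral_cong_right) (auto simp: indicator_def)
  also have "\<dots> = emeasure (V \<mu>) (\<Union>(x,v)\<in>?X \<times> vgrid N. {x} \<times> cell v (1 / real N))"
    using TN fin V\<mu> by (intro sum_mv) auto
  also have "\<dots> \<le> emeasure (V \<mu>) (fst -` A \<inter> space (V \<mu>))"
  proof (rule emeasure_mono)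
    have "A \<times> (UNIV :: (real^'d) set) \<in> sets borel" using A by (intro Times_in_borel) auto
    moreover have "fst -` A \<inter> space (V \<mu>) = A \<times> UNIV" using probsD(3)[OF V\<mu>] by auto
    ultimately show "fst -` A \<inter> space (V \<mu>) \<in> sets (V \<mu>)" using probsD(2)[OF V\<mu>] by simp
  qed (use probsD(3)[OF V\<mu>] in auto)
  also have "\<dots> = emeasure (distr (V \<mu>) borel fst) A"
    using A probsD(2)[OF V\<mu>]
    by (subst emeasure_distr) (auto cong: measurable_cong_sets simp: borel_prod[symmetric])
  finally show "emeasure (LAS_step T V N \<mu> 0) A \<le> emeasure \<mu> A" using fst by simp
qed

lemma tick_simps: "tick T N 0 = 0" "tick T N (Suc k) = tick T N k + T / real N"
  by (simp_all add: tick_def algebra_simps add_divide_distrib)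

lemma tick_mono: "T > 0 \<Longrightarrow> k \<le> l \<Longrightarrow> tick T N k \<le> tick T N l"
  unfolding tick_def by (intro mult_right_mono) auto

lemma tick_last: "N \<ge> 1 \<Longrightarrow> tick T N N = T"
  by (simp add: tick_def)

section \<open>Lipschitz curves and their concatenation\<close>

definition lipschitz_curves :: "real \<Rightarrow> real \<Rightarrow> real \<Rightarrow> (real \<Rightarrow> real^'d) set" where
  "lipschitz_curves a b L = {\<gamma> \<in> topspace (curves a b). \<forall>s\<in>{a..b}. \<forall>t\<in>{a..b}. dist (\<gamma> s) (\<gamma> t) \<le> L * \<bar>s - t\<bar>}"

lemma closedin_lipschitz_curves: "closedin (curves a b) (lipschitz_curves a b L :: (real \<Rightarrow> real^'d) set)"
proof -
  have cl: "closedin (curves a b) {\<gamma> \<in> topspace (curves a b). dist (\<gamma> s) (\<gamma> t :: real^'d) \<in> {..L * \<bar>s - t\<bar>}}"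
    if "s \<in> {a..b}" "t \<in> {a..b}" for s t
  proof (rule closedin_continuous_map_preimage)
    show "continuous_map (curves a b) euclideanreal (\<lambda>\<gamma>. dist (\<gamma> s) (\<gamma> t :: real^'d))"
      using continuous_map_mdist[of "curves a b" euclidean_metric "\<lambda>\<gamma>. \<gamma> s :: real^'d" "\<lambda>\<gamma>. \<gamma> t"]
        continuous_map_eval[OF that(1)] continuous_map_eval[OF that(2)] by simp
  qed simp
  have "lipschitz_curves a b L = topspace (curves a b) \<inter>
     (\<Inter>s\<in>{a..b}. \<Inter>t\<in>{a..b}. {\<gamma> \<in> topspace (curves a b). dist (\<gamma> s) (\<gamma> t :: real^'d) \<in> {..L * \<bar>s - t\<bar>}})"
    by (auto simp: lipschitz_curves_def)
  also have "closedin (curves a b) \<dots>"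
  proof (cases "{a..b} = {}")
    case False
    then show ?thesis using cl by (intro closedin_Int closedin_topspace closedin_INT) auto
  next
    case True
    then show ?thesis by simp
  qed
  finally show ?thesis .
qed

text \<open>The constant does not deteriorate: for times on both sides of \<open>b\<close> the path
  through the common value costs \<open>L * (b - s) + L * (t - b)\<close>, which is exactly
  \<open>L * (t - s)\<close>.\<close>

lemma concat_lipschitz_curves:
  fixes g h :: "real \<Rightarrow> real^'d"
  assumes abc: "a \<le> b" "b \<le> c" and g: "g \<in> lipschitz_curves a b L" and h: "h \<in> lipschitz_curves b c L"
    and eq: "g b = h b" and c: "concat_curves a b c (g, h) \<in> topspace (curves a c)"
  shows "concat_curves a b c (g, h) \<in> lipschitz_curves a c L"
proof -
  let ?f = "concat_curves a b c (g, h)"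
  have f: "?f t = (if t \<le> b then g t else h t)" if "t \<in> {a..c}" for t
    using that by (simp add: concat_curves_def)
  have gl: "dist (g s) (g t) \<le> L * \<bar>s - t\<bar>" if "s \<in> {a..b}" "t \<in> {a..b}" for s t
    using g that unfolding lipschitz_curves_def by blast
  have hl: "dist (h s) (h t) \<le> L * \<bar>s - t\<bar>" if "s \<in> {b..c}" "t \<in> {b..c}" for s t
    using h that unfolding lipschitz_curves_def by blast
  have *: "dist (?f s) (?f t) \<le> L * (t - s)" if st: "a \<le> s" "s \<le> t" "t \<le> c" for s t
  proof -
    consider "t \<le> b" | "s \<le> b" "b < t" | "b < s" by linarith
    then show ?thesis
    proof cases
      case 1
      then have "dist (g s) (g t) \<le> L * \<bar>s - t\<bar>" using gl[of s t] st by simp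
      then show ?thesis using f 1 st by simp
    next
      case 2
      then have "dist (g s) (g b) \<le> L * \<bar>s - b\<bar>" "dist (h b) (h t) \<le> L * \<bar>b - t\<bar>"
        using gl[of s b] hl[of b t] st by auto
      then have "dist (g s) (h t) \<le> L * (b - s) + L * (t - b)"
        using 2 eq dist_triangle[of "g s" "h t" "g b"] by simp
      then show ?thesis using f 2 st by (simp add: algebra_simps)
    next
      case 3
      then have "dist (h s) (h t) \<le> L * \<bar>s - t\<bar>" using hl[of s t] st abc by simp
      then show ?thesis using f 3 st by simp
    qed
  qed
  have "dist (?f s) (?f t) \<le> L * \<bar>s - t\<bar>" if "s \<in> {a..c}" "t \<in> {a..c}" for s t
    using *[of s t] *[of t s] that by (cases "s \<le> t") (auto simp: dist_commute)
  then show ?thesis using c by (simp add: lipschitz_curves_def)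
qed

lemma concat_in_topspace:
  fixes g h :: "real \<Rightarrow> real^'d"
  assumes "a \<le> b" "b \<le> c" "g \<in> topspace (curves a b)" "h \<in> topspace (curves b c)" "g b = h b"
  shows "concat_curves a b c (g, h) \<in> topspace (curves a c)"
  using measurable_space[OF measurable_concat_curves[OF assms(1,2) refl], of "(g, h)"] assms
  by (simp add: space_restrict_space space_pair_measure)

text \<open>A fixed \<open>N\<close> for which the approximations stay probability measures on the
  whole time interval.\<close>

locale mass_preserving =
  fixes T :: real and V :: "(real^'d) measure \<Rightarrow> ((real^'d) \<times> (real^'d)) measure"
    and \<mu>0 :: "(real^'d) measure" and N :: nat
  assumes T: "T > 0" and N: "N \<ge> 1" and V: "pvf V" and nml: "no_mass_lost T V \<mu>0 N"
begin

abbreviation "node \<equiv> LAS_node T V \<mu>0 N"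
abbreviation "tk \<equiv> tick T N"

lemma tick_in: "k \<le> N \<Longrightarrow> tk k \<in> {0..T}"
  using tick_mono[OF T, of 0 k N] tick_mono[OF T, of k N N] tick_last[OF N, of T] by (simp add: tick_simps)

lemma node_probs: "k \<le> N \<Longrightarrow> node k \<in> probs borel"
  using nml tick_in[of k] LAS_tick[OF T N, of V \<mu>0 k] unfolding no_mass_lost_def by metis

text \<open>The sum is the total mass of the next node, which is a probability measure; hence the
  strict bound on \<open>l\<close>.\<close>

lemma sum_mv_node: "l < N \<Longrightarrow> (\<Sum>p\<in>xgrid T N \<times> vgrid N. mv V N (node l) p) = 1"
  using node_probs[of "Suc l"] LAS_step_probs_iff[OF T N, THEN iffD1] by simp

text \<open>The definition assigns a node time to the piece ending there. That the piece starting
  there gives the same value is the local time 0 statement, and it makes the formula valid on the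
  closed interval.\<close>

lemma LAS_eq_step:
  assumes "l < N" "t \<in> {tk l..tk (Suc l)}"
  shows "LAS T V \<mu>0 N t = LAS_step T V N (node l) (t - tk l)"
proof (cases "t = tk l")
  case True
  then show ?thesis
    using LAS_tick[OF T N] LAS_step_0[OF T N V node_probs sum_mv_node] assms by simp
next
  case False
  then show ?thesis using LAS_piece[OF T N, of "t - tk l" V \<mu>0 l] assms by (simp add: tick_simps)
qed

abbreviation "line l p \<equiv> restrict (\<lambda>t. fst p + (t - tk l) *\<^sub>R snd p) {tk l..tk (Suc l)}"

lemma eta_piece_eq: "eta_piece T V \<mu>0 N l = dirac_sum (borel_of (curves (tk l) (tk (Suc l))))
    (xgrid T N \<times> vgrid N) (mv V N (node l)) (line l)"
  by (simp add: eta_piece_def case_prod_unfold)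

lemma line_topspace: "line l p \<in> topspace (curves (tk l) (tk (Suc l)))"
  by (intro curves_restrict continuous_intros)

lemma eta_piece_probs: "l < N \<Longrightarrow> eta_piece T V \<mu>0 N l \<in> probs (borel_of (curves (tk l) (tk (Suc l))))"
  unfolding eta_piece_eq using T N line_topspace sum_mv_node[of l]
  by (subst dirac_sum_probs_iff) auto

lemma eta_piece_marginal:
  assumes "l < N" "t \<in> {tk l..tk (Suc l)}"
  shows "distr (eta_piece T V \<mu>0 N l) borel (\<lambda>\<gamma>. \<gamma> t) = LAS T V \<mu>0 N t"
proof -
  have "distr (eta_piece T V \<mu>0 N l) borel (\<lambda>\<gamma>. \<gamma> t) =
    dirac_sum borel (xgrid T N \<times> vgrid N) (mv V N (node l)) (\<lambda>p. line l p t)"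
    unfolding eta_piece_eq using line_topspace assms
    by (intro distr_dirac_sum measurable_eval) auto
  also have "\<dots> = LAS T V \<mu>0 N t"
    using assms by (simp add: LAS_eq_step LAS_step_def case_prod_unfold)
  finally show ?thesis .
qed

text \<open>Segments have speed \<open>norm v\<close>, and only those of nonzero weight are
  charged.\<close>

lemma eta_piece_lipschitz:
  assumes L: "\<And>x v. x \<in> xgrid T N \<Longrightarrow> v \<in> vgrid N \<Longrightarrow> mv V N (node l) (x, v) \<noteq> 0 \<Longrightarrow> norm v \<le> L"
  shows "AE \<gamma> in eta_piece T V \<mu>0 N l. \<gamma> \<in> lipschitz_curves (tk l) (tk (Suc l)) L"
  unfolding eta_piece_eq
proof (rule AE_dirac_sum)
  show "lipschitz_curves (tk l) (tk (Suc l)) L \<in> sets (borel_of (curves (tk l) (tk (Suc l))))"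
    by (intro closedin_in_sets_borel_of closedin_lipschitz_curves)
  fix p assume p: "p \<in> xgrid T N \<times> vgrid N" "mv V N (node l) p \<noteq> 0"
  then have v: "norm (snd p) \<le> L" using L[of "fst p" "snd p"] by auto
  have "dist (line l p s) (line l p t) \<le> L * \<bar>s - t\<bar>" if "s \<in> {tk l..tk (Suc l)}" "t \<in> {tk l..tk (Suc l)}" for s t
  proof -
    have "line l p s - line l p t = (s - t) *\<^sub>R snd p" using that by (simp add: algebra_simps)
    then have "dist (line l p s) (line l p t) = \<bar>s - t\<bar> * norm (snd p)" by (metis dist_norm norm_scaleR)
    also have "\<dots> \<le> L * \<bar>s - t\<bar>" using mult_left_mono[OF v, of "\<bar>s - t\<bar>"] by (simp add: mult.commute)
    finally show ?thesis .
  qed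
  then show "line l p \<in> lipschitz_curves (tk l) (tk (Suc l)) L"
    unfolding lipschitz_curves_def using line_topspace by blast
qed (use T N line_topspace in auto)

text \<open>The claims are proved in one induction, since the next glueing step requires that the
  measure built so far is a probability measure with the right marginal at its end time. The index
  is shifted: stage \<open>j\<close> already covers the pieces 0 to \<open>j\<close>.\<close>

lemma eta_upto:
  assumes "j < N"
  shows eta_upto_probs: "eta_upto T V \<mu>0 N j \<in> probs (borel_of (curves 0 (tk (Suc j))))" (is "?P j")
    and eta_upto_marginal: "\<forall>t\<in>{0..tk (Suc j)}. distr (eta_upto T V \<mu>0 N j) borel (\<lambda>\<gamma>. \<gamma> t) = LAS T V \<mu>0 N t" (is "?M j")
    and eta_upto_lipschitz: "\<forall>l<N. \<forall>x\<in>xgrid T N. \<forall>v\<in>vgrid N. mv V N (node l) (x, v) \<noteq> 0 \<longrightarrow> norm v \<le> L \<Longrightarrow>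
      AE \<gamma> in eta_upto T V \<mu>0 N j. \<gamma> \<in> lipschitz_curves 0 (tk (Suc j)) L" (is "?H \<Longrightarrow> ?L j")
proof -
  have "?P j \<and> ?M j \<and> (?H \<longrightarrow> ?L j)"
    using assms
  proof (induction j)
    case 0
    then show ?case
      using eta_piece_probs[of 0] eta_piece_marginal[of 0] eta_piece_lipschitz[of 0 L]
      unfolding eta_upto.simps by (simp add: tick_simps)
  next
    case (Suc j)
    let ?b = "tk (Suc j)" and ?c = "tk (Suc (Suc j))"
    note IH = Suc.IH[OF Suc_lessD[OF Suc.prems]]
    have b: "0 \<le> ?b" "?b \<le> ?c" using tick_mono[OF T, of "Suc j" "Suc (Suc j)"] tick_in[of "Suc j"] Suc.prems by auto
    interpret glueing 0 ?b ?c "node (Suc j)" "eta_upto T V \<mu>0 N j" "eta_piece T V \<mu>0 N (Suc j)" "xgrid T N"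
    proof
      show "distr (eta_upto T V \<mu>0 N j) borel (\<lambda>\<gamma>. \<gamma> ?b) = node (Suc j)"
        using IH b LAS_tick[OF T N, of V \<mu>0 "Suc j"] by auto
      show "distr (eta_piece T V \<mu>0 N (Suc j)) borel (\<lambda>\<gamma>. \<gamma> ?b) = node (Suc j)"
        using eta_piece_marginal[of "Suc j" ?b] Suc.prems b LAS_tick[OF T N, of V \<mu>0 "Suc j"] by auto
      \<comment> \<open>The finite carrier of the node: a step at local time 0 is a sum of Dirac
        masses at grid points by construction, and it equals the node.\<close>
      have "AE x in LAS_step T V N (node (Suc j)) 0. x \<in> xgrid T N"
        unfolding LAS_step_def using T N by (intro AE_dirac_sum borel_closed finite_imp_closed) auto
      moreover have "LAS_step T V N (node (Suc j)) 0 = node (Suc j)"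
        using Suc.prems by (intro LAS_step_0[OF T N V node_probs sum_mv_node]) auto
      ultimately show "AE x in node (Suc j). x \<in> xgrid T N" by metis
    qed (use T N b IH eta_piece_probs[OF Suc.prems] in auto)
    have "?M (Suc j)"
    proof
      fix t assume t: "t \<in> {0..?c}"
      then consider "t \<in> {0..?b}" | "t \<in> {?b..?c}" by fastforce
      then show "distr (eta_upto T V \<mu>0 N (Suc j)) borel (\<lambda>\<gamma>. \<gamma> t) = LAS T V \<mu>0 N t"
        using IH eta_piece_marginal[of "Suc j" t] Suc.prems glue_marginal[of t] by cases simp_all
    qed
    moreover have "?H \<longrightarrow> ?L (Suc j)"
    proof
      assume H: ?H
      have "AE \<gamma> in eta_piece T V \<mu>0 N (Suc j). \<gamma> \<in> lipschitz_curves ?b ?c L"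
        using H Suc.prems by (intro eta_piece_lipschitz) auto
      then show "?L (Suc j)"
        unfolding eta_upto.simps using IH H
        by (intro AE_glue[where P = "\<lambda>\<gamma>. \<gamma> \<in> lipschitz_curves 0 ?b L" and Q = "\<lambda>\<gamma>. \<gamma> \<in> lipschitz_curves ?b ?c L"])
          (auto intro!: closedin_in_sets_borel_of closedin_lipschitz_curves concat_lipschitz_curves b concat_in_topspace)
    qed
    ultimately show ?case using glue_probs by simp
  qed
  then show "?P j" "?M j" "?H \<Longrightarrow> ?L j" by auto
qed

lemma eta_representation: "prob_representation T (eta T V \<mu>0 N) (LAS T V \<mu>0 N)"
  using eta_upto_probs[of "N - 1"] eta_upto_marginal[of "N - 1"] N tick_last[OF N, of T]
  by (simp add: prob_representation_def eta_def)

lemma eta_lipschitz: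
  assumes "\<forall>l<N. \<forall>x\<in>xgrid T N. \<forall>v\<in>vgrid N. mv V N (node l) (x, v) \<noteq> 0 \<longrightarrow> norm v \<le> L"
  shows "AE \<gamma> in eta T V \<mu>0 N. \<gamma> \<in> lipschitz_curves 0 T L"
  using eta_upto_lipschitz[of "N - 1" L] N tick_last[OF N, of T] assms unfolding eta_def by simp

end

section \<open>Uniform bounds from the growth condition\<close>

text \<open>The complement of the support is the union of all open null sets; by Lindelof a
  countable subfamily has the same union, so it is null.\<close>

lemma AE_msupport:
  fixes M :: "'a::second_countable_topology measure"
  assumes "M \<in> probs borel"
  shows "AE x in M. x \<in> msupport M"
proof -
  have s: "sets M = sets borel" using probsD(2)[OF assms] .
  let ?F = "{U. open U \<and> emeasure M U = 0}"
  obtain F' where F': "F' \<subseteq> ?F" "countable F'" "\<Union>F' = \<Union>?F"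
    using Lindelof[of ?F] by auto
  have "(\<Union>U\<in>F'. U) \<in> null_sets M"
    using F' s by (intro null_sets_UN') (auto simp: null_sets_def)
  moreover have "- msupport M = \<Union>?F"
    by (auto simp: msupport_def)
  ultimately have "- msupport M \<in> null_sets M" using F'(3) by simp
  then have "AE x in M. x \<notin> - msupport M" by (rule AE_not_in)
  then show ?thesis by simp
qed

lemma msupport_subset_closed:
  assumes "sets M = sets borel" "closed F" "AE x in M. x \<in> F"
  shows "msupport M \<subseteq> F"
proof
  fix x assume x: "x \<in> msupport M"
  have "emeasure M (- F) = 0"
    using assms AE_iff_null_sets[of "- F" M] by (simp add: null_sets_def)
  then show "x \<in> F" using x assms(2) by (force simp: msupport_def not_gr_zero)
qed

text \<open>Rounding every coordinate down to a multiple of \<open>h\<close> gives the corner of the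
  cell. Rounding could leave the box only at its lower end, which is excluded because
  \<open>-R\<close> is itself such a multiple.\<close>

lemma lattice_cover:
  fixes y :: "real^'d"
  assumes h: "h > 0" and R: "R = h * of_nat n" and y: "norm y \<le> R"
  shows "\<exists>x\<in>lattice h R. y \<in> cell x h"
proof
  let ?x = "\<chi> i. h * of_int \<lfloor>y $ i / h\<rfloor> :: real^'d"
  have fl: "h * of_int \<lfloor>y $ i / h\<rfloor> \<le> y $ i" "y $ i < h * of_int \<lfloor>y $ i / h\<rfloor> + h" for i
  proof -
    have "of_int \<lfloor>y $ i / h\<rfloor> \<le> y $ i / h" "y $ i / h < of_int \<lfloor>y $ i / h\<rfloor> + 1" by linarith+
    then have "h * of_int \<lfloor>y $ i / h\<rfloor> \<le> h * (y $ i / h)" "h * (y $ i / h) < h * (of_int \<lfloor>y $ i / h\<rfloor> + 1)"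
      using h by (simp_all only: mult_le_cancel_left_pos mult_less_cancel_left_pos)
    then show "h * of_int \<lfloor>y $ i / h\<rfloor> \<le> y $ i" "y $ i < h * of_int \<lfloor>y $ i / h\<rfloor> + h"
      using h by (simp_all add: distrib_left)
  qed
  then show "y \<in> cell ?x h" by (simp add: cell_eq)
  have "-R \<le> h * of_int \<lfloor>y $ i / h\<rfloor>" for i
  proof -
    have "\<bar>y $ i\<bar> \<le> R" using component_le_norm_cart[of y i] y by linarith
    then have "of_int (- int n) \<le> y $ i / h" using R h by (simp add: field_simps)
    then have "- int n \<le> \<lfloor>y $ i / h\<rfloor>" by (simp only: le_floor_iff)
    then have "of_int (- int n) \<le> (of_int \<lfloor>y $ i / h\<rfloor> :: real)" by (simp only: of_int_le_iff)
    then have "h * of_int (- int n) \<le> h * of_int \<lfloor>y $ i / h\<rfloor>" using h by (intro mult_left_mono) auto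
    then show ?thesis using R by simp
  qed
  moreover have "h * of_int \<lfloor>y $ i / h\<rfloor> \<le> R" for i
    using fl(1)[of i] component_le_norm_cart[of y i] y by linarith
  ultimately show "?x \<in> lattice h R" by (auto simp: lattice_def)
qed

lemma cell_norm_le:
  fixes y :: "real^'d"
  assumes "y \<in> cell x h"
  shows "norm (x - y) \<le> real CARD('d) * h"
proof -
  have "norm (x - y) \<le> (\<Sum>i\<in>UNIV. \<bar>(x - y) $ i\<bar>)" by (rule norm_le_l1_cart)
  also have "\<dots> \<le> (\<Sum>i\<in>(UNIV :: 'd set). h)"
    using assms by (intro sum_mono) (force simp: cell_eq abs_le_iff algebra_simps less_imp_le)
  finally show ?thesis by simp
qed

lemma xgrid_cover:
  "T > 0 \<Longrightarrow> N \<ge> 1 \<Longrightarrow> norm y \<le> T * real N \<Longrightarrow> \<exists>x\<in>xgrid T N. y \<in> cell x (T / real N ^ 2)"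
  unfolding xgrid_def by (rule lattice_cover[where n = "N ^ 3"]) (auto simp: power2_eq_square power3_eq_cube)

lemma vgrid_cover:
  "N \<ge> 1 \<Longrightarrow> norm v \<le> real N \<Longrightarrow> \<exists>w\<in>vgrid N. v \<in> cell w (1 / real N)"
  unfolding vgrid_def by (rule lattice_cover[where n = "N ^ 2"]) (auto simp: power2_eq_square)

text \<open>A cell of positive mass meets the ball of radius \<open>R\<close>, so its corner is at
  most the cell diameter farther out. That diameter is bounded by the dimension times
  \<open>T\<close>, uniformly in \<open>N\<close>.\<close>

lemma LAS_initial_concentrated:
  fixes \<mu>0 :: "(real^'d) measure"
  assumes TN: "T > 0" "N \<ge> 1" and \<mu>0: "\<mu>0 \<in> probs borel" and R: "AE x in \<mu>0. norm x \<le> R" and RN: "R \<le> T * real N"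
  shows "LAS_initial T \<mu>0 N \<in> probs borel"
    and "AE x in LAS_initial T \<mu>0 N. x \<in> {x \<in> xgrid T N. norm x \<le> R + real CARD('d) * T}"
proof -
  let ?h = "T / real N ^ 2"
  have h: "?h > 0" "?h \<le> T" using TN by (auto simp: field_simps)
  note p = probsD[OF \<mu>0]
  interpret prob_space \<mu>0 by fact
  let ?U = "\<Union>x\<in>xgrid T N. cell x ?h"
  have U: "AE y in \<mu>0. y \<in> ?U"
    using R
  proof eventually_elim
    fix y :: "real^'d" assume "norm y \<le> R"
    then show "y \<in> ?U" using xgrid_cover[OF TN, of y] RN by auto
  qed
  have "(\<Sum>x\<in>xgrid T N. emeasure \<mu>0 (cell x ?h)) = emeasure \<mu>0 ?U"
  proof (rule sum_emeasure)
    show "disjoint_family_on (\<lambda>x. cell x ?h) (xgrid T N :: (real^'d) set)"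
      unfolding disjoint_family_on_def
    proof (intro ballI impI equals0I)
      fix a b y :: "real^'d"
      assume "a \<in> xgrid T N" "b \<in> xgrid T N" "a \<noteq> b" "y \<in> cell a ?h \<inter> cell b ?h"
      then show False using lattice_cell_unique[OF h(1), of a "T * real N" b "T * real N" y] by (simp add: xgrid_def)
    qed
  qed (use TN p in auto)
  also have "\<dots> = 1"
    using U p TN by (intro emeasure_eq_1_AE) auto
  finally show "LAS_initial T \<mu>0 N \<in> probs borel"
    unfolding LAS_initial_def using TN by (subst dirac_sum_probs_iff) auto
  show "AE x in LAS_initial T \<mu>0 N. x \<in> {x \<in> xgrid T N. norm x \<le> R + real CARD('d) * T}"
    unfolding LAS_initial_def
  proof (rule AE_dirac_sum)
    fix x :: "real^'d" assume x: "x \<in> xgrid T N" "emeasure \<mu>0 (cell x ?h) \<noteq> 0"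
    have "\<not> (AE y in \<mu>0. y \<notin> cell x ?h)"
      using x(2) p AE_iff_null_sets[of "cell x ?h" \<mu>0] by (auto simp: null_sets_def)
    moreover have "AE y in \<mu>0. y \<notin> cell x ?h" if "\<And>y. y \<in> cell x ?h \<Longrightarrow> \<not> norm y \<le> R"
      using R by eventually_elim (use that in auto)
    ultimately obtain y where y: "y \<in> cell x ?h" "norm y \<le> R" by blast
    have "norm x \<le> norm (x - y) + norm y" by (metis diff_add_cancel norm_triangle_ineq)
    also have "\<dots> \<le> real CARD('d) * ?h + R" using cell_norm_le[OF y(1)] y(2) by linarith
    also have "\<dots> \<le> R + real CARD('d) * T" using mult_left_mono[OF h(2), of "real CARD('d)"] by simp
    finally show "x \<in> {x \<in> xgrid T N. norm x \<le> R + real CARD('d) * T}" using x by simp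
  qed (use TN in \<open>auto intro!: borel_closed finite_imp_closed\<close>)
qed

text \<open>A measure carried by finitely many grid points has compact support, so the growth
  condition bounds the velocities by \<open>C * (1 + R)\<close>. If the velocity grid reaches that
  far, all mass falls into cells; the dimension in \<open>L\<close> pays for moving a velocity to
  the corner of its cell.\<close>

lemma LAS_step_concentrated:
  fixes \<mu> :: "(real^'d) measure"
  assumes TN: "T > 0" "N \<ge> 1" and V: "pvf V" and \<mu>: "\<mu> \<in> probs borel"
    and C: "C > 0" and gr: "\<And>\<nu>. \<nu> \<in> probs_c \<Longrightarrow>
      (SUP p\<in>msupport (V \<nu>). ennreal (norm (snd p))) \<le> ennreal C * (1 + (SUP x\<in>msupport \<nu>. ennreal (norm x)))"
    and R: "R \<ge> 0" "AE x in \<mu>. x \<in> {x \<in> xgrid T N. norm x \<le> R}"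
    and N_large: "C * (1 + R) \<le> real N"
    and L: "L = (C + real CARD('d)) * (1 + R)"
  shows sum_mv_eq_1: "(\<Sum>p\<in>xgrid T N \<times> vgrid N. mv V N \<mu> p) = 1"
    and mv_nonzero: "\<And>x v. mv V N \<mu> (x, v) \<noteq> 0 \<Longrightarrow> norm x \<le> R \<and> norm v \<le> L"
    and LAS_step_tick_concentrated: "R + T / real N * L \<le> T * real N \<Longrightarrow>
      AE x in LAS_step T V N \<mu> (T / real N). x \<in> {x \<in> xgrid T N. norm x \<le> R + T / real N * L}"
proof -
  let ?X = "{x \<in> xgrid T N. norm x \<le> R} :: (real^'d) set"
  have finX: "finite ?X" using TN by simp
  have V\<mu>: "V \<mu> \<in> probs borel" and fst: "distr (V \<mu>) borel fst = \<mu>"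
    using V \<mu> by (auto simp: pvf_def)
  note p = probsD[OF V\<mu>]
  interpret prob_space "V \<mu>" by fact
  have supp: "msupport \<mu> \<subseteq> ?X"
    using probsD(2)[OF \<mu>] finX R by (intro msupport_subset_closed finite_imp_closed) auto
  then have "\<mu> \<in> probs_c"
    using \<mu> finX by (auto simp: probs_c_def intro!: finite_imp_compact intro: finite_subset)
  from gr[OF this] have "(SUP p\<in>msupport (V \<mu>). ennreal (norm (snd p))) \<le> ennreal C * (1 + (SUP x\<in>msupport \<mu>. ennreal (norm x)))" .
  also have "\<dots> \<le> ennreal C * (1 + ennreal R)"
    using supp by (intro mult_left_mono add_left_mono SUP_least ennreal_leI) auto
  also have "\<dots> = ennreal (C * (1 + R))"
    using C R by (simp add: ennreal_mult ennreal_plus flip: ennreal_1)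
  finally have vb: "norm (snd q) \<le> C * (1 + R)" if "q \<in> msupport (V \<mu>)" for q
    using that C R by (auto simp: SUP_le_iff)
  have fst_m: "fst \<in> V \<mu> \<rightarrow>\<^sub>M borel"
    using p(2) by (auto cong: measurable_cong_sets simp: borel_prod[symmetric])
  have fX: "AE q in V \<mu>. fst q \<in> ?X"
    using R(2) AE_distrD[OF fst_m, of "\<lambda>x. x \<in> ?X"] unfolding fst by blast
  have good: "AE q in V \<mu>. fst q \<in> ?X \<and> norm (snd q) \<le> C * (1 + R)"
    using fX AE_msupport[OF V\<mu>] by eventually_elim (use vb in auto)
  let ?U = "\<Union>(x,v)\<in>xgrid T N \<times> vgrid N. {x} \<times> cell v (1 / real N) :: ((real^'d) \<times> (real^'d)) set"
  have "AE q in V \<mu>. q \<in> ?U"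
    using good
  proof eventually_elim
    fix q :: "(real^'d) \<times> (real^'d)" assume q: "fst q \<in> ?X \<and> norm (snd q) \<le> C * (1 + R)"
    then obtain w where "w \<in> vgrid N" "snd q \<in> cell w (1 / real N)"
      using vgrid_cover[OF TN(2), of "snd q"] N_large by auto
    then show "q \<in> ?U" using q by (cases q) auto
  qed
  moreover have "?U \<in> sets (V \<mu>)"
    unfolding p(2) using TN by (intro sets.finite_UN) (auto intro!: Times_in_borel)
  ultimately have "emeasure (V \<mu>) ?U = 1" by (intro emeasure_eq_1_AE) auto
  then show 1: "(\<Sum>p\<in>xgrid T N \<times> vgrid N. mv V N \<mu> p) = 1"
    using sum_mv[where V=V and \<mu>=\<mu> and X="xgrid T N" and N=N] TN V\<mu> by simp
  show mv: "norm x \<le> R \<and> norm v \<le> L" if "mv V N \<mu> (x, v) \<noteq> 0" for x v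
  proof -
    let ?B = "{x} \<times> cell v (1 / real N)"
    have "?B \<in> sets (V \<mu>)" unfolding p(2) by (intro Times_in_borel) auto
    then have "\<not> (AE q in V \<mu>. q \<notin> ?B)"
      using that AE_iff_null_sets[of ?B "V \<mu>"] by (auto simp: mv_eq)
    moreover have "AE q in V \<mu>. q \<notin> ?B" if "\<And>q. q \<in> ?B \<Longrightarrow> \<not> (fst q \<in> ?X \<and> norm (snd q) \<le> C * (1 + R))"
      using good by eventually_elim (use that in blast)
    ultimately obtain q where q: "q \<in> ?B" "fst q \<in> ?X" "norm (snd q) \<le> C * (1 + R)" by blast
    then obtain w where w: "w \<in> cell v (1 / real N)" "norm w \<le> C * (1 + R)" "norm x \<le> R" by auto
    have "norm v \<le> norm (v - w) + norm w" by (metis diff_add_cancel norm_triangle_ineq)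
    also have "\<dots> \<le> real CARD('d) * (1 / real N) + C * (1 + R)" using cell_norm_le[OF w(1)] w(2) by linarith
    \<comment> \<open>The rounding error is inflated from 1/N to \<open>1 + R\<close> so that
      \<open>L\<close> is a multiple of \<open>1 + R\<close> with a factor free of
      \<open>N\<close>.\<close>
    also have "\<dots> \<le> real CARD('d) * (1 + R) + C * (1 + R)"
      using TN R by (intro add_right_mono mult_left_mono) (auto simp: field_simps intro: add_increasing2)
    finally show ?thesis using w L by (simp add: algebra_simps)
  qed
  assume le: "R + T / real N * L \<le> T * real N"
  show "AE x in LAS_step T V N \<mu> (T / real N). x \<in> {x \<in> xgrid T N. norm x \<le> R + T / real N * L}"
    unfolding LAS_step_def
  proof (rule AE_dirac_sum)
    fix q assume q: "q \<in> xgrid T N \<times> (vgrid N :: (real^'d) set)" "mv V N \<mu> q \<noteq> 0"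
    obtain x v where xv: "q = (x, v)" "x \<in> xgrid T N" "v \<in> vgrid N" "norm x \<le> R" "norm v \<le> L"
      using q mv by (cases q) auto
    let ?y = "x + (T / real N) *\<^sub>R v"
    have "norm ?y \<le> norm x + T / real N * norm v" using norm_triangle_ineq[of x "(T / real N) *\<^sub>R v"] TN by simp
    also have "\<dots> \<le> R + T / real N * L" using xv TN by (intro add_mono mult_left_mono) auto
    finally have ny: "norm ?y \<le> R + T / real N * L" .
    \<comment> \<open>One time step times the velocity mesh is the space mesh: (T/N)(1/N) = T/N^2. A
      full step therefore maps lattice points to lattice points.\<close>
    have "?y \<in> xgrid T N"
      unfolding xgrid_def lattice_def
    proof (intro CollectI allI conjI)
      fix i
      obtain k k' :: int where k: "x $ i = T / real N ^ 2 * of_int k" "v $ i = 1 / real N * of_int k'"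
        using xv unfolding xgrid_def vgrid_def lattice_def by blast
      have "?y $ i = T / real N ^ 2 * of_int (k + k')"
        using TN by (simp add: k power2_eq_square field_simps)
      then show "\<exists>k::int. ?y $ i = T / real N ^ 2 * of_int k" by blast
      have "\<bar>?y $ i\<bar> \<le> T * real N" using component_le_norm_cart[of ?y i] ny le by linarith
      then show "- (T * real N) \<le> ?y $ i" "?y $ i \<le> T * real N" by linarith+
    qed
    then show "(case q of (x, v) \<Rightarrow> x + (T / real N) *\<^sub>R v) \<in> {x \<in> xgrid T N. norm x \<le> R + T / real N * L}"
      using ny xv by simp
  qed (use TN in \<open>auto intro!: borel_closed finite_imp_closed\<close>)
qed

text \<open>Within one piece the weights do not depend on time, so mass conservation at finitely
  many nodes covers all times.\<close>

lemma no_mass_lostI: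
  assumes TN: "T > 0" "N \<ge> 1" and 0: "LAS_initial T \<mu>0 N \<in> probs borel"
    and 1: "\<And>l. l < N \<Longrightarrow> (\<Sum>p\<in>xgrid T N \<times> vgrid N. mv V N (LAS_node T V \<mu>0 N l) p) = 1"
  shows "no_mass_lost T V \<mu>0 N"
  unfolding no_mass_lost_def
proof
  fix t assume t: "t \<in> {0..T}"
  show "LAS T V \<mu>0 N t \<in> probs borel"
  proof (cases "t \<le> 0")
    case True
    then show ?thesis using 0 by (simp add: LAS_def)
  next
    case False
    define k where "k = nat \<lceil>t / (T / real N)\<rceil> - 1"
    have "t / (T / real N) \<le> of_int (int N)" using t TN by (simp add: field_simps)
    then have "\<lceil>t / (T / real N)\<rceil> \<le> int N" by (simp only: ceiling_le_iff)
    then have "k < N" using TN by (simp add: k_def)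
    then show ?thesis
      using False LAS_step_probs_iff[OF TN, THEN iffD2, OF 1, of k] by (simp add: LAS_def k_def Let_def)
  qed
qed

text \<open>With \<open>C' = C + d\<close>, the quantity \<open>1 + R\<close>, where \<open>R\<close> bounds the support, grows at most by the
  factor \<open>1 + T C' / N\<close> per step, hence by \<open>exp (T C')\<close> over the \<open>N\<close> steps.\<close>

lemma eventually_uniformly_bounded:
  fixes V :: "(real^'d) measure \<Rightarrow> ((real^'d) \<times> (real^'d)) measure"
  assumes T: "T > 0" and V: "pvf V" and g: "pvf_growth V" and \<mu>0: "\<mu>0 \<in> probs_c"
  obtains B L N0 where "\<And>N. N \<ge> N0 \<Longrightarrow> N \<ge> 1 \<and> no_mass_lost T V \<mu>0 N \<and>
     (AE x in LAS_initial T \<mu>0 N. norm x \<le> B) \<and>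
     (\<forall>l<N. \<forall>x v. mv V N (LAS_node T V \<mu>0 N l) (x, v) \<noteq> 0 \<longrightarrow> norm v \<le> L)"
proof -
  obtain C where C: "C > 0" and gr: "\<And>\<nu>. \<nu> \<in> probs_c \<Longrightarrow>
      (SUP p\<in>msupport (V \<nu>). ennreal (norm (snd p))) \<le> ennreal C * (1 + (SUP x\<in>msupport \<nu>. ennreal (norm x)))"
    using g unfolding pvf_growth_def by blast
  have \<mu>0p: "\<mu>0 \<in> probs borel" and "compact (msupport \<mu>0)" using \<mu>0 by (auto simp: probs_c_def)
  then obtain R0 where R0: "R0 > 0" "\<And>x. x \<in> msupport \<mu>0 \<Longrightarrow> norm x \<le> R0"
    using compact_imp_bounded bounded_pos by metis
  have AE0: "AE x in \<mu>0. norm x \<le> R0"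
    using AE_msupport[OF \<mu>0p] by eventually_elim (rule R0)
  define C' where "C' = C + real CARD('d)"
  have C': "C' > 0" "C \<le> C'" using C by (auto simp: C'_def)
  \<comment> \<open>One plus the radius of the initial approximation: the radius of the support of
    \<mu>0 plus the discretisation error.\<close>
  define B0 where "B0 = 1 + R0 + real CARD('d) * T"
  have B0: "B0 \<ge> 1" using R0 T by (simp add: B0_def)
  define B where "B = B0 * exp (T * C')"
  have B: "B0 \<le> B" "B \<ge> 1"
  proof -
    have "B0 * 1 \<le> B0 * exp (T * C')" using B0 T C' by (intro mult_left_mono) auto
    then show "B0 \<le> B" by (simp add: B_def)
    then show "B \<ge> 1" using B0 by simp
  qed
  \<comment> \<open>The first bound makes the velocity grid large enough, the second the space grid,
    for all supports that can occur.\<close>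
  obtain N0 :: nat where N0: "real N0 \<ge> max (C' * B) (B / T)" "N0 \<ge> 1"
  proof -
    obtain n :: nat where "real n \<ge> max (C' * B) (B / T)" using real_arch_simple by blast
    then show thesis using that[of "max n 1"] by (auto simp: max_def split: if_splits)
  qed
  have *: "N \<ge> 1 \<and> no_mass_lost T V \<mu>0 N \<and> (AE x in LAS_initial T \<mu>0 N. norm x \<le> B) \<and>
     (\<forall>l<N. \<forall>x v. mv V N (LAS_node T V \<mu>0 N l) (x, v) \<noteq> 0 \<longrightarrow> norm v \<le> C' * B)" if N: "N \<ge> N0" for N
  proof -
    have N1: "N \<ge> 1" and NC: "C' * B \<le> real N" and NB: "B \<le> T * real N"
    proof -
      have "real N \<ge> real N0" using N by simp
      then have r: "real N \<ge> C' * B" "real N \<ge> B / T" using N0 by linarith+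
      then show "C' * B \<le> real N" "B \<le> T * real N" using T by (auto simp: field_simps)
    qed (use N N0 in simp)
    note TN = T N1
    define q where "q = 1 + T * C' / real N"
    have q: "q \<ge> 1" using T C' by (simp add: q_def)
    \<comment> \<open>Solution of the recursion \<open>1 + R (Suc k) = q * (1 + R k)\<close> with
      \<open>1 + R 0 = B0\<close>.\<close>
    define R where "R k = B0 * q ^ k - 1" for k :: nat
    have R_ge: "R k \<ge> 0" for k
    proof -
      have "1 * 1 \<le> B0 * q ^ k" using B0 q by (intro mult_mono) (auto simp: one_le_power)
      then show ?thesis by (simp add: R_def)
    qed
    have R_le: "1 + R k \<le> B" if "k \<le> N" for k
    proof -
      have "q ^ k \<le> q ^ N" using q that by (intro power_increasing) auto
      also have "\<dots> \<le> exp (T * C' / real N) ^ N" using q by (intro power_mono) (auto simp: q_def)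
      also have "\<dots> = exp (T * C')" using N1 by (simp flip: exp_of_nat_mult)
      finally show ?thesis using B0 by (simp add: R_def B_def)
    qed
    have R_Suc: "R (Suc k) = R k + T / real N * (C' * (1 + R k))" for k
      by (simp add: R_def q_def algebra_simps)
    have RT: "R k \<le> T * real N" if "k \<le> N" for k using R_le[OF that] NB by linarith
    note step = LAS_step_concentrated[OF TN V _ C gr R_ge, where L = "C' * (1 + R k)" for k, folded C'_def]
    have NCR: "C * (1 + R k) \<le> real N" if "k \<le> N" for k
    proof -
      have "C * (1 + R k) \<le> C' * B" using R_le[OF that] C C' R_ge[of k] by (intro mult_mono) auto
      then show ?thesis using NC by simp
    qed
    have node: "LAS_node T V \<mu>0 N k \<in> probs borel \<and>
        (AE x in LAS_node T V \<mu>0 N k. x \<in> {x \<in> xgrid T N. norm x \<le> R k})" if "k \<le> N" for k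
      using that
    proof (induction k)
      case 0
      have "R0 \<le> T * real N" using B NB T unfolding B0_def by (smt (verit) mult_nonneg_nonneg of_nat_0_le_iff)
      moreover have "R 0 = R0 + real CARD('d) * T" by (simp add: R_def B0_def)
      ultimately show ?case
        using LAS_initial_concentrated[OF TN \<mu>0p AE0] unfolding LAS_node.simps by simp
    next
      case (Suc k)
      then have k: "k \<le> N" by simp
      note IH = Suc.IH[OF k]
      have RS: "R k + T / real N * (C' * (1 + R k)) \<le> T * real N"
        using RT[OF Suc.prems] by (simp add: R_Suc)
      have "LAS_step T V N (LAS_node T V \<mu>0 N k) (T / real N) \<in> probs borel"
        using LAS_step_probs_iff[OF TN] sum_mv_eq_1[OF TN V IH[THEN conjunct1] C gr R_ge IH[THEN conjunct2] NCR[OF k] refl] by blast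
      moreover have "AE x in LAS_step T V N (LAS_node T V \<mu>0 N k) (T / real N). x \<in> {x \<in> xgrid T N. norm x \<le> R (Suc k)}"
        unfolding R_Suc
        by (rule LAS_step_tick_concentrated[OF TN V IH[THEN conjunct1] C gr R_ge IH[THEN conjunct2] NCR[OF k] _ RS])
          (auto simp: C'_def)
      ultimately show ?case unfolding LAS_node.simps by blast
    qed
    have "(\<Sum>p\<in>xgrid T N \<times> vgrid N. mv V N (LAS_node T V \<mu>0 N l) p) = 1" if "l < N" for l
      using sum_mv_eq_1[OF TN V _ C gr R_ge _ NCR refl] node[of l] that by fastforce
    moreover have "LAS_initial T \<mu>0 N \<in> probs borel" using node[of 0] by simp
    ultimately have "no_mass_lost T V \<mu>0 N" using no_mass_lostI[OF TN] by blast
    moreover have "AE x in LAS_initial T \<mu>0 N. norm x \<le> B"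
    proof -
      have "AE x in LAS_initial T \<mu>0 N. x \<in> {x \<in> xgrid T N. norm x \<le> R 0}"
        using node[of 0] unfolding LAS_node.simps by blast
      then show ?thesis by eventually_elim (use R_le[of 0] in auto)
    qed
    moreover have "norm v \<le> C' * B" if "l < N" "mv V N (LAS_node T V \<mu>0 N l) (x, v) \<noteq> 0" for l x v
    proof -
      have "norm v \<le> (C + real CARD('d)) * (1 + R l)"
        using mv_nonzero[OF TN V _ C gr R_ge _ NCR refl that(2), of l] node[of l] that(1) by auto
      also have "\<dots> \<le> C' * B" using R_le[of l] that(1) C' R_ge[of l] unfolding C'_def[symmetric]
        by (intro mult_left_mono) auto
      finally show ?thesis .
    qed
    ultimately show ?thesis using N1 by blast
  qed
  then show thesis by (rule that)
qed

section \<open>Narrow compactness of measures on Lipschitz curves\<close>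

text \<open>In base 3 the tail of the series is at most half of the preceding term, so that close codes force
  agreement on the first sets of the sequence.\<close>

definition ternary_code :: "(nat \<Rightarrow> 'a set) \<Rightarrow> 'a \<Rightarrow> real" where
  "ternary_code E x = (\<Sum>k. indicator (E k) x * (1/3) ^ k)"

lemma summable_ternary_code: "summable (\<lambda>k. indicator (E k) x * (1/3 :: real) ^ k)"
proof (rule summable_comparison_test')
  show "summable (\<lambda>k. (1/3 :: real) ^ k)" by (rule summable_geometric) simp
  show "norm (indicator (E k) x * (1/3 :: real) ^ k) \<le> (1/3) ^ k" for k
    by (simp add: indicator_def)
qed

lemma ternary_code_bounds: "ternary_code E x \<in> {0..2}"
proof -
  have "ternary_code E x \<le> (\<Sum>k. (1/3 :: real) ^ k)"
    unfolding ternary_code_def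
    by (intro suminf_le summable_ternary_code summable_geometric) (auto simp: indicator_def)
  also have "\<dots> = 3/2" by (subst suminf_geometric) auto
  finally have "ternary_code E x \<le> 2" by simp
  moreover have "0 \<le> ternary_code E x"
    unfolding ternary_code_def by (intro suminf_nonneg summable_ternary_code) simp
  ultimately show ?thesis by simp
qed

lemma borel_measurable_ternary_code:
  assumes "\<And>k. E k \<in> sets M"
  shows "ternary_code E \<in> borel_measurable M"
  unfolding ternary_code_def using assms by measurable

lemma ternary_code_separates:
  assumes "x \<in> E k \<longleftrightarrow> y \<notin> E k"
  shows "(1/3) ^ k / 2 \<le> \<bar>ternary_code E x - ternary_code E y\<bar>"
proof -
  \<comment> \<open>At the first index of disagreement the earlier terms cancel, the term itself has
    size 3^(-m), and the tail cannot compensate more than half of it.\<close>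
  define m where "m = (LEAST k. x \<in> E k \<longleftrightarrow> y \<notin> E k)"
  have m: "x \<in> E m \<longleftrightarrow> y \<notin> E m" unfolding m_def using assms by (rule LeastI)
  have "m \<le> k" unfolding m_def using assms by (rule Least_le)
  have less: "x \<in> E j \<longleftrightarrow> y \<in> E j" if "j < m" for j
    using not_less_Least[of j "\<lambda>k. x \<in> E k \<longleftrightarrow> y \<notin> E k"] that unfolding m_def by blast
  define d :: "nat \<Rightarrow> real" where "d j = (indicator (E j) x - indicator (E j) y) * (1/3) ^ j" for j
  have d_eq: "d j = indicator (E j) x * (1/3) ^ j - indicator (E j) y * (1/3) ^ j" for j
    by (simp add: d_def algebra_simps)
  have sd: "summable d" unfolding d_eq by (intro summable_diff summable_ternary_code)
  have d_le: "\<bar>d j\<bar> \<le> (1/3) ^ j" for j by (simp add: d_def abs_mult indicator_def)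
  have "ternary_code E x - ternary_code E y = (\<Sum>j. d j)"
    unfolding ternary_code_def d_eq by (intro suminf_diff summable_ternary_code)
  also have "\<dots> = (\<Sum>j. d (j + Suc m)) + (\<Sum>j<Suc m. d j)"
    using sd by (rule suminf_split_initial_segment)
  also have "(\<Sum>j<Suc m. d j) = d m"
    using less by (simp add: d_def indicator_def)
  finally have eq: "ternary_code E x - ternary_code E y = (\<Sum>j. d (j + Suc m)) + d m" .
  have geo: "(\<lambda>j. (1/3 :: real) ^ (j + Suc m)) sums ((1/3) ^ m / 2)"
  proof -
    have "(\<lambda>j. (1/3 :: real) ^ Suc m * (1/3) ^ j) sums ((1/3) ^ Suc m * (1 / (1 - 1/3)))"
      by (intro sums_mult geometric_sums) simp
    then show ?thesis by (simp add: power_add mult.commute)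
  qed
  have "\<bar>\<Sum>j. d (j + Suc m)\<bar> \<le> (\<Sum>j. (1/3) ^ (j + Suc m))"
    using norm_suminf_le[of "\<lambda>j. d (j + Suc m)" "\<lambda>j. (1/3) ^ (j + Suc m)", OF _ sums_summable[OF geo]] d_le
    by (simp only: real_norm_def)
  also have "\<dots> = (1/3) ^ m / 2" using geo by (simp only: sums_iff)
  finally have tail: "\<bar>\<Sum>j. d (j + Suc m)\<bar> \<le> (1/3) ^ m / 2" .
  have head: "\<bar>d m\<bar> = (1/3) ^ m" using m by (auto simp: d_def indicator_def abs_mult)
  have "(1/3 :: real) ^ k \<le> (1/3) ^ m" using \<open>m \<le> k\<close> by (intro power_decreasing) auto
  then show ?thesis unfolding eq using head tail by linarith
qed

text \<open>Finitely many yes-or-no questions fix a curve up to \<epsilon>: by equicontinuity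
  finitely many times suffice, and at these times the values lie in one compact ball covered by
  finitely many small balls.\<close>

lemma lipschitz_curves_finitely_determined:
  fixes L B :: real
  assumes "L \<ge> 0" and D: "UNIV \<subseteq> closure D" and Q: "{a..b} \<subseteq> closure Q" "Q \<subseteq> {a..b}" and \<epsilon>: "\<epsilon> > 0"
  shows "\<exists>F. finite F \<and> F \<subseteq> Q \<times> D \<times> \<rat> \<and>
    (\<forall>g\<in>lipschitz_curves a b L. \<forall>h\<in>lipschitz_curves a b L. norm (g a) \<le> B \<longrightarrow> norm (h a) \<le> B \<longrightarrow>
      (\<forall>(q, p, r)\<in>F. dist (g q) (p :: real^'d) < r \<longleftrightarrow> dist (h q) p < r) \<longrightarrow> (\<forall>t\<in>{a..b}. dist (g t) (h t) \<le> \<epsilon>))"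
proof -
  \<comment> \<open>The error is split in four: moving from \<open>t\<close> to a tested time for
    each of the two curves, and from each value there to the centre of a common ball. The summand 1
    prevents division by zero.\<close>
  define \<delta> where "\<delta> = \<epsilon> / (4 * (L + 1))"
  have \<delta>: "\<delta> > 0" "L * \<delta> \<le> \<epsilon> / 4"
    using \<epsilon> assms(1) by (auto simp: \<delta>_def field_simps)
  obtain r where r: "r \<in> \<rat>" "0 < r" "r < \<epsilon> / 4" using Rats_dense_in_real[of 0 "\<epsilon>/4"] \<epsilon> by auto
  have "{a..b} \<subseteq> (\<Union>q\<in>Q. ball q \<delta>)"
  proof
    fix t assume "t \<in> {a..b}"
    then have "t \<in> closure Q" using Q by auto
    then obtain q where "q \<in> Q" "dist q t < \<delta>" using \<delta>(1) by (auto simp: closure_approachable)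
    then show "t \<in> (\<Union>q\<in>Q. ball q \<delta>)" by auto
  qed
  then obtain Q0 where Q0: "Q0 \<subseteq> Q" "finite Q0" "{a..b} \<subseteq> (\<Union>q\<in>Q0. ball q \<delta>)"
    using compactE_image[of "{a..b}" Q "\<lambda>q. ball q \<delta>"] by (metis compact_Icc open_ball)
  let ?K = "cball (0 :: real^'d) (B + L * (b - a))"
  have "?K \<subseteq> (\<Union>p\<in>D. ball p r)"
  proof
    fix x :: "real^'d"
    have "x \<in> closure D" using D by auto
    then obtain p where "p \<in> D" "dist p x < r" using r(2) by (auto simp: closure_approachable)
    then show "x \<in> (\<Union>p\<in>D. ball p r)" by auto
  qed
  then obtain D0 where D0: "D0 \<subseteq> D" "finite D0" "?K \<subseteq> (\<Union>p\<in>D0. ball p r)"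
    using compactE_image[of ?K D "\<lambda>p. ball p r"] by (metis compact_cball open_ball)
  show ?thesis
  proof (intro exI[of _ "Q0 \<times> D0 \<times> {r}"] conjI ballI impI)
    fix g h :: "real \<Rightarrow> real^'d" and t
    assume g: "g \<in> lipschitz_curves a b L" "norm (g a) \<le> B" and h: "h \<in> lipschitz_curves a b L"
      and eq: "\<forall>(q, p, r)\<in>Q0 \<times> D0 \<times> {r}. dist (g q) p < r \<longleftrightarrow> dist (h q) p < r" and t: "t \<in> {a..b}"
    obtain q where q: "q \<in> Q0" "dist q t < \<delta>" using Q0(3) t by auto
    have qab: "q \<in> {a..b}" using q Q0 Q by auto
    have lip: "dist (f q) (f t) \<le> \<epsilon> / 4" if "f \<in> lipschitz_curves a b L" for f :: "real \<Rightarrow> real^'d"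
    proof -
      have "dist (f q) (f t) \<le> L * \<bar>q - t\<bar>" using that qab t by (auto simp: lipschitz_curves_def)
      also have "\<dots> \<le> L * \<delta>" using q assms(1) by (intro mult_left_mono) (auto simp: dist_real_def)
      finally show ?thesis using \<delta> by simp
    qed
    have a: "a \<in> {a..b}" using t by auto
    have "dist (g a) (g q) \<le> L * \<bar>a - q\<bar>" using g qab a unfolding lipschitz_curves_def by blast
    also have "\<dots> \<le> L * (b - a)" using qab assms(1) by (intro mult_left_mono) auto
    finally have "norm (g q) \<le> B + L * (b - a)"
      using g(2) norm_triangle_ineq[of "g q - g a" "g a"] by (simp add: dist_norm norm_minus_commute)
    then have "g q \<in> (\<Union>p\<in>D0. ball p r)" using D0(3) by (intro subsetD[OF D0(3)]) simp
    then obtain p where p: "p \<in> D0" "dist (g q) p < r" by (auto simp: dist_commute)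
    then have "dist (h q) p < r" using eq q(1) by auto
    then show "dist (g t) (h t) \<le> \<epsilon>"
      using p(2) lip[OF g(1)] lip[OF h] r(3) dist_triangle[of "g t" "h t" "g q"] dist_triangle[of "g q" "h t" "h q"]
        dist_triangle2[of "g q" "h q" p] by (simp add: dist_commute)
  qed (use Q0(1,2) D0(1,2) r(1) in auto)
qed

text \<open>Prokhorov's theorem for measures on uniformly bounded Lipschitz curves: the compact set of these
  curves is coded by real numbers in such a way that decoding is uniformly continuous; Helly's theorem
  then applies to the laws of the codes.\<close>

lemma lipschitz_curves_narrow_subsequence:
  fixes \<eta> :: "nat \<Rightarrow> (real \<Rightarrow> real^'d) measure"
  assumes ab: "a \<le> b" and L: "L \<ge> 0" and \<eta>: "\<And>n. \<eta> n \<in> probs (borel_of (curves a b))"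
    and lip: "\<And>n. AE \<gamma> in \<eta> n. \<gamma> \<in> lipschitz_curves a b L" and bd: "\<And>n. AE \<gamma> in \<eta> n. norm (\<gamma> a) \<le> B"
  shows "\<exists>r \<eta>'. strict_mono r \<and> \<eta>' \<in> probs (borel_of (curves a b)) \<and>
     narrowly_converges (curves a b) (\<lambda>n. \<eta> (r n)) \<eta>'"
proof -
  define K :: "(real \<Rightarrow> real^'d) set" where "K = {g \<in> lipschitz_curves a b L. norm (g a) \<le> B}"
  have K_top: "g \<in> topspace (curves a b)" if "g \<in> K" for g using that by (auto simp: K_def lipschitz_curves_def)
  have AE_K: "AE \<gamma> in \<eta> n. \<gamma> \<in> K" for n
    using lip[of n] bd[of n] by eventually_elim (simp add: K_def)
  obtain Q where Q: "countable Q" "Q \<subseteq> {a..b}" "{a..b} \<subseteq> closure Q" using separable by blast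
  obtain D :: "(real^'d) set" where D: "countable D" "UNIV \<subseteq> closure D"
    using separable by (metis subset_UNIV)
  \<comment> \<open>All possible questions, with times, centres and radii in countable dense sets;
    their answers are the digits of the code.\<close>
  define J where "J = Q \<times> D \<times> (\<rat> :: real set)"
  have J: "countable J" "J \<noteq> {}"
    using Q D ab countable_rat by (auto simp: J_def)
  define E where "E k = {g \<in> topspace (curves a b). case from_nat_into J k of (q, p, r) \<Rightarrow> dist (g q) p < r}" for k
  have E_sets: "E k \<in> sets (borel_of (curves a b))" for k
  proof -
    obtain q p r where qpr: "from_nat_into J k = (q, p, r)" by (metis prod_cases3)
    have "(q, p, r) \<in> J" using from_nat_into[OF J(2), of k] qpr by simp
    then have "q \<in> {a..b}" using Q by (auto simp: J_def)
    from measurable_sets[OF measurable_eval[OF this], of "ball p r"]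
    show ?thesis by (simp add: E_def qpr vimage_def Int_def conj_commute dist_commute)
  qed
  define s where "s = ternary_code E"
  \<comment> \<open>This is uniform continuity of decoding: codes closer than \<open>d\<close> agree
    on the finitely many digits that fix a curve up to \<epsilon>.\<close>
  have determined: "\<exists>d>0. \<forall>g\<in>K. \<forall>h\<in>K. \<bar>s g - s h\<bar> < d \<longrightarrow> (\<forall>t\<in>{a..b}. dist (g t) (h t) \<le> \<epsilon>)" if \<epsilon>: "\<epsilon> > 0" for \<epsilon>
  proof -
    obtain F where F: "finite F" "F \<subseteq> J" and F_det: "\<forall>g\<in>lipschitz_curves a b L. \<forall>h\<in>lipschitz_curves a b L.
        norm (g a) \<le> B \<longrightarrow> norm (h a) \<le> B \<longrightarrow>
        (\<forall>(q, p, r)\<in>F. dist (g q) p < r \<longleftrightarrow> dist (h q) p < r) \<longrightarrow> (\<forall>t\<in>{a..b}. dist (g t) (h t) \<le> \<epsilon>)"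
      using lipschitz_curves_finitely_determined[OF L D(2) Q(3,2) \<epsilon>, of B] unfolding J_def by (elim exE conjE)
    have F_K: "\<forall>t\<in>{a..b}. dist (g t) (h t) \<le> \<epsilon>"
      if "g \<in> K" "h \<in> K" "\<forall>(q, p, r)\<in>F. dist (g q) p < r \<longleftrightarrow> dist (h q) p < r" for g h
      using F_det that unfolding K_def by blast
    have "\<exists>k. from_nat_into J k = j" if "j \<in> F" for j using from_nat_into_surj[OF J(1)] F(2) that by blast
    then obtain idx where idx: "\<And>j. j \<in> F \<Longrightarrow> from_nat_into J (idx j) = j" by metis
    define n where "n = Max (insert 0 (idx ` F))"
    have n: "idx j \<le> n" if "j \<in> F" for j using that F(1) by (simp add: n_def)
    have "\<forall>t\<in>{a..b}. dist (g t) (h t) \<le> \<epsilon>" if gh: "g \<in> K" "h \<in> K" "\<bar>s g - s h\<bar> < (1/3) ^ n / 2" for g h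
    proof (rule F_K[OF gh(1,2)], safe)
      have agree: "g \<in> E (idx j) \<longleftrightarrow> h \<in> E (idx j)" if "j \<in> F" for j
      proof (rule ccontr)
        assume "\<not> ?thesis"
        then have "(1/3) ^ idx j / 2 \<le> \<bar>s g - s h\<bar>" unfolding s_def by (intro ternary_code_separates) auto
        moreover have "(1/3 :: real) ^ n \<le> (1/3) ^ idx j" using n[OF that] by (intro power_decreasing) auto
        ultimately show False using gh(3) by linarith
      qed
      fix q p r assume "(q, p, r) \<in> F"
      from agree[OF this] idx[OF this] show "dist (g q) p < r \<Longrightarrow> dist (h q) p < r" "dist (h q) p < r \<Longrightarrow> dist (g q) p < r"
        using K_top gh(1,2) by (auto simp: E_def)
    qed
    then show ?thesis by (intro exI[of _ "(1/3) ^ n / 2"]) auto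
  qed
  \<comment> \<open>Clamping the time extends a curve to a bounded continuous function on the real
    line. These functions form a complete space, as the extension of the decoder to the closure of
    the codes requires.\<close>
  have "\<exists>f :: real \<Rightarrow>\<^sub>C (real^'d). (\<forall>t. apply_bcontfun f t = g (clamp a b t))" if "g \<in> K" for g
  proof -
    have "continuous_on (cbox a b) g" using K_top[OF that] by (simp add: topspace_curves)
    then show ?thesis by (rule continuous_on_cbox_bcontfunE) auto
  qed
  then obtain ext :: "(real \<Rightarrow> real^'d) \<Rightarrow> real \<Rightarrow>\<^sub>C (real^'d)" where ext: "\<And>g t. g \<in> K \<Longrightarrow> apply_bcontfun (ext g) t = g (clamp a b t)"
    by metis
  have clamp: "clamp a b t \<in> {a..b}" for t using clamp_in_interval[of a b t] ab by simp
  have clamp_id: "clamp a b t = t" if "t \<in> {a..b}" for t using clamp_cancel_cbox[of t a b] that by simp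
  define dec where "dec y = (SOME g. g \<in> K \<and> s g = y)" for y
  have dec: "dec y \<in> K \<and> s (dec y) = y" if "y \<in> s ` K" for y
  proof -
    from that obtain g where "g \<in> K \<and> s g = y" by blast
    then show ?thesis unfolding dec_def by (rule someI[where P = "\<lambda>g. g \<in> K \<and> s g = y"])
  qed
  have "uniformly_continuous_on (s ` K) (\<lambda>y. ext (dec y))"
    unfolding uniformly_continuous_on_def
  proof (intro allI impI)
    fix e :: real assume "e > 0"
    then obtain d where d: "d > 0" "\<forall>g\<in>K. \<forall>h\<in>K. \<bar>s g - s h\<bar> < d \<longrightarrow> (\<forall>t\<in>{a..b}. dist (g t) (h t) \<le> e / 2)"
      using determined[of "e/2"] by auto
    show "\<exists>d>0. \<forall>x\<in>s ` K. \<forall>x'\<in>s ` K. dist x' x < d \<longrightarrow> dist (ext (dec x')) (ext (dec x)) < e"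
    proof (intro exI[of _ d] conjI ballI impI d(1))
      fix x x' assume x: "x \<in> s ` K" "x' \<in> s ` K" "dist x' x < d"
      have "\<forall>t\<in>{a..b}. dist (dec x' t) (dec x t) \<le> e / 2"
        using d(2) dec[OF x(1)] dec[OF x(2)] x(3) by (auto simp: dist_real_def)
      then have "dist (ext (dec x')) (ext (dec x)) \<le> e / 2"
        using ext dec[OF x(1)] dec[OF x(2)] clamp by (intro dist_bound) auto
      then show "dist (ext (dec x')) (ext (dec x)) < e" using \<open>e > 0\<close> by simp
    qed
  qed
  then obtain h where h: "uniformly_continuous_on (closure (s ` K)) h" "\<And>y. y \<in> s ` K \<Longrightarrow> ext (dec y) = h y"
    by (rule uniformly_continuous_on_extension_on_closure) auto
  \<comment> \<open>The code is discontinuous in general, so its image of \<open>K\<close> cannot be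
    assumed closed; limit laws are controlled only on the closure.\<close>
  define C where "C = closure (s ` K)"
  have C: "closed C" by (simp add: C_def)
  have s_C: "s g \<in> C" if "g \<in> K" for g
    unfolding C_def by (rule subsetD[OF closure_subset imageI[OF that]])
  have h_cont: "continuous_on C h" using uniformly_continuous_imp_continuous[OF h(1)] by (simp add: C_def)
  \<comment> \<open>The total decoder; off \<open>C\<close> it returns the zero curve, so that it is
    measurable on the whole line with values in the curve space.\<close>
  define \<Phi> :: "real \<Rightarrow> real \<Rightarrow> real^'d" where "\<Phi> y = (if y \<in> C then restrict (apply_bcontfun (h y)) {a..b} else restrict (\<lambda>_. 0) {a..b})" for y
  have \<Phi>_top: "\<Phi> y \<in> topspace (curves a b)" for y
    by (auto simp: \<Phi>_def intro!: curves_restrict)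
  have \<Phi>_code: "\<Phi> (s g) = g" if g: "g \<in> K" for g
  proof
    fix t
    have sg: "s g \<in> s ` K" "s g \<in> C" using g s_C by auto
    show "\<Phi> (s g) t = g t"
    proof (cases "t \<in> {a..b}")
      case True
      \<comment> \<open>The chosen preimage of \<open>s g\<close> has the same code as
        \<open>g\<close>, so both agree up to every \<epsilon>: the code is injective on
        \<open>K\<close>.\<close>
      have "dist (dec (s g) t) (g t) \<le> \<epsilon>" if \<epsilon>: "\<epsilon> > 0" for \<epsilon>
      proof -
        obtain d where "d > 0" "\<forall>g\<in>K. \<forall>h\<in>K. \<bar>s g - s h\<bar> < d \<longrightarrow> (\<forall>t\<in>{a..b}. dist (g t) (h t) \<le> \<epsilon>)"
          using determined[OF \<epsilon>] by blast
        then show ?thesis using dec[OF sg(1)] g True by simp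
      qed
      then have "dist (dec (s g) t) (g t) \<le> 0" by (rule dense_ge)
      then have "dec (s g) t = g t" by simp
      then show ?thesis using True sg h(2)[OF sg(1), symmetric] dec[OF sg(1)] ext clamp_id by (simp add: \<Phi>_def)
    next
      case False
      then show ?thesis using K_top[OF g] sg by (auto simp: \<Phi>_def topspace_curves extensional_def)
    qed
  qed
  have \<Phi>_meas: "\<Phi> \<in> borel \<rightarrow>\<^sub>M borel_of (curves a b)"
  proof (rule measurable_into_curves)
    fix t assume t: "t \<in> {a..b}"
    have "continuous_on C (\<lambda>y. apply_bcontfun (h y) t)"
      unfolding continuous_on_iff
    proof (intro ballI allI impI)
      fix y e :: real assume y: "y \<in> C" "e > 0"
      then obtain d where d: "d > 0" "\<And>x'. x'\<in>C \<Longrightarrow> dist x' y < d \<Longrightarrow> dist (h x') (h y) < e"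
        using h_cont unfolding continuous_on_iff by meson
      then show "\<exists>d>0. \<forall>x'\<in>C. dist x' y < d \<longrightarrow> dist (apply_bcontfun (h x') t) (apply_bcontfun (h y) t) < e"
        using dist_bounded[of "h _" t "h y"] order_le_less_trans by metis
    qed
    from borel_measurable_continuous_on_if[OF borel_closed[OF C] this, of "\<lambda>_. 0"]
    have "(\<lambda>y. if y \<in> C then apply_bcontfun (h y) t else 0) \<in> borel_measurable borel" by simp
    moreover have "(\<lambda>y. \<Phi> y t) = (\<lambda>y. if y \<in> C then apply_bcontfun (h y) t else 0)"
      using t by (auto simp: \<Phi>_def)
    ultimately show "(\<lambda>y. \<Phi> y t) \<in> borel_measurable borel" by simp
  qed (use \<Phi>_top in auto)
  have s_meas: "s \<in> borel_measurable (\<eta> n)" for n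
    unfolding s_def using E_sets probsD(2)[OF \<eta>] by (intro borel_measurable_ternary_code) auto
  define \<nu> where "\<nu> n = distr (\<eta> n) borel s" for n
  have \<nu>: "real_distribution (\<nu> n)" for n
    unfolding \<nu>_def by (intro prob_space.real_distribution_distr probsD(1)[OF \<eta>] s_meas)
  \<comment> \<open>All codes lie in \<open>{0..2}\<close>; the left end is moved to -1 because
    tightness is stated with half-open intervals.\<close>
  have "tight \<nu>"
    unfolding tight_def
  proof (intro conjI allI impI \<nu>)
    fix \<epsilon> :: real assume \<epsilon>: "\<epsilon> > 0"
    have "measure (\<nu> n) {-1<..2} = 1" for n
    proof -
      interpret real_distribution "\<nu> n" by (rule \<nu>)
      have "s x \<in> {-1<..2}" for x using ternary_code_bounds[of E x] by (simp add: s_def)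
      then have "AE x in \<eta> n. s x \<in> {-1<..2}" by (intro AE_I2)
      then have "AE x in \<nu> n. x \<in> {-1<..2}" unfolding \<nu>_def using s_meas by (subst AE_distr_iff) auto
      then show ?thesis by (subst prob_eq_1) auto
    qed
    then show "\<exists>a b. a < b \<and> (\<forall>n. 1 - \<epsilon> < measure (\<nu> n) {a<..b})"
      using \<epsilon> by (intro exI[of _ "-1"] exI[of _ 2]) auto
  qed
  then obtain r \<nu>' where r: "strict_mono r" and \<nu>': "real_distribution \<nu>'" and weak: "weak_conv_m (\<nu> \<circ> id \<circ> r) \<nu>'"
    using tight_imp_convergent_subsubsequence[of \<nu> id] by (metis strict_mono_id)
  interpret \<nu>': real_distribution \<nu>' by (rule \<nu>')
  have conv: "(\<lambda>n. \<integral>y. f y \<partial>\<nu> (r n)) \<longlonglongrightarrow> (\<integral>y. f y \<partial>\<nu>')"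
    if "continuous_on UNIV f" "\<And>y. norm (f y) \<le> M" for f :: "real \<Rightarrow> real" and M
    using weak_conv_imp_integral_bdd_continuous_conv[OF _ \<nu>' weak, of f M] that \<nu>
    by (simp add: continuous_on_eq_continuous_at comp_def)
  have \<nu>_integral: "(\<integral>y. f y \<partial>\<nu> n) = (\<integral>x. f (s x) \<partial>\<eta> n)" if "f \<in> borel_measurable borel" for f :: "real \<Rightarrow> real" and n
    unfolding \<nu>_def using s_meas that by (rule integral_distr)
  \<comment> \<open>The distance to the empty set is 0 by convention, so \<open>infdist\<close>
    detects membership in \<open>C\<close> only if \<open>C\<close> is nonempty.\<close>
  have "\<exists>x. x \<in> K"
  proof (rule ccontr)
    assume "\<nexists>x. x \<in> K"
    then have "AE x in \<eta> 0. False" using AE_K[of 0] by simp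
    then show False using prob_space.AE_False[OF probsD(1)[OF \<eta>]] by blast
  qed
  then have C_ne: "C \<noteq> {}" using s_C by blast
  have AE_C: "AE y in \<nu>'. y \<in> C"
  proof -
    \<comment> \<open>A bounded continuous function vanishing exactly on \<open>C\<close>: its
      integrals are 0 along the sequence, hence 0 for the limit law.\<close>
    define f where "f y = min 1 (infdist y C)" for y
    have f: "continuous_on UNIV f" "norm (f y) \<le> 1" for y
      unfolding f_def by (auto intro!: continuous_intros simp: infdist_nonneg)
    have fm [measurable]: "f \<in> borel_measurable borel" using f(1) by (rule borel_measurable_continuous_onI)
    have "(\<integral>y. f y \<partial>\<nu> n) = 0" for n
    proof -
      have "AE x in \<eta> n. f (s x) = 0"
        using AE_K[of n] by eventually_elim (use s_C in \<open>auto simp: f_def\<close>)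
      then show ?thesis unfolding \<nu>_integral[OF fm] by (rule integral_eq_zero_AE)
    qed
    then have "(\<integral>y. f y \<partial>\<nu>') = 0" using conv[OF f] by (simp add: LIMSEQ_const_iff)
    moreover have "integrable \<nu>' f" using f(2) by (intro \<nu>'.integrable_const_bound[where B=1]) auto
    ultimately have "AE y in \<nu>'. f y = 0"
      by (subst (asm) integral_nonneg_eq_0_iff_AE) (auto simp: f_def infdist_nonneg)
    then show ?thesis
      by eventually_elim (use C C_ne in \<open>auto simp: f_def min_def in_closed_iff_infdist_zero split: if_splits\<close>)
  qed
  define \<eta>' where "\<eta>' = distr \<nu>' (borel_of (curves a b)) \<Phi>"
  have \<Phi>_meas': "\<Phi> \<in> \<nu>' \<rightarrow>\<^sub>M borel_of (curves a b)" using \<Phi>_meas by (simp cong: measurable_cong_sets)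
  have "\<eta>' \<in> probs (borel_of (curves a b))"
    using \<nu>'.prob_space_distr[OF \<Phi>_meas'] by (simp add: \<eta>'_def space_prob_algebra)
  moreover have "narrowly_converges (curves a b) (\<lambda>n. \<eta> (r n)) \<eta>'"
    unfolding narrowly_converges_def
  proof (intro allI impI)
    fix \<phi> :: "(real \<Rightarrow> real^'d) \<Rightarrow> real"
    assume \<phi>: "continuous_map (curves a b) euclideanreal \<phi>" "bounded (\<phi> ` topspace (curves a b))"
    have \<phi>_meas: "\<phi> \<in> borel_measurable (borel_of (curves a b))" using \<phi>(1) by (rule continuous_map_borel_measurable)
    obtain M where M: "\<And>\<gamma>. \<gamma> \<in> topspace (curves a b) \<Longrightarrow> norm (\<phi> \<gamma>) \<le> M"
      using \<phi>(2) by (auto simp: bounded_iff)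
    have "0 \<le> norm (\<phi> (\<Phi> 0))" by simp
    also have "\<dots> \<le> M" using M[OF \<Phi>_top] .
    finally have M0: "0 \<le> M" .
    have cont: "continuous_on C (\<lambda>y. \<phi> (\<Phi> y))"
      unfolding continuous_on_iff
    proof (intro ballI allI impI)
      fix y e :: real assume y: "y \<in> C" and e: "e > 0"
      have "openin (curves a b) {g \<in> topspace (curves a b). \<phi> g \<in> ball (\<phi> (\<Phi> y)) e}"
        by (rule openin_continuous_map_preimage[OF \<phi>(1)]) simp
      moreover have "\<Phi> y \<in> {g \<in> topspace (curves a b). \<phi> g \<in> ball (\<phi> (\<Phi> y)) e}" using \<Phi>_top e by simp
      ultimately have "\<exists>\<rho>>0. \<forall>g\<in>topspace (curves a b). (\<forall>t\<in>{a..b}. dist (\<Phi> y t) (g t) \<le> \<rho>) \<longrightarrow>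
          g \<in> {g \<in> topspace (curves a b). \<phi> g \<in> ball (\<phi> (\<Phi> y)) e}"
        unfolding openin_curves by (elim conjE) (erule bspec)
      then obtain \<rho> where \<rho>: "\<rho> > 0" "\<And>g. g \<in> topspace (curves a b) \<Longrightarrow> (\<forall>t\<in>{a..b}. dist (\<Phi> y t) (g t) \<le> \<rho>)
          \<Longrightarrow> \<phi> g \<in> ball (\<phi> (\<Phi> y)) e"
        by blast
      obtain d where d: "d > 0" "\<And>x'. x'\<in>C \<Longrightarrow> dist x' y < d \<Longrightarrow> dist (h x') (h y) < \<rho>"
        using h_cont y \<rho>(1) unfolding continuous_on_iff by meson
      have "dist (\<phi> (\<Phi> x')) (\<phi> (\<Phi> y)) < e" if x': "x' \<in> C" "dist x' y < d" for x'
      proof -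
        have "dist (\<Phi> y t) (\<Phi> x' t) \<le> \<rho>" if "t \<in> {a..b}" for t
          using that y x' d(2)[OF x'] dist_bounded[of "h y" t "h x'"] by (simp add: \<Phi>_def dist_commute)
        then show ?thesis using \<rho>(2)[OF \<Phi>_top] by (simp add: dist_commute)
      qed
      then show "\<exists>d>0. \<forall>x'\<in>C. dist x' y < d \<longrightarrow> dist (\<phi> (\<Phi> x')) (\<phi> (\<Phi> y)) < e" using d(1) by blast
    qed
    \<comment> \<open>The pulled-back test function is continuous only on \<open>C\<close>. Tietze
      extends it to the line with the same bound, and all laws involved charge only
      \<open>C\<close>.\<close>
    obtain G where G: "continuous_on UNIV G" "\<And>y. y \<in> C \<Longrightarrow> G y = \<phi> (\<Phi> y)" "\<And>y. norm (G y) \<le> M"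
      using Tietze[OF cont, of UNIV M] C M0 M[OF \<Phi>_top] by auto
    have G_meas: "G \<in> borel_measurable borel" using G(1) by (rule borel_measurable_continuous_onI)
    have "(\<integral>y. G y \<partial>\<nu> n) = (\<integral>x. \<phi> x \<partial>\<eta> n)" for n
      unfolding \<nu>_integral[OF G_meas]
    proof (rule integral_cong_AE)
      show "(\<lambda>x. G (s x)) \<in> borel_measurable (\<eta> n)" by (rule measurable_compose[OF s_meas G_meas])
      show "\<phi> \<in> borel_measurable (\<eta> n)" using \<phi>_meas probsD(2)[OF \<eta>] by (simp cong: measurable_cong_sets)
      show "AE x in \<eta> n. G (s x) = \<phi> x"
        using AE_K[of n]
      proof eventually_elim
        fix x assume x: "x \<in> K"
        then show "G (s x) = \<phi> x" using G(2)[OF s_C] \<Phi>_code by simp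
      qed
    qed
    moreover have "(\<integral>y. G y \<partial>\<nu>') = (\<integral>x. \<phi> x \<partial>\<eta>')"
    proof -
      have "(\<integral>x. \<phi> x \<partial>\<eta>') = (\<integral>y. \<phi> (\<Phi> y) \<partial>\<nu>')"
        unfolding \<eta>'_def by (rule integral_distr[OF \<Phi>_meas' \<phi>_meas])
      also have "\<dots> = (\<integral>y. G y \<partial>\<nu>')"
      proof (rule integral_cong_AE)
        show "(\<lambda>y. \<phi> (\<Phi> y)) \<in> borel_measurable \<nu>'" by (rule measurable_compose[OF \<Phi>_meas' \<phi>_meas])
        show "AE y in \<nu>'. \<phi> (\<Phi> y) = G y" using AE_C by eventually_elim (simp add: G)
      qed (use G_meas in \<open>simp cong: measurable_cong_sets\<close>)
      finally show ?thesis by simp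
    qed
    ultimately show "(\<lambda>n. \<integral>x. \<phi> x \<partial>\<eta> (r n)) \<longlonglongrightarrow> (\<integral>x. \<phi> x \<partial>\<eta>')"
      using conv[OF G(1) G(3)] by simp
  qed
  ultimately show ?thesis using r by blast
qed

section \<open>Passage to the limit\<close>

lemma continuous_on_of_dist_bound:
  fixes f :: "'a::metric_space \<Rightarrow> real"
  assumes "\<And>x y. \<bar>f x - f y\<bar> \<le> L * dist x y"
  shows "continuous_on UNIV f"
proof (rule lipschitz_on_continuous_on)
  show "(max L 1)-lipschitz_on UNIV f"
  proof (rule lipschitz_onI)
    fix x y :: 'a
    have "L * dist x y \<le> max L 1 * dist x y" by (intro mult_right_mono) auto
    then show "dist (f x) (f y) \<le> max L 1 * dist x y" using assms[of x y] by (simp add: dist_real_def)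
  qed simp
qed

text \<open>The easy half of Kantorovich duality: every coupling bounds the difference of integrals
  by the Lipschitz constant times its cost, and the infimum provides a coupling of small
  cost.\<close>

lemma wasserstein_tendsto_integral:
  fixes f :: "'a::{metric_space, second_countable_topology} \<Rightarrow> real"
  assumes W: "(\<lambda>n. wasserstein (P n) Q) \<longlonglongrightarrow> 0"
    and lip: "\<And>x y. \<bar>f x - f y\<bar> \<le> L * dist x y" and bd: "\<And>x. \<bar>f x\<bar> \<le> B"
  shows "(\<lambda>n. \<integral>x. f x \<partial>P n) \<longlonglongrightarrow> (\<integral>x. f x \<partial>Q)"
proof -
  \<comment> \<open>A strictly positive Lipschitz constant, by which the tolerance can be
    divided.\<close>
  define L' where "L' = max L 1"
  have L': "L' > 0" by (simp add: L'_def)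
  have lip': "\<bar>f x - f y\<bar> \<le> L' * dist x y" for x y
  proof -
    have "L * dist x y \<le> L' * dist x y" by (intro mult_right_mono) (auto simp: L'_def)
    then show ?thesis using lip[of x y] by simp
  qed
  have "continuous_on UNIV f" using lip by (rule continuous_on_of_dist_bound)
  then have f[measurable]: "f \<in> borel_measurable borel" by (rule borel_measurable_continuous_onI)
  have est: "ennreal \<bar>(\<integral>x. f x \<partial>\<mu>) - (\<integral>x. f x \<partial>\<nu>)\<bar> \<le> ennreal L' * (\<integral>\<^sup>+p. ennreal (dist (fst p) (snd p)) \<partial>\<pi>)"
    if \<pi>: "\<pi> \<in> couplings \<mu> \<nu>" for \<mu> \<nu> and \<pi> :: "('a \<times> 'a) measure"
  proof -
    have p: "\<pi> \<in> probs borel" "distr \<pi> borel fst = \<mu>" "distr \<pi> borel snd = \<nu>"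
      using \<pi> by (auto simp: couplings_def)
    interpret prob_space \<pi> by (rule probsD(1)[OF p(1)])
    have fst_m: "fst \<in> \<pi> \<rightarrow>\<^sub>M borel" and snd_m: "snd \<in> \<pi> \<rightarrow>\<^sub>M borel"
      using probsD(2)[OF p(1)] by (auto cong: measurable_cong_sets simp: borel_prod[symmetric])
    note [measurable] = fst_m snd_m
    have i: "integrable \<pi> (\<lambda>p. f (fst p))" "integrable \<pi> (\<lambda>p. f (snd p))"
      using bd by (auto intro!: integrable_const_bound[where B=B])
    have "(\<integral>x. f x \<partial>\<mu>) - (\<integral>x. f x \<partial>\<nu>) = (\<integral>p. f (fst p) \<partial>\<pi>) - (\<integral>p. f (snd p) \<partial>\<pi>)"
      using integral_distr[OF fst_m f] integral_distr[OF snd_m f] p by simp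
    also have "\<dots> = (\<integral>p. f (fst p) - f (snd p) \<partial>\<pi>)" using i by simp
    finally have "ennreal \<bar>(\<integral>x. f x \<partial>\<mu>) - (\<integral>x. f x \<partial>\<nu>)\<bar> \<le> (\<integral>\<^sup>+p. ennreal \<bar>f (fst p) - f (snd p)\<bar> \<partial>\<pi>)"
      using integral_norm_bound_ennreal[OF Bochner_Integration.integrable_diff[OF i]] by simp
    also have "\<dots> \<le> (\<integral>\<^sup>+p. ennreal L' * ennreal (dist (fst p) (snd p)) \<partial>\<pi>)"
      using lip' L' by (intro nn_integral_mono) (simp flip: ennreal_mult)
    also have "\<dots> = ennreal L' * (\<integral>\<^sup>+p. ennreal (dist (fst p) (snd p)) \<partial>\<pi>)"
      by (rule nn_integral_cmult) measurable
    finally show ?thesis .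
  qed
  show ?thesis
  proof (rule LIMSEQ_I)
    fix e :: real assume e: "e > 0"
    have "\<forall>\<^sub>F n in sequentially. wasserstein (P n) Q < ennreal (e / L')"
      using W e L' by (intro order_tendstoD) auto
    then obtain n0 where n0: "\<And>n. n \<ge> n0 \<Longrightarrow> wasserstein (P n) Q < ennreal (e / L')"
      by (auto simp: eventually_sequentially)
    show "\<exists>n0. \<forall>n\<ge>n0. norm ((\<integral>x. f x \<partial>P n) - (\<integral>x. f x \<partial>Q)) < e"
    proof (intro exI[of _ n0] allI impI)
      fix n assume "n \<ge> n0"
      from n0[OF this] obtain \<pi> where \<pi>: "\<pi> \<in> couplings (P n) Q"
        "(\<integral>\<^sup>+p. ennreal (dist (fst p) (snd p)) \<partial>\<pi>) < ennreal (e / L')"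
        unfolding wasserstein_def by (auto simp: INF_less_iff)
      have "ennreal \<bar>(\<integral>x. f x \<partial>P n) - (\<integral>x. f x \<partial>Q)\<bar> \<le> ennreal L' * (\<integral>\<^sup>+p. ennreal (dist (fst p) (snd p)) \<partial>\<pi>)"
        by (rule est[OF \<pi>(1)])
      also have "\<dots> < ennreal L' * ennreal (e / L')"
        using \<pi>(2) L' by (intro ennreal_mult_strict_left_mono) auto
      also have "\<dots> = ennreal e" using L' e by (simp flip: ennreal_mult)
      finally show "norm ((\<integral>x. f x \<partial>P n) - (\<integral>x. f x \<partial>Q)) < e" using e by (simp add: ennreal_less_iff)
    qed
  qed
qed

text \<open>Closed sets generate the Borel sets and are stable under intersection; the indicator of
  a nonempty closed set is the pointwise limit of \<open>max 0 (1 - n * infdist x F)\<close>, which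
  is \<open>n\<close>-Lipschitz with values in the unit interval.\<close>

lemma prob_measure_eqI_lipschitz:
  fixes P Q :: "'a::metric_space measure"
  assumes P: "P \<in> probs borel" and Q: "Q \<in> probs borel"
    and eq: "\<And>f L. (\<And>x y. \<bar>f x - f y\<bar> \<le> L * dist x y) \<Longrightarrow> (\<And>x. \<bar>f x\<bar> \<le> 1) \<Longrightarrow> (\<integral>x. f x \<partial>P) = (\<integral>x. (f x :: real) \<partial>Q)"
  shows "P = Q"
proof (rule measure_eqI_generator_eq[where \<Omega>=UNIV and E="Collect closed" and A="\<lambda>_. UNIV"])
  note p = probsD[OF P] and q = probsD[OF Q]
  interpret P: prob_space P by (rule p)
  interpret Q: prob_space Q by (rule q)
  show "sets P = sigma_sets UNIV (Collect closed)" "sets Q = sigma_sets UNIV (Collect closed)"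
    using p q by (auto simp: borel_eq_closed)
  show "Int_stable (Collect closed :: 'a set set)" by (auto simp: Int_stable_def)
  show "emeasure P UNIV \<noteq> \<infinity>" by simp
  fix F :: "'a set" assume "F \<in> Collect closed"
  then have F: "closed F" by simp
  show "emeasure P F = emeasure Q F"
  proof (cases "F = {}")
    case False
    define f where "f n x = max 0 (1 - real n * infdist x F)" for n x
    have lip: "\<bar>f n x - f n y\<bar> \<le> real n * dist x y" for n x y
    proof -
      have "\<bar>infdist x F - infdist y F\<bar> \<le> dist x y"
        using infdist_triangle[of x F y] infdist_triangle[of y F x] by (auto simp: dist_commute abs_le_iff)
      then have "real n * \<bar>infdist x F - infdist y F\<bar> \<le> real n * dist x y" by (intro mult_left_mono) auto
      then have "\<bar>real n * infdist x F - real n * infdist y F\<bar> \<le> real n * dist x y"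
        by (simp add: abs_mult flip: right_diff_distrib)
      then show ?thesis unfolding f_def max_def by (auto split: if_splits)
    qed
    have bd: "\<bar>f n x\<bar> \<le> 1" for n x by (auto simp: f_def max_def infdist_nonneg)
    have meas: "f n \<in> borel_measurable borel" for n
      unfolding f_def by (intro borel_measurable_continuous_onI continuous_intros)
    have lim: "(\<lambda>n. f n x) \<longlonglongrightarrow> indicator F x" for x
    proof (cases "x \<in> F")
      case True
      then show ?thesis by (simp add: f_def)
    next
      case False
      then have pos: "infdist x F > 0"
        using F \<open>F \<noteq> {}\<close> by (metis in_closed_iff_infdist_zero infdist_nonneg less_eq_real_def)
      obtain n0 :: nat where n0: "1 / infdist x F \<le> real n0" using real_arch_simple by blast
      have "f n x = 0" if "n \<ge> n0" for n
      proof -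
        have "1 / infdist x F \<le> real n" using n0 that by linarith
        then show ?thesis using pos by (simp add: f_def field_simps)
      qed
      then have "\<forall>\<^sub>F n in sequentially. f n x = 0" by (auto simp: eventually_sequentially)
      then show ?thesis using False by (simp add: tendsto_eventually)
    qed
    have "(\<lambda>n. \<integral>x. f n x \<partial>M) \<longlonglongrightarrow> measure M F" if "M \<in> probs borel" for M :: "'a measure"
    proof -
      note m = probsD[OF that]
      interpret M: prob_space M by (rule m)
      have "(\<lambda>n. \<integral>x. f n x \<partial>M) \<longlonglongrightarrow> (\<integral>x. indicator F x \<partial>M)"
        by (rule integral_dominated_convergence[where w="\<lambda>_. 1"])
          (use m meas F lim bd in \<open>auto cong: measurable_cong_sets\<close>)
      moreover have "(\<integral>x. indicator F x \<partial>M) = measure M F" using F m by simp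
      ultimately show ?thesis by simp
    qed
    from this[OF P] this[OF Q] have "measure P F = measure Q F"
      using eq[OF lip bd] LIMSEQ_unique by simp
    then show ?thesis by (simp add: P.emeasure_eq_measure Q.emeasure_eq_measure)
  qed simp
qed auto

lemma marginals_of_narrow_limit:
  fixes \<mu> :: "real \<Rightarrow> (real^'d) measure"
  assumes \<eta>: "\<And>n. \<eta> n \<in> probs (borel_of (curves a b))" and \<eta>': "\<eta>' \<in> probs (borel_of (curves a b))"
    and narrow: "narrowly_converges (curves a b) \<eta> \<eta>'" and t: "t \<in> {a..b}" and \<mu>: "\<mu> t \<in> probs borel"
    and W: "(\<lambda>n. wasserstein (distr (\<eta> n) borel (\<lambda>\<gamma>. \<gamma> t)) (\<mu> t)) \<longlonglongrightarrow> 0"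
  shows "\<mu> t = distr \<eta>' borel (\<lambda>\<gamma>. \<gamma> t)"
proof (rule prob_measure_eqI_lipschitz[OF \<mu>])
  have ev: "(\<lambda>\<gamma>. \<gamma> t) \<in> M \<rightarrow>\<^sub>M borel" if "M \<in> probs (borel_of (curves a b))" for M :: "(real \<Rightarrow> real^'d) measure"
    using measurable_eval[OF t] probsD(2)[OF that] by (simp cong: measurable_cong_sets)
  show "distr \<eta>' borel (\<lambda>\<gamma>. \<gamma> t) \<in> probs borel"
    using prob_space.prob_space_distr[OF probsD(1)[OF \<eta>'] ev[OF \<eta>']] by (simp add: space_prob_algebra)
  fix f :: "real^'d \<Rightarrow> real" and L
  assume lip: "\<And>x y. \<bar>f x - f y\<bar> \<le> L * dist x y" and bd: "\<And>x. \<bar>f x\<bar> \<le> 1"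
  have f: "continuous_on UNIV f" using lip by (rule continuous_on_of_dist_bound)
  have fm: "f \<in> borel_measurable borel" using f by (rule borel_measurable_continuous_onI)
  have "continuous_map (curves a b) euclideanreal (\<lambda>\<gamma>. f (\<gamma> t))"
    using continuous_map_compose[OF continuous_map_eval[OF t], of euclideanreal f] f by (simp add: comp_def)
  moreover have "bounded ((\<lambda>\<gamma>. f (\<gamma> t)) ` topspace (curves a b))"
    using bd by (auto simp: bounded_iff)
  ultimately have "(\<lambda>n. \<integral>\<gamma>. f (\<gamma> t) \<partial>\<eta> n) \<longlonglongrightarrow> (\<integral>\<gamma>. f (\<gamma> t) \<partial>\<eta>')"
    using narrow unfolding narrowly_converges_def by blast
  then have "(\<lambda>n. \<integral>x. f x \<partial>distr (\<eta> n) borel (\<lambda>\<gamma>. \<gamma> t)) \<longlonglongrightarrow> (\<integral>x. f x \<partial>distr \<eta>' borel (\<lambda>\<gamma>. \<gamma> t))"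
    by (simp add: integral_distr[OF ev[OF \<eta>] fm] integral_distr[OF ev[OF \<eta>'] fm])
  moreover have "(\<lambda>n. \<integral>x. f x \<partial>distr (\<eta> n) borel (\<lambda>\<gamma>. \<gamma> t)) \<longlonglongrightarrow> (\<integral>x. f x \<partial>\<mu> t)"
    using W lip bd by (rule wasserstein_tendsto_integral)
  ultimately show "(\<integral>x. f x \<partial>\<mu> t) = (\<integral>x. f x \<partial>distr \<eta>' borel (\<lambda>\<gamma>. \<gamma> t))"
    using LIMSEQ_unique by blast
qed

text \<open>The first conjunct justifies the convention that \<open>N\<close> is large enough: it
  holds for all but finitely many \<open>N\<close>. The second covers every \<open>N\<close> for
  which mass is preserved, and in the third \<open>r\<close> enumerates the values of
  \<open>N\<close> along the subsequence.\<close>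

theorem proposition3p7:
  fixes T :: real
    and V :: "(real^'d) measure \<Rightarrow> ((real^'d) \<times> (real^'d)) measure"
    and \<mu>0 :: "(real^'d) measure"
    and \<mu> :: "real \<Rightarrow> (real^'d) measure"
  assumes "T > 0"
    and "pvf V"
    and "pvf_growth V"
    and "pvf_continuous V"
    and "\<mu>0 \<in> probs_c"
    and "pvf_solution T V \<mu>0 \<mu>"
    and "(\<lambda>N. SUP t\<in>{0..T}. wasserstein (LAS T V \<mu>0 N t) (\<mu> t)) \<longlonglongrightarrow> 0"
  shows "(\<forall>\<^sub>F N in sequentially. no_mass_lost T V \<mu>0 N) \<and>
    (\<forall>N\<ge>1. no_mass_lost T V \<mu>0 N \<longrightarrow>
       prob_representation T (eta T V \<mu>0 N) (LAS T V \<mu>0 N)) \<and>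
    (\<exists>r \<eta>. strict_mono r \<and>
       narrowly_converges (curves 0 T) (\<lambda>n. eta T V \<mu>0 (r n)) \<eta> \<and>
       prob_representation T \<eta> \<mu>)"
proof (intro conjI allI impI)
  note T = \<open>T > 0\<close> and V = \<open>pvf V\<close>
  obtain B L N0 where N0: "\<And>N. N \<ge> N0 \<Longrightarrow> N \<ge> 1 \<and> no_mass_lost T V \<mu>0 N \<and>
     (AE x in LAS_initial T \<mu>0 N. norm x \<le> B) \<and>
     (\<forall>l<N. \<forall>x v. mv V N (LAS_node T V \<mu>0 N l) (x, v) \<noteq> 0 \<longrightarrow> norm v \<le> L)"
    using eventually_uniformly_bounded[OF T V \<open>pvf_growth V\<close> \<open>\<mu>0 \<in> probs_c\<close>] by metis
  then show "\<forall>\<^sub>F N in sequentially. no_mass_lost T V \<mu>0 N"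
    by (auto simp: eventually_sequentially)
  show rep: "prob_representation T (eta T V \<mu>0 N) (LAS T V \<mu>0 N)" if "N \<ge> 1" "no_mass_lost T V \<mu>0 N" for N
    using mass_preserving.eta_representation[of T V \<mu>0 N] T V that by (simp add: mass_preserving_def)
  \<comment> \<open>Shifting by \<open>N0\<close> makes the uniform bounds available for every
    member of the sequence.\<close>
  define \<eta>N where "\<eta>N n = eta T V \<mu>0 (N0 + n)" for n
  have rep': "prob_representation T (\<eta>N n) (LAS T V \<mu>0 (N0 + n))" for n
    unfolding \<eta>N_def using N0[of "N0 + n"] by (intro rep) auto
  have \<eta>N: "\<eta>N n \<in> probs (borel_of (curves 0 T))" for n
    using rep'[of n] by (simp add: prob_representation_def)
  have marginal: "distr (\<eta>N n) borel (\<lambda>\<gamma>. \<gamma> t) = LAS T V \<mu>0 (N0 + n) t" if "t \<in> {0..T}" for n t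
    using rep'[of n] that by (simp add: prob_representation_def)
  have lip: "AE \<gamma> in \<eta>N n. \<gamma> \<in> lipschitz_curves 0 T (max L 0)" for n
    unfolding \<eta>N_def using N0[of "N0 + n"] T V
    by (intro mass_preserving.eta_lipschitz) (auto simp: mass_preserving_def intro: max.coboundedI1)
  have bd: "AE \<gamma> in \<eta>N n. norm (\<gamma> 0) \<le> B" for n
  proof -
    have "AE x in distr (\<eta>N n) borel (\<lambda>\<gamma>. \<gamma> 0). norm x \<le> B"
    proof -
      have "distr (\<eta>N n) borel (\<lambda>\<gamma>. \<gamma> 0) = LAS_initial T \<mu>0 (N0 + n)"
        using marginal[of 0 n] T by (simp add: LAS_def)
      then show ?thesis using N0[of "N0 + n"] by (metis le_add1)
    qed
    moreover have "(\<lambda>\<gamma>. \<gamma> 0) \<in> \<eta>N n \<rightarrow>\<^sub>M borel"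
      using measurable_eval[of 0 0 T] T probsD(2)[OF \<eta>N] by (simp cong: measurable_cong_sets)
    ultimately show ?thesis by (rule AE_distrD[rotated])
  qed
  obtain r \<eta> where r: "strict_mono r" and \<eta>: "\<eta> \<in> probs (borel_of (curves 0 T))"
    and narrow: "narrowly_converges (curves 0 T) (\<lambda>n. \<eta>N (r n)) \<eta>"
    using lipschitz_curves_narrow_subsequence[of 0 T _ \<eta>N, OF _ _ \<eta>N lip bd] T by auto
  \<comment> \<open>Undoes the shift, so that the subsequence refers to the original index
    \<open>N\<close>.\<close>
  define R where "R n = N0 + r n" for n
  have R: "strict_mono R" using r by (simp add: strict_mono_def R_def)
  have "\<mu> t = distr \<eta> borel (\<lambda>\<gamma>. \<gamma> t)" if t: "t \<in> {0..T}" for t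
  proof (rule marginals_of_narrow_limit[OF \<eta>N \<eta> narrow t])
    show "\<mu> t \<in> probs borel" using \<open>pvf_solution T V \<mu>0 \<mu>\<close> t by (simp add: pvf_solution_def)
    have "(\<lambda>n. SUP t\<in>{0..T}. wasserstein (LAS T V \<mu>0 (R n) t) (\<mu> t)) \<longlonglongrightarrow> 0"
      using LIMSEQ_subseq_LIMSEQ[OF assms(7) R] by (simp add: comp_def)
    then have "(\<lambda>n. wasserstein (LAS T V \<mu>0 (R n) t) (\<mu> t)) \<longlonglongrightarrow> 0"
    proof (rule tendsto_sandwich[OF _ _ tendsto_const, rotated 2])
      show "\<forall>\<^sub>F n in sequentially. wasserstein (LAS T V \<mu>0 (R n) t) (\<mu> t)
          \<le> (SUP t\<in>{0..T}. wasserstein (LAS T V \<mu>0 (R n) t) (\<mu> t))"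
        using t by (intro always_eventually allI SUP_upper)
    qed simp
    then show "(\<lambda>n. wasserstein (distr (\<eta>N (r n)) borel (\<lambda>\<gamma>. \<gamma> t)) (\<mu> t)) \<longlonglongrightarrow> 0"
      using marginal[OF t] by (simp add: R_def)
  qed
  then show "\<exists>r \<eta>. strict_mono r \<and> narrowly_converges (curves 0 T) (\<lambda>n. eta T V \<mu>0 (r n)) \<eta> \<and> prob_representation T \<eta> \<mu>"
    using R narrow \<eta> by (intro exI[of _ R] exI[of _ \<eta>]) (simp add: prob_representation_def \<eta>N_def R_def)
qed

end
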